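(* Consider the following decision problem: given a labelled Markov chain $\mathcal{M}'$, a number $\epsilon_2\in(0,1]$ and a positive integer $k$, decide whether there exists an $\epsilon_2$-quotient of $\mathcal{M}'$ of size $k$ (i.e. with exactly $k$ states). This problem is $\mathsf{NP}$-complete. Moreover, it is $\mathsf{NP}$-hard even for fixed $k=5$.
   Context: A labelled Markov chain (LMC) is a quadruple $\langle S,L,\tau,\ell\rangle$ with $S$ a nonempty finite set of states, $L$ a nonempty finite set of labels, $\tau:S\to\mathrm{Distr}(S)$ a transition function ($\mathrm{Distr}(S)$ is the set of probability distributions on $S$), and $\ell:S\to L$ a labelling function. For $E\subseteq S$ write $\tau(s)(E)=\sum_{t\in E}\tau(s)(t)$. The size of an LMC is its number of states. An equivalence relation $\mathcal{R}\subseteq S\times S$ is a probabilistic bisimulation if for all $(s,t)\in\mathcal{R}$ we have $\ell(s)=\ell(t)$ and $\tau(s)(E)=\tau(t)(E)$ for each $\mathcal{R}$-equivalence class $E$. Probabilistic bisimilarity $\sim_{\mathcal{M}}$ is the largest probabilistic bisimulation on $\mathcal{M}$. A probabilistic bisimulation $\mathcal{R}$ induces the quotient LMC $\mathcal{M}/_{\mathcal{R}}=\langle S/_{\mathcal{R}},L,\tau/_{\mathcal{R}},\ell/_{\mathcal{R}}\rangle$ with $\tau/_{\mathcal{R}}([s])([t])=\tau(s)([t])$ and $\ell/_{\mathcal{R}}([s])=\ell(s)$. For $\epsilon\ge 0$, an LMC $\mathcal{Q}$ is an $\epsilon$-quotient of $\mathcal{M}=\langle S,L,\tau,\ell\rangle$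 if there is a transition function $\tau':S\to\mathrm{Distr}(S)$ with $\|\tau'(s)-\tau(s)\|_1\le\epsilon$ for all $s\in S$ such that $\mathcal{Q}$ is (up to isomorphism, i.e. renaming of states) the bisimulation quotient $\mathcal{N}/_{\sim_{\mathcal{N}}}$ of $\mathcal{N}=\langle S,L,\tau',\ell\rangle$. Here $\|\mu\|_1=\sum_{s}|\mu(s)|$. Convention: the transition probabilities of the input and $\epsilon_2$ are rationals encoded in binary (as fractions of integers). $\mathsf{NP}$-hardness is with respect to polynomial-time many-one reductions. *)

theory Defs
  imports Complex_Main "HOL-Computational_Algebra.Polynomial"
begin

section \<open>Labelled Markov chains, bisimilarity and \<open>\<epsilon>\<close>-quotients\<close>

text \<open>The fields \<open>prob\<close> and \<open>label\<close> are only meaningful on \<open>states\<close>; every notion below looks at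
  them there only.\<close>

record ('s, 'l) lmc =
  states :: "'s set"
  labels :: "'l set"
  prob :: "'s \<Rightarrow> 's \<Rightarrow> real"
  label :: "'s \<Rightarrow> 'l"

definition is_distr :: "'s set \<Rightarrow> ('s \<Rightarrow> real) \<Rightarrow> bool" where
  "is_distr S \<mu> \<longleftrightarrow> (\<forall>s\<in>S. 0 \<le> \<mu> s) \<and> (\<Sum>s\<in>S. \<mu> s) = 1"

definition is_lmc :: "('s, 'l) lmc \<Rightarrow> bool" where
  "is_lmc M \<longleftrightarrow>
     finite (states M) \<and> states M \<noteq> {} \<and> finite (labels M) \<and> labels M \<noteq> {} \<and>
     (\<forall>s\<in>states M. is_distr (states M) (prob M s) \<and> label M s \<in> labels M)"

definition prob_bisimulation :: "('s, 'l) lmc \<Rightarrow> ('s \<times> 's) set \<Rightarrow> bool" where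
  "prob_bisimulation M R \<longleftrightarrow>
     equiv (states M) R \<and>
     (\<forall>(s, t)\<in>R. label M s = label M t \<and>
        (\<forall>E\<in>states M // R. (\<Sum>u\<in>E. prob M s u) = (\<Sum>u\<in>E. prob M t u)))"

text \<open>That a largest probabilistic bisimulation exists (for every finite state space) is shown
  in \<open>bisimilarity_largest\<close> below.\<close>

definition bisimilarity :: "('s, 'l) lmc \<Rightarrow> ('s \<times> 's) set" where
  "bisimilarity M = (GREATEST R. prob_bisimulation M R)"

text \<open>The value on a class is read off at a chosen representative; if \<open>R\<close> is a probabilistic
  bisimulation, the choice does not matter.\<close>

definition quotient_lmc :: "('s, 'l) lmc \<Rightarrow> ('s \<times> 's) set \<Rightarrow> ('s set, 'l) lmc" where
  "quotient_lmc M R =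
     \<lparr>states = states M // R,
      labels = labels M,
      prob = (\<lambda>C D. \<Sum>t\<in>D. prob M (SOME s. s \<in> C) t),
      label = (\<lambda>C. label M (SOME s. s \<in> C))\<rparr>"

definition lmc_isomorphic :: "('s, 'l) lmc \<Rightarrow> ('t, 'l) lmc \<Rightarrow> bool" where
  "lmc_isomorphic M N \<longleftrightarrow>
     labels M = labels N \<and>
     (\<exists>f. bij_betw f (states M) (states N) \<and>
        (\<forall>s\<in>states M. label N (f s) = label M s \<and>
           (\<forall>t\<in>states M. prob N (f s) (f t) = prob M s t)))"

definition is_eps_quotient :: "real \<Rightarrow> ('t, 'l) lmc \<Rightarrow> ('s, 'l) lmc \<Rightarrow> bool" where
  "is_eps_quotient \<epsilon> Q M \<longleftrightarrow>
     is_lmc Q \<and>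
     (\<exists>\<tau>'. (\<forall>s\<in>states M. is_distr (states M) (\<tau>' s) \<and>
              (\<Sum>t\<in>states M. \<bar>\<tau>' s t - prob M s t\<bar>) \<le> \<epsilon>) \<and>
        (let N = M\<lparr>prob := \<tau>'\<rparr> in lmc_isomorphic Q (quotient_lmc N (bisimilarity N))))"

text \<open>Quotients matter only up to renaming of states and are finite, so it is no restriction to
  take their states from \<^typ>\<open>nat\<close>.\<close>

definition has_eps_quotient_of_size :: "('s, 'l) lmc \<Rightarrow> real \<Rightarrow> nat \<Rightarrow> bool" where
  "has_eps_quotient_of_size M \<epsilon> k \<longleftrightarrow>
     (\<exists>Q :: (nat, 'l) lmc. is_eps_quotient \<epsilon> Q M \<and> card (states Q) = k)"


section \<open>Multi-tape Turing machines and polynomial time\<close>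

text \<open>Tapes are infinite in both directions. States and tape symbols are initial segments of
  \<^typ>\<open>nat\<close>; symbol \<open>0\<close> is the blank, \<open>1\<close> and \<open>2\<close> stand for the bits \<open>False\<close> and \<open>True\<close>. State \<open>0\<close>
  is the initial state and state \<open>1\<close> the halting state.\<close>

datatype move = Move_Left | Stay | Move_Right

record tm =
  n_tapes :: nat
  n_states :: nat
  n_symbols :: nat
  delta :: "nat \<Rightarrow> nat list \<Rightarrow> nat \<times> (nat \<times> move) list"

definition is_tm :: "tm \<Rightarrow> bool" where
  "is_tm M \<longleftrightarrow>
     1 \<le> n_tapes M \<and> 2 \<le> n_states M \<and> 3 \<le> n_symbols M \<and>
     (\<forall>q as. q < n_states M \<and> length as = n_tapes M \<and> (\<forall>a\<in>set as. a < n_symbols M) \<longrightarrow>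
        (case delta M q as of (q', acts) \<Rightarrow>
           q' < n_states M \<and> length acts = n_tapes M \<and> (\<forall>(b, m)\<in>set acts. b < n_symbols M)))"

type_synonym tape = "(int \<Rightarrow> nat) \<times> int"
type_synonym config = "nat \<times> tape list"

fun read_tape :: "tape \<Rightarrow> nat" where
  "read_tape (c, h) = c h"

fun displacement :: "move \<Rightarrow> int" where
  "displacement Move_Left = - 1"
| "displacement Stay = 0"
| "displacement Move_Right = 1"

fun act_on_tape :: "nat \<times> move \<Rightarrow> tape \<Rightarrow> tape" where
  "act_on_tape (b, m) (c, h) = (c(h := b), h + displacement m)"

fun tm_step :: "tm \<Rightarrow> config \<Rightarrow> config" where
  "tm_step M (q, ts) =
     (if q = 1 then (q, ts)
      else case delta M q (map read_tape ts) of (q', acts) \<Rightarrow> (q', map2 act_on_tape acts ts))"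

definition word_tape :: "bool list \<Rightarrow> int \<Rightarrow> nat" where
  "word_tape w i =
     (if 0 \<le> i \<and> i < int (length w) then (if w ! nat i then 2 else 1) else 0)"

text \<open>The \<open>j\<close>-th input word is written on tape \<open>j\<close>, starting at position \<open>0\<close>; further tapes are
  blank.\<close>

definition tm_init :: "tm \<Rightarrow> bool list list \<Rightarrow> config" where
  "tm_init M ws =
     (0, map (\<lambda>j. (word_tape (if j < length ws then ws ! j else []), 0)) [0..<n_tapes M])"

text \<open>The output is the content of the last tape.\<close>

definition tm_computes_within :: "tm \<Rightarrow> nat \<Rightarrow> bool list list \<Rightarrow> bool list \<Rightarrow> bool" where
  "tm_computes_within M T ws y \<longleftrightarrow>
     (\<exists>t\<le>T. case (tm_step M ^^ t) (tm_init M ws) of (q, ts) \<Rightarrow>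
        q = 1 \<and> fst (last ts) = word_tape y)"

definition poly_time_computable :: "nat \<Rightarrow> (bool list list \<Rightarrow> bool list) \<Rightarrow> bool" where
  "poly_time_computable n f \<longleftrightarrow>
     (\<exists>M (p :: nat poly). is_tm M \<and> n \<le> n_tapes M \<and>
        (\<forall>ws. length ws = n \<longrightarrow>
           tm_computes_within M (poly p (sum_list (map length ws))) ws (f ws)))"


section \<open>NP-completeness\<close>

type_synonym language = "bool list set"

definition NP :: "language set" where
  "NP = {A. \<exists>V (p :: nat poly).
     poly_time_computable 2 (\<lambda>ws. [V (ws ! 0) (ws ! 1)]) \<and>
     (\<forall>x. x \<in> A \<longleftrightarrow> (\<exists>w. length w \<le> poly p (length x) \<and> V x w))}"

definition poly_time_reducible :: "language \<Rightarrow> language \<Rightarrow> bool" where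
  "poly_time_reducible A B \<longleftrightarrow>
     (\<exists>f. poly_time_computable 1 (\<lambda>ws. f (ws ! 0)) \<and> (\<forall>x. x \<in> A \<longleftrightarrow> f x \<in> B))"

definition NP_hard :: "language \<Rightarrow> bool" where
  "NP_hard B \<longleftrightarrow> (\<forall>A\<in>NP. poly_time_reducible A B)"

definition NP_complete :: "language \<Rightarrow> bool" where
  "NP_complete B \<longleftrightarrow> B \<in> NP \<and> NP_hard B"


section \<open>The decision problems\<close>

subsection \<open>Concrete instances\<close>

type_synonym fraction = "nat \<times> nat"

fun fraction_value :: "fraction \<Rightarrow> real" where
  "fraction_value (a, b) = real a / real b"

text \<open>The states are \<open>0, \<dots>, n - 1\<close>, where \<open>n\<close> is the length of \<open>state_labels\<close>; \<open>label_names\<close> lists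
  the elements of the label set, which may contain labels that no state carries.\<close>

record lmc_code =
  label_names :: "nat list"
  state_labels :: "nat list"
  prob_rows :: "fraction list list"

definition lmc_of_code :: "lmc_code \<Rightarrow> (nat, nat) lmc" where
  "lmc_of_code c =
     \<lparr>states = {..<length (state_labels c)},
      labels = set (label_names c),
      prob = (\<lambda>s t. fraction_value (prob_rows c ! s ! t)),
      label = (\<lambda>s. state_labels c ! s)\<rparr>"

definition valid_lmc_code :: "lmc_code \<Rightarrow> bool" where
  "valid_lmc_code c \<longleftrightarrow>
     (let n = length (state_labels c) in
        length (prob_rows c) = n \<and>
        (\<forall>row\<in>set (prob_rows c). length row = n \<and> (\<forall>(a, b)\<in>set row. 0 < b))) \<and>
     is_lmc (lmc_of_code c)"

definition valid_eps :: "fraction \<Rightarrow> bool" where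
  "valid_eps e \<longleftrightarrow> 0 < snd e \<and> 0 < fraction_value e \<and> fraction_value e \<le> 1"


subsection \<open>Encoding as bit strings\<close>

text \<open>Self-delimiting encodings. Numbers are written in binary, least significant bit first.\<close>

fun binary :: "nat \<Rightarrow> bool list" where
  "binary n = (if n = 0 then [] else odd n # binary (n div 2))"

declare binary.simps [simp del]

definition enc_list :: "('a \<Rightarrow> bool list) \<Rightarrow> 'a list \<Rightarrow> bool list" where
  "enc_list f xs = concat (map (\<lambda>x. True # f x) xs) @ [False]"

definition enc_nat :: "nat \<Rightarrow> bool list" where
  "enc_nat n = enc_list (\<lambda>b. [b]) (binary n)"

fun enc_fraction :: "fraction \<Rightarrow> bool list" where
  "enc_fraction (a, b) = enc_nat a @ enc_nat b"

definition enc_lmc :: "lmc_code \<Rightarrow> bool list" where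
  "enc_lmc c =
     enc_list enc_nat (label_names c) @
     enc_list enc_nat (state_labels c) @
     enc_list (enc_list enc_fraction) (prob_rows c)"


subsection \<open>The problems as languages\<close>

definition EPS_QUOTIENT :: language where
  "EPS_QUOTIENT =
     {enc_lmc c @ enc_fraction e @ enc_nat k | c e k.
        valid_lmc_code c \<and> valid_eps e \<and> 1 \<le> k \<and>
        has_eps_quotient_of_size (lmc_of_code c) (fraction_value e) k}"

definition EPS_QUOTIENT_FIXED :: "nat \<Rightarrow> language" where
  "EPS_QUOTIENT_FIXED k =
     {enc_lmc c @ enc_fraction e | c e.
        valid_lmc_code c \<and> valid_eps e \<and>
        has_eps_quotient_of_size (lmc_of_code c) (fraction_value e) k}"


section \<open>Adequacy of the definitions\<close>

subsection \<open>Existence of the largest probabilistic bisimulation\<close>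

lemma sum_coarser_class:
  assumes "finite S" "equiv S R" "equiv S T" "R \<subseteq> T" "E \<in> S // T"
    and eq: "\<And>D. D \<in> S // R \<Longrightarrow> (\<Sum>u\<in>D. f u) = (\<Sum>u\<in>D. g u)"
  shows "(\<Sum>u\<in>E. f u) = (\<Sum>u\<in>E. (g u :: real))"
proof -
  let ?P = "{D \<in> S // R. D \<subseteq> E}"
  have ES: "E \<subseteq> S" using assms(3,5) by (metis Union_quotient Sup_upper)
  have U: "\<Union>?P = E"
  proof
    show "\<Union>?P \<subseteq> E" by auto
    show "E \<subseteq> \<Union>?P"
    proof
      fix u assume u: "u \<in> E"
      have "E = T `` {u}" using assms(3,5) u
        by (metis ES Image_singleton_iff equiv_class_eq_iff quotientE)
      hence "R `` {u} \<subseteq> E" using assms(4) by auto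
      moreover have "u \<in> R `` {u}" using u ES assms(2) by (meson equiv_class_self subsetD)
      moreover have "R `` {u} \<in> S // R" using u ES by (auto intro: quotientI)
      ultimately show "u \<in> \<Union>?P" by blast
    qed
  qed
  have fin: "\<forall>D\<in>?P. finite D" using ES assms(1) by (auto intro: finite_subset)
  have disj: "\<forall>A\<in>?P. \<forall>B\<in>?P. A \<noteq> B \<longrightarrow> A \<inter> B = {}"
    using quotient_disj[OF assms(2)] by blast
  have "(\<Sum>u\<in>\<Union>?P. f u) = (\<Sum>D\<in>?P. \<Sum>u\<in>D. f u)"
    by (rule sum.Union_disjoint[OF fin disj, unfolded comp_def])
  also have "\<dots> = (\<Sum>D\<in>?P. \<Sum>u\<in>D. g u)" by (rule sum.cong) (auto simp: eq)
  also have "\<dots> = (\<Sum>u\<in>\<Union>?P. g u)"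
    by (rule sum.Union_disjoint[OF fin disj, unfolded comp_def, symmetric])
  finally show ?thesis by (simp add: U)
qed

lemma bisimilarity_largest:
  assumes "finite (states M)"
  shows "prob_bisimulation M (bisimilarity M)"
    and "prob_bisimulation M R \<Longrightarrow> R \<subseteq> bisimilarity M"
proof -
  define U where "U = \<Union>{R. prob_bisimulation M R}"
  define T where "T = U\<^sup>+"
  have U_I: "(s, t) \<in> U" if "prob_bisimulation M R" "(s, t) \<in> R" for R s t
    using that unfolding U_def by blast
  have U_E: "\<exists>R. prob_bisimulation M R \<and> (s, t) \<in> R" if "(s, t) \<in> U" for s t
    using that unfolding U_def by blast
  have up: "R \<subseteq> T" if "prob_bisimulation M R" for R
    using U_I[OF that] unfolding T_def by (meson r_into_trancl subrelI)
  have bis_equiv: "equiv (states M) R" if "prob_bisimulation M R" for R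
    using that unfolding prob_bisimulation_def by (rule conjunct1)
  have Id: "prob_bisimulation M (Id_on (states M))"
    unfolding prob_bisimulation_def
    by (auto simp: equiv_def refl_on_def Id_on_def sym_def Relation.trans_def)
  have "T \<subseteq> states M \<times> states M"
    unfolding T_def
    by (rule trancl_subset_Sigma) (use U_E bis_equiv in \<open>force simp: equiv_def\<close>)
  moreover have "refl_on (states M) T"
  proof (rule refl_onI)
    fix s assume "s \<in> states M"
    then have "(s, s) \<in> Id_on (states M)" by blast
    then show "(s, s) \<in> T" using up[OF Id] by blast
  qed
  moreover have "sym T"
    unfolding T_def
  proof (rule sym_trancl, rule symI)
    fix s t assume "(s, t) \<in> U"
    then obtain R where R: "prob_bisimulation M R" "(s, t) \<in> R" using U_E by blast
    then have "(t, s) \<in> R" using bis_equiv[OF R(1)] unfolding equiv_def by (blast dest: symD)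
    then show "(t, s) \<in> U" by (rule U_I[OF R(1)])
  qed
  ultimately have eqT: "equiv (states M) T"
    by (simp add: equiv_def T_def)
  have base_step: "label M s = label M t \<and>
      (\<forall>E\<in>states M // T. (\<Sum>u\<in>E. prob M s u) = (\<Sum>u\<in>E. prob M t u))" if st: "(s, t) \<in> U" for s t
  proof -
    obtain R where R: "prob_bisimulation M R" "(s, t) \<in> R" using U_E[OF st] by blast
    have sub: "R \<subseteq> T" by (rule up[OF R(1)])
    have eqR: "equiv (states M) R"
      and lab: "label M s = label M t"
      and cls: "\<And>D. D \<in> states M // R \<Longrightarrow> (\<Sum>u\<in>D. prob M s u) = (\<Sum>u\<in>D. prob M t u)"
      using R unfolding prob_bisimulation_def by auto
    show ?thesis
      using lab sum_coarser_class[OF assms eqR eqT sub _ cls] by simp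
  qed
  have P: "label M s = label M t \<and>
      (\<forall>E\<in>states M // T. (\<Sum>u\<in>E. prob M s u) = (\<Sum>u\<in>E. prob M t u))" if "(s, t) \<in> T" for s t
    using that unfolding T_def
  proof (induction rule: trancl_induct)
    case (base y)
    then show ?case using base_step T_def by simp
  next
    case (step y z)
    show ?case using base_step[OF step(2)] step(3) T_def by simp
  qed
  have T: "prob_bisimulation M T"
    unfolding prob_bisimulation_def using eqT P by blast
  have "bisimilarity M = T"
    unfolding bisimilarity_def by (rule Greatest_equality) (rule T, rule up)
  then show "prob_bisimulation M (bisimilarity M)"
    and "prob_bisimulation M R \<Longrightarrow> R \<subseteq> bisimilarity M"
    using T up by simp_all
qed


subsection \<open>Distinct instances have distinct encodings\<close>

definition prefix_free :: "('a \<Rightarrow> bool list) \<Rightarrow> bool" where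
  "prefix_free f \<longleftrightarrow> (\<forall>x y u v. f x @ u = f y @ v \<longrightarrow> x = y \<and> u = v)"

lemma prefix_freeD: "prefix_free f \<Longrightarrow> f x @ u = f y @ v \<Longrightarrow> x = y \<and> u = v"
  unfolding prefix_free_def by blast

lemma prefix_free_inject: "prefix_free f \<Longrightarrow> f x = f y \<Longrightarrow> x = y"
  using prefix_freeD[of f x "[]" y "[]"] by simp

lemma prefix_free_enc_list:
  assumes "prefix_free f"
  shows "prefix_free (enc_list f)"
proof -
  have "xs = ys \<and> u = v" if "enc_list f xs @ u = enc_list f ys @ v" for xs ys u v
    using that
  proof (induction xs arbitrary: ys)
    case Nil
    then show ?case by (cases ys) (auto simp: enc_list_def)
  next
    case (Cons x xs)
    then obtain y ys' where ys: "ys = y # ys'" by (cases ys) (auto simp: enc_list_def)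
    with Cons.prems have "f x @ (enc_list f xs @ u) = f y @ (enc_list f ys' @ v)"
      by (simp add: enc_list_def)
    then have "x = y" "enc_list f xs @ u = enc_list f ys' @ v"
      using assms unfolding prefix_free_def by blast+
    then show ?case using Cons.IH ys by simp
  qed
  then show ?thesis unfolding prefix_free_def by blast
qed

lemma binary_rec: "binary 0 = []" "n \<noteq> 0 \<Longrightarrow> binary n = odd n # binary (n div 2)"
  by (simp_all add: binary.simps[of 0] binary.simps[of n])

lemma binary_inject: "binary m = binary n \<Longrightarrow> m = n"
proof (induction m arbitrary: n rule: less_induct)
  case (less m)
  show ?case
  proof (cases "m = 0 \<or> n = 0")
    case True
    with less.prems show ?thesis
      by (cases "m = 0"; cases "n = 0") (simp_all add: binary_rec)
  next
    case False
    with less.prems have parity: "odd m = odd n" and "binary (m div 2) = binary (n div 2)"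
      by (simp_all add: binary_rec)
    with False have half: "m div 2 = n div 2" using less.IH[of "m div 2"] by simp
    have "m mod 2 = n mod 2" using parity by (simp add: mod2_eq_if)
    with half show ?thesis by (metis div_mult_mod_eq)
  qed
qed

lemma prefix_free_enc_nat: "prefix_free enc_nat"
proof -
  have bits: "prefix_free (enc_list (\<lambda>b. [b]))"
    by (rule prefix_free_enc_list) (simp add: prefix_free_def)
  have "m = n \<and> u = v" if "enc_nat m @ u = enc_nat n @ v" for m n u v
    using prefix_freeD[OF bits that[unfolded enc_nat_def]] binary_inject by blast
  then show ?thesis unfolding prefix_free_def by blast
qed

lemma prefix_free_enc_fraction: "prefix_free enc_fraction"
proof -
  have "x = y \<and> u = v" if eq: "enc_fraction x @ u = enc_fraction y @ v" for x y u v
  proof -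
    obtain a b c d where xy: "x = (a, b)" "y = (c, d)" by (cases x, cases y)
    have "enc_nat a @ (enc_nat b @ u) = enc_nat c @ (enc_nat d @ v)"
      using eq by (simp add: xy)
    from prefix_freeD[OF prefix_free_enc_nat this]
    have "a = c" and "enc_nat b @ u = enc_nat d @ v" by simp_all
    with prefix_freeD[OF prefix_free_enc_nat this(2)] show ?thesis by (simp add: xy)
  qed
  then show ?thesis unfolding prefix_free_def by blast
qed

lemma prefix_free_enc_lmc: "prefix_free enc_lmc"
proof -
  have nats: "prefix_free (enc_list enc_nat)"
    by (intro prefix_free_enc_list prefix_free_enc_nat)
  have rows: "prefix_free (enc_list (enc_list enc_fraction))"
    by (intro prefix_free_enc_list prefix_free_enc_fraction)
  have "c = d \<and> u = v" if eq: "enc_lmc c @ u = enc_lmc d @ v" for c d :: lmc_code and u v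
  proof -
    note 1 = prefix_freeD[OF nats eq[unfolded enc_lmc_def append_assoc]]
    note 2 = prefix_freeD[OF nats conjunct2[OF 1]]
    note 3 = prefix_freeD[OF rows conjunct2[OF 2]]
    from 1 2 3 show ?thesis by simp
  qed
  then show ?thesis unfolding prefix_free_def by blast
qed

lemma enc_instance_inject:
  assumes "enc_lmc c @ enc_fraction e @ enc_nat k = enc_lmc c' @ enc_fraction e' @ enc_nat k'"
  shows "c = c' \<and> e = e' \<and> k = k'"
proof -
  note 1 = prefix_freeD[OF prefix_free_enc_lmc assms]
  note 2 = prefix_freeD[OF prefix_free_enc_fraction conjunct2[OF 1]]
  note 3 = prefix_free_inject[OF prefix_free_enc_nat conjunct2[OF 2]]
  from 1 2 3 show ?thesis by simp
qed

lemma enc_instance_fixed_inject: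
  assumes "enc_lmc c @ enc_fraction e = enc_lmc c' @ enc_fraction e'"
  shows "c = c' \<and> e = e'"
proof -
  note 1 = prefix_freeD[OF prefix_free_enc_lmc assms]
  note 2 = prefix_free_inject[OF prefix_free_enc_fraction conjunct2[OF 1]]
  from 1 2 show ?thesis by simp
qed

lemma word_tape_inject: "word_tape v = word_tape w \<Longrightarrow> v = w"
proof (rule nth_equalityI)
  assume eq: "word_tape v = word_tape w"
  have dom: "word_tape u (int i) \<noteq> 0 \<longleftrightarrow> i < length u" for u i
    by (simp add: word_tape_def)
  show len: "length v = length w"
    using dom[of v] dom[of w] eq by (metis linorder_neqE_nat less_irrefl)
  fix i assume "i < length v"
  with len fun_cong[OF eq, of "int i"] show "v ! i = w ! i"
    by (simp add: word_tape_def split: if_splits)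
qed

end

(*
  Membership: only finitely many sign conditions on a perturbed transition function matter for
  bisimilarity, namely which pairs of rows agree on which sets of states. Simultaneous Diophantine
  approximation turns a feasible real solution of such a linear system with small coefficients into a
  rational one whose denominator has polynomially many bits; partition refinement then computes the
  number of bisimilarity classes in polynomial time.

  Hardness: with five classes, two states of equal label that are too far apart to be merged act as
  truth values, and the states that represent literals lie exactly halfway between them, so each must
  be merged with one of them. All remaining states form the fifth class, which requires their
  probabilities of reaching the class "true" to lie in a window of width epsilon; this expresses
  that a clause has a true literal and that exactly one of v and not v is true. Satisfiability of
  clauses of a length bounded in terms of the verifier captures runs of a multitape Turing machine
  because cells can be addressed relative to the head.

  Polynomial time is handled by while programs on stacks of bits, which compile to Turing machines;
  values are encoded as binary trees, and the functions computed are closed under composition and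
  bounded iteration.
*)

theory Submission
  imports Defs "HOL-Analysis.Kronecker_Approximation_Theorem"
begin

text \<open>The conditions that preserve bisimilarity range over all sets of states, so there are
  exponentially many. This is harmless: the denominator bound \<open>(B + 1) ^ card I\<close>
  depends only on the number of variables and on the l1 norms of the coefficients. Strict conditions
  are expressed through one additional variable, the smallest gap. The verifier never parses its
  input; the certificate contains the instance, which is encoded again and compared.

  In the hardness proof K bounds the clause length, all weights are multiples of 1/(4K), and
  \<epsilon> = (K - 1)/(4K). Two constant rows of weight K + 1 and 2K then fix the window, which
  contains exactly the K integers between them. A clause row starts at K and gains 1 per true
  literal, so the lower end demands a true literal. Starting at 2K - 1 turns the upper end into "at
  most one". K depends on the verifier alone and is a constant of the reduction.

  Iterating a polynomial-time step may square a length in every round, so each loop comes with a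
  polynomial bound on all intermediate values.\<close>

hide_const (open) Sigma_Algebra.binary

section \<open>A while language on stacks and its compilation to Turing machines\<close>

datatype com =
    Skip
  | Push nat bool
  | Seq com com (infixr ";;" 60)
  | Branch nat com com
  | While nat com com

type_synonym store = "nat \<Rightarrow> bool list"

text \<open>\<^const>\<open>Branch\<close> and \<^const>\<open>While\<close> pop the top bit of the tested register and select the
  first command for \<^const>\<open>False\<close>, the second for \<^const>\<open>True\<close>; they fall through on the empty
  register. The costs are the exact numbers of steps of the compiled machine.\<close>

inductive exec :: "com \<Rightarrow> store \<Rightarrow> store \<Rightarrow> nat \<Rightarrow> bool" where
  Skip: "exec Skip s s 0"
| Push: "exec (Push r b) s (s(r := b # s r)) 2"
| Seq: "exec c s s1 t1 \<Longrightarrow> exec d s1 s2 t2 \<Longrightarrow> exec (c ;; d) s s2 (t1 + t2)"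
| Branch_Nil: "s r = [] \<Longrightarrow> exec (Branch r c d) s s 1"
| Branch_F: "s r = False # w \<Longrightarrow> exec c (s(r := w)) s' t \<Longrightarrow> exec (Branch r c d) s s' (t + 2)"
| Branch_T: "s r = True # w \<Longrightarrow> exec d (s(r := w)) s' t \<Longrightarrow> exec (Branch r c d) s s' (t + 1)"
| While_Nil: "s r = [] \<Longrightarrow> exec (While r c d) s s 1"
| While_Cons: "s r = b # w \<Longrightarrow> exec (if b then d else c) (s(r := w)) s1 t1 \<Longrightarrow>
    exec (While r c d) s1 s2 t2 \<Longrightarrow> exec (While r c d) s s2 (t1 + 2 + t2)"

primrec regs :: "com \<Rightarrow> nat set" where
  "regs Skip = {}"
| "regs (Push r b) = {r}"
| "regs (c ;; d) = regs c \<union> regs d"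
| "regs (Branch r c d) = insert r (regs c \<union> regs d)"
| "regs (While r c d) = insert r (regs c \<union> regs d)"

lemma finite_regs [simp]: "finite (regs c)"
  by (induction c) auto

type_synonym instr = "nat \<times> (nat \<Rightarrow> nat \<times> move \<times> nat)"

definition bit_sym :: "bool \<Rightarrow> nat" where
  "bit_sym b = (if b then 2 else 1)"

text \<open>A blank under the head means that the stack is empty. A popped cell is erased because
  \<open>tape_of\<close> has only blanks to the left of the head.\<close>

definition pop_instr :: "nat \<Rightarrow> nat \<Rightarrow> nat \<Rightarrow> nat \<Rightarrow> instr" where
  "pop_instr r e f g = (r, \<lambda>x. if x = 0 then (0, Stay, e) else (0, Move_Right, if x = 1 then f else g))"

definition jump_instr :: "nat \<Rightarrow> instr" where
  "jump_instr q = (0, \<lambda>x. (x, Stay, q))"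

text \<open>Addresses are absolute, \<open>a\<close> being that of the first instruction. Every
  block is left at the address right behind it, so sequencing is concatenation. In
  \<open>Branch\<close> only the first case needs a jump, over the second one; this is the extra
  step in \<open>Branch_F\<close>.\<close>

primrec compile :: "com \<Rightarrow> nat \<Rightarrow> instr list" where
  "compile Skip a = []"
| "compile (Push r b) a = [(r, \<lambda>x. (x, Move_Left, a + 1)), (r, \<lambda>x. (bit_sym b, Stay, a + 2))]"
| "compile (c ;; d) a = compile c a @ compile d (a + length (compile c a))"
| "compile (Branch r c d) a =
     (let C = compile c (a + 1); f = a + length C + 2; D = compile d f; e = f + length D
      in pop_instr r e (a + 1) f # C @ jump_instr e # D)"
| "compile (While r c d) a =
     (let C = compile c (a + 1); f = a + length C + 2; D = compile d f; e = f + length D + 1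
      in pop_instr r e (a + 1) f # C @ jump_instr a # D @ [jump_instr a])"

definition machine :: "nat \<Rightarrow> instr list \<Rightarrow> tm" where
  "machine k P =
     \<lparr>n_tapes = k, n_states = length P, n_symbols = 3,
      delta = \<lambda>q as. case P ! q of (r, f) \<Rightarrow> case f (as ! r) of (w, m, q') \<Rightarrow>
        (q', (map (\<lambda>a. (a, Stay)) as)[r := (w, m)])\<rparr>"

lemma act_Stay: "act_on_tape (read_tape t, Stay) t = t"
  by (cases t) auto

lemma machine_step:
  assumes "q \<noteq> 1" "P ! q = (r, f)" "f (read_tape (ts ! r)) = (w, m, q')" "r < length ts"
  shows "tm_step (machine k P) (q, ts) = (q', ts[r := act_on_tape (w, m) (ts ! r)])"
proof -
  have "map2 act_on_tape ((map (\<lambda>a. (a, Stay)) (map read_tape ts))[r := (w, m)]) ts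
      = ts[r := act_on_tape (w, m) (ts ! r)]"
    by (rule nth_equalityI) (use assms(4) in \<open>auto simp: nth_list_update act_Stay\<close>)
  then show ?thesis using assms by (simp add: machine_def)
qed

text \<open>A register is a stack with its top under the head and its bottom to the right. An input
  tape with head at 0 is therefore a register from the start; pushes and pops make the head position
  drift.\<close>

definition tape_of :: "bool list \<Rightarrow> int \<Rightarrow> tape" where
  "tape_of w h = ((\<lambda>i. word_tape w (i - h)), h)"

lemma read_tape_of [simp]:
  "read_tape (tape_of w h) = (case w of [] \<Rightarrow> 0 | b # _ \<Rightarrow> bit_sym b)"
  by (auto simp: tape_of_def word_tape_def bit_sym_def split: list.split)

lemma word_tape_Cons: "word_tape (b # w) i = (if i = 0 then bit_sym b else word_tape w (i - 1))"
proof -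
  consider "i < 0" | "i = 0" | "i > 0" by linarith
  then show ?thesis
  proof cases
    case 3
    then have "nat i = Suc (nat (i - 1))" by linarith
    with 3 show ?thesis by (auto simp: word_tape_def)
  qed (auto simp: word_tape_def bit_sym_def)
qed

lemma pop_tape: "act_on_tape (0, Move_Right) (tape_of (b # w) h) = tape_of w (h + 1)"
proof -
  have "word_tape w (- 1) = 0" by (simp add: word_tape_def)
  then show ?thesis by (auto simp: tape_of_def word_tape_Cons diff_diff_add intro!: ext)
qed

lemma push_tape:
  "act_on_tape (bit_sym b, Stay)
     (act_on_tape (read_tape (tape_of w h), Move_Left) (tape_of w h)) = tape_of (b # w) (h - 1)"
proof -
  have "i - (h - 1) - 1 = i - h" for i by simp
  then show ?thesis
    by (auto simp: tape_of_def word_tape_Cons fun_eq_iff simp del: diff_diff_eq)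
qed

lemma word_tape_snoc: "word_tape (w @ [b]) = (word_tape w)(int (length w) := bit_sym b)"
  by (auto simp: word_tape_def bit_sym_def nth_append intro!: ext)

text \<open>The last tape is kept apart from the registers because the output must start at position
  0, whereas the words in registers drift.\<close>

definition config_of :: "nat \<Rightarrow> nat \<Rightarrow> store \<Rightarrow> (nat \<Rightarrow> int) \<Rightarrow> tape \<Rightarrow> config" where
  "config_of k q s h out = (q, map (\<lambda>r. tape_of (s r) (h r)) [0..<k] @ [out])"

lemma config_step:
  assumes "q \<noteq> 1" "P ! q = (r, f)" "f (read_tape (tape_of (s r) (h r))) = (w, m, q')" "r < k"
    and "act_on_tape (w, m) (tape_of (s r) (h r)) = tape_of v i"
  shows "tm_step (machine (Suc k) P) (config_of k q s h out)
       = config_of k q' (s(r := v)) (h(r := i)) out"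
proof -
  let ?ts = "map (\<lambda>r. tape_of (s r) (h r)) [0..<k] @ [out]"
  have "?ts[r := tape_of v i] = map (\<lambda>x. tape_of ((s(r := v)) x) ((h(r := i)) x)) [0..<k] @ [out]"
    using assms(4) by (auto intro!: nth_equalityI simp: nth_list_update nth_append)
  then show ?thesis
    using machine_step[of q P r f ?ts w m q' "Suc k"] assms
    by (simp add: config_of_def nth_append del: read_tape_of)
qed

lemma push_steps:
  assumes "q \<noteq> 1" "Suc q \<noteq> 1" "r < k"
    and "P ! q = (r, \<lambda>x. (x, Move_Left, q + 1))" "P ! (Suc q) = (r, \<lambda>x. (bit_sym b, Stay, q + 2))"
  shows "(tm_step (machine (Suc k) P) ^^ 2) (config_of k q s h out)
       = config_of k (q + 2) (s(r := b # s r)) (h(r := h r - 1)) out"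
proof -
  let ?ts = "map (\<lambda>r. tape_of (s r) (h r)) [0..<k] @ [out]"
  let ?t = "act_on_tape (read_tape (tape_of (s r) (h r)), Move_Left) (tape_of (s r) (h r))"
  have 1: "tm_step (machine (Suc k) P) (q, ?ts) = (q + 1, ?ts[r := ?t])"
    using machine_step[of q P r _ ?ts _ Move_Left "q + 1" "Suc k"] assms
    by (simp add: nth_append del: read_tape_of)
  have 2: "tm_step (machine (Suc k) P) (q + 1, ?ts[r := ?t])
      = (q + 2, ?ts[r := tape_of (b # s r) (h r - 1)])"
    using machine_step[of "Suc q" P r _ "?ts[r := ?t]" "bit_sym b" Stay "q + 2" "Suc k"] assms
    by (simp add: nth_append push_tape del: read_tape_of)
  have "?ts[r := tape_of (b # s r) (h r - 1)]
      = map (\<lambda>x. tape_of ((s(r := b # s r)) x) ((h(r := h r - 1)) x)) [0..<k] @ [out]"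
    using assms(3) by (auto intro!: nth_equalityI simp: nth_list_update nth_append)
  with 1 2 show ?thesis by (simp add: config_of_def numeral_2_eq_2)
qed

lemma jump_step:
  assumes "q \<noteq> 1" "P ! q = jump_instr q'" "0 < k"
  shows "tm_step (machine (Suc k) P) (config_of k q s h out) = config_of k q' s h out"
proof -
  have "act_on_tape (read_tape (tape_of (s 0) (h 0)), Stay) (tape_of (s 0) (h 0)) = tape_of (s 0) (h 0)"
    by (rule act_Stay)
  then show ?thesis
    using config_step[of q P 0 "\<lambda>x. (x, Stay, q')" s h _ Stay q' k "s 0" "h 0" out] assms
    by (simp add: jump_instr_def del: read_tape_of)
qed

lemma pop_step:
  assumes "q \<noteq> 1" "P ! q = pop_instr r e f g" "r < k"
  shows "s r = [] \<Longrightarrow> tm_step (machine (Suc k) P) (config_of k q s h out) = config_of k e s h out"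
    and "s r = b # w \<Longrightarrow> tm_step (machine (Suc k) P) (config_of k q s h out)
      = config_of k (if b then g else f) (s(r := w)) (h(r := h r + 1)) out"
proof -
  assume "s r = []"
  then have "act_on_tape (0, Stay) (tape_of (s r) (h r)) = tape_of [] (h r)"
    using act_Stay[of "tape_of (s r) (h r)"] by simp
  then show "tm_step (machine (Suc k) P) (config_of k q s h out) = config_of k e s h out"
    using config_step[of q P r _ s h 0 Stay e k "[]" "h r" out] assms \<open>s r = []\<close>
    by (simp add: pop_instr_def fun_upd_idem)
next
  assume "s r = b # w"
  then show "tm_step (machine (Suc k) P) (config_of k q s h out)
      = config_of k (if b then g else f) (s(r := w)) (h(r := h r + 1)) out"
    using config_step[of q P r _ s h 0 Move_Right "if b then g else f" k w "h r + 1" out] assms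
    by (simp add: pop_instr_def pop_tape bit_sym_def)
qed

lemma funpow_trans: "(f ^^ m) x = y \<Longrightarrow> (f ^^ n) y = z \<Longrightarrow> (f ^^ (m + n)) x = z"
  by (metis add.commute comp_apply funpow_add)

text \<open>State 1 halts, so code may not occupy the first two addresses; hence the prefix of
  length at least 2. The final head positions depend on the pushes and pops performed, so only their
  existence is asserted.\<close>

lemma compile_correct:
  assumes "exec c s s' t" "P = pre @ compile c (length pre) @ post" "2 \<le> length pre"
    and "regs c \<subseteq> {..<k}" "0 < k"
  shows "\<exists>h'. (tm_step (machine (Suc k) P) ^^ t) (config_of k (length pre) s h out)
      = config_of k (length pre + length (compile c (length pre))) s' h' out"
  using assms
proof (induction arbitrary: pre post h rule: exec.induct)
  case (Skip s)
  then show ?case by auto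
next
  case (Push r b s)
  have *: "P ! length pre = (r, \<lambda>x. (x, Move_Left, length pre + 1))"
    "P ! Suc (length pre) = (r, \<lambda>x. (bit_sym b, Stay, length pre + 2))"
    using Push by (auto simp: nth_append)
  have "length pre \<noteq> 1" "Suc (length pre) \<noteq> 1" "r < k" using Push.prems by auto
  from push_steps[OF this *]
  have "(tm_step (machine (Suc k) P) ^^ 2) (config_of k (length pre) s h out)
      = config_of k (length pre + length (compile (Push r b) (length pre))) (s(r := b # s r)) (h(r := h r - 1)) out"
    by simp
  then show ?case by blast
next
  case (Seq c s s1 t1 d s2 t2)
  let ?C = "compile c (length pre)"
  obtain h1 where 1: "(tm_step (machine (Suc k) P) ^^ t1) (config_of k (length pre) s h out)
      = config_of k (length pre + length ?C) s1 h1 out"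
    using Seq.IH(1)[of pre "compile d (length pre + length ?C) @ post" h] Seq.prems by auto
  obtain h2 where "(tm_step (machine (Suc k) P) ^^ t2) (config_of k (length pre + length ?C) s1 h1 out)
      = config_of k (length pre + length ?C + length (compile d (length pre + length ?C))) s2 h2 out"
    using Seq.IH(2)[of "pre @ ?C" post h1] Seq.prems by auto
  from funpow_trans[OF 1 this] show ?case by (auto simp: add.assoc)
next
  case (Branch_Nil s r c d)
  let ?e = "length pre + length (compile (Branch r c d) (length pre))"
  let ?f = "length pre + 1" and ?g = "length pre + length (compile c (length pre + 1)) + 2"
  have "P ! length pre = pop_instr r ?e ?f ?g"
    using Branch_Nil.prems by (simp add: Let_def add.assoc)
  then have "tm_step (machine (Suc k) P) (config_of k (length pre) s h out) = config_of k ?e s h out"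
    using pop_step(1)[of "length pre" P r ?e ?f ?g k s h out] Branch_Nil by simp
  then show ?case by auto
next
  case (Branch_F s r w c s' t d)
  let ?a = "length pre"
  let ?C = "compile c (?a + 1)"
  let ?f = "?a + length ?C + 2"
  let ?D = "compile d ?f"
  let ?e = "?f + length ?D"
  let ?M = "tm_step (machine (Suc k) P)"
  have P: "P = (pre @ [pop_instr r ?e (?a + 1) ?f]) @ ?C @ (jump_instr ?e # ?D @ post)"
    using Branch_F.prems by (simp add: Let_def)
  have P0: "P ! ?a = pop_instr r ?e (?a + 1) ?f" unfolding P by (simp add: nth_append)
  have len: "length (pre @ [pop_instr r ?e (?a + 1) ?f]) = ?a + 1" by simp
  have 1: "(?M ^^ 1) (config_of k ?a s h out) = config_of k (?a + 1) (s(r := w)) (h(r := h r + 1)) out"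
    using pop_step(2)[of ?a P r ?e "?a + 1" ?f k s False w h out] P0 Branch_F.hyps(1) Branch_F.prems(2,3) by simp
  obtain h1 where 2: "(?M ^^ t) (config_of k (?a + 1) (s(r := w)) (h(r := h r + 1)) out)
      = config_of k (?a + 1 + length ?C) s' h1 out"
    using Branch_F.IH[of "pre @ [pop_instr r ?e (?a + 1) ?f]" _ "h(r := h r + 1)", unfolded len, OF P] Branch_F.prems(2-)
    by (auto simp: fun_upd_def)
  have "P ! (?a + 1 + length ?C) = jump_instr ?e"
    unfolding P by (simp add: nth_append)
  moreover have ne: "?a + 1 + length ?C \<noteq> 1" using Branch_F.prems(2) by linarith
  ultimately have 3: "(?M ^^ 1) (config_of k (?a + 1 + length ?C) s' h1 out) = config_of k ?e s' h1 out"
    using jump_step[OF ne, of P ?e k s' h1 out] Branch_F.prems(2-) by simp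
  show ?case using funpow_trans[OF funpow_trans[OF 1 2] 3]
    by (auto simp: Let_def add_ac)
next
  case (Branch_T s r w d s' t c)
  let ?a = "length pre"
  let ?C = "compile c (?a + 1)"
  let ?f = "?a + length ?C + 2"
  let ?D = "compile d ?f"
  let ?e = "?f + length ?D"
  let ?M = "tm_step (machine (Suc k) P)"
  have P: "P = (pre @ pop_instr r ?e (?a + 1) ?f # ?C @ [jump_instr ?e]) @ ?D @ post"
    using Branch_T.prems by (simp add: Let_def)
  have P0: "P ! ?a = pop_instr r ?e (?a + 1) ?f" unfolding P by (simp add: nth_append)
  have 1: "(?M ^^ 1) (config_of k ?a s h out) = config_of k ?f (s(r := w)) (h(r := h r + 1)) out"
    using pop_step(2)[of ?a P r ?e "?a + 1" ?f k s True w h out] P0 Branch_T.hyps(1) Branch_T.prems(2,3) by simp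
  have len: "length (pre @ pop_instr r ?e (?a + 1) ?f # ?C @ [jump_instr ?e]) = ?f" by simp
  obtain h1 where 2: "(?M ^^ t) (config_of k ?f (s(r := w)) (h(r := h r + 1)) out)
      = config_of k ?e s' h1 out"
    using Branch_T.IH[of "pre @ pop_instr r ?e (?a + 1) ?f # ?C @ [jump_instr ?e]" post "h(r := h r + 1)", unfolded len, OF P]
      Branch_T.prems(2-) by (auto simp: fun_upd_def)
  show ?case using funpow_trans[OF 1 2] by (auto simp: Let_def add_ac)
next
  case (While_Nil s r c d)
  let ?e = "length pre + length (compile (While r c d) (length pre))"
  let ?f = "length pre + 1" and ?g = "length pre + length (compile c (length pre + 1)) + 2"
  have "P ! length pre = pop_instr r ?e ?f ?g"
    using While_Nil.prems by (simp add: Let_def add.assoc)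
  then have "tm_step (machine (Suc k) P) (config_of k (length pre) s h out) = config_of k ?e s h out"
    using pop_step(1)[of "length pre" P r ?e ?f ?g k s h out] While_Nil by simp
  then show ?case by auto
next
  case (While_Cons s r b w d c s1 t1 s2 t2)
  let ?a = "length pre"
  let ?C = "compile c (?a + 1)"
  let ?f = "?a + length ?C + 2"
  let ?D = "compile d ?f"
  let ?e = "?f + length ?D + 1"
  let ?M = "tm_step (machine (Suc k) P)"
  have P: "P = (pre @ [pop_instr r ?e (?a + 1) ?f]) @ ?C @ (jump_instr ?a # ?D @ jump_instr ?a # post)"
    using While_Cons.prems by (simp add: Let_def)
  have P': "P = (pre @ pop_instr r ?e (?a + 1) ?f # ?C @ [jump_instr ?a]) @ ?D @ (jump_instr ?a # post)"
    using P by simp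
  have P0: "P ! ?a = pop_instr r ?e (?a + 1) ?f" unfolding P by (simp add: nth_append)
  have 1: "(?M ^^ 1) (config_of k ?a s h out)
      = config_of k (if b then ?f else ?a + 1) (s(r := w)) (h(r := h r + 1)) out"
    using pop_step(2)[of ?a P r ?e "?a + 1" ?f k s b w h out] P0 While_Cons.hyps(1) While_Cons.prems(2,3) by simp
  have len: "length (pre @ pop_instr r ?e (?a + 1) ?f # ?C @ [jump_instr ?a]) = ?f" by simp
  have len0: "length (pre @ [pop_instr r ?e (?a + 1) ?f]) = ?a + 1" by simp
  have "\<exists>h1 q. (?M ^^ t1) (config_of k (if b then ?f else ?a + 1) (s(r := w)) (h(r := h r + 1)) out)
      = config_of k q s1 h1 out \<and> P ! q = jump_instr ?a \<and> q \<noteq> 1"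
  proof (cases b)
    case True
    obtain h1 where 2: "(?M ^^ t1) (config_of k ?f (s(r := w)) (h(r := h r + 1)) out)
        = config_of k (?f + length ?D) s1 h1 out"
      using While_Cons.IH(1)[unfolded if_P[OF True], of "pre @ pop_instr r ?e (?a + 1) ?f # ?C @ [jump_instr ?a]" _ "h(r := h r + 1)", unfolded len, OF P']
        While_Cons.prems(2-) by (auto simp: fun_upd_def)
    have "P ! (?f + length ?D) = jump_instr ?a"
      unfolding P' by (simp add: nth_append)
    then show ?thesis using 2 True by auto
  next
    case False
    obtain h1 where 2: "(?M ^^ t1) (config_of k (?a + 1) (s(r := w)) (h(r := h r + 1)) out)
        = config_of k (?a + 1 + length ?C) s1 h1 out"
      using While_Cons.IH(1)[unfolded if_not_P[OF False], of "pre @ [pop_instr r ?e (?a + 1) ?f]" _ "h(r := h r + 1)", unfolded len0, OF P]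
        While_Cons.prems(2-) by (auto simp: fun_upd_def)
    have "P ! (?a + 1 + length ?C) = jump_instr ?a"
      unfolding P by (simp add: nth_append)
    moreover have "?a + 1 + length ?C \<noteq> 1" using While_Cons.prems(2) by linarith
    ultimately show ?thesis using 2 False
      by (intro exI[of _ h1] exI[of _ "?a + 1 + length ?C"]) simp
  qed
  then obtain h1 q where 2: "(?M ^^ t1) (config_of k (if b then ?f else ?a + 1) (s(r := w)) (h(r := h r + 1)) out)
      = config_of k q s1 h1 out" and q: "P ! q = jump_instr ?a" "q \<noteq> 1" by blast
  have 3: "(?M ^^ 1) (config_of k q s1 h1 out) = config_of k ?a s1 h1 out"
    using jump_step[OF q(2,1), of k s1 h1 out] While_Cons.prems(2-) by simp
  obtain h2 where 4: "(?M ^^ t2) (config_of k ?a s1 h1 out)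
      = config_of k (?a + length (compile (While r c d) ?a)) s2 h2 out"
    using While_Cons.IH(2)[OF While_Cons.prems] by blast
  have "1 + t1 + 1 + t2 = t1 + 2 + t2" by simp
  with funpow_trans[OF funpow_trans[OF funpow_trans[OF 1 2] 3] 4] show ?case by metis
qed

section \<open>The compiled program is a Turing machine\<close>

definition wf_instr :: "nat \<Rightarrow> nat \<Rightarrow> instr \<Rightarrow> bool" where
  "wf_instr k n i \<longleftrightarrow> fst i < k \<and> (\<forall>x<3. case snd i x of (w, m, q) \<Rightarrow> w < 3 \<and> q < n)"

lemma wf_pop_instr: "r < k \<Longrightarrow> e < n \<Longrightarrow> f < n \<Longrightarrow> g < n \<Longrightarrow> wf_instr k n (pop_instr r e f g)"
  by (simp add: wf_instr_def pop_instr_def)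

lemma wf_jump_instr: "0 < k \<Longrightarrow> q < n \<Longrightarrow> wf_instr k n (jump_instr q)"
  by (simp add: wf_instr_def jump_instr_def)

text \<open>The strict bound leaves room for the exit address right behind the code, which is a jump
  target.\<close>

lemma wf_compile:
  assumes "regs c \<subseteq> {..<k}" "0 < k" "i \<in> set (compile c a)" "a + length (compile c a) < n"
  shows "wf_instr k n i"
  using assms
proof (induction c arbitrary: a)
  case (Push r b)
  then show ?case by (auto simp: wf_instr_def bit_sym_def)
next
  case (Seq c d)
  then show ?case by (auto simp: add.assoc)
next
  case (Branch r c d)
  then show ?case by (auto simp: Let_def intro!: wf_pop_instr wf_jump_instr)
next
  case (While r c d)
  then show ?case by (auto simp: Let_def intro!: wf_pop_instr wf_jump_instr)
qed simp

lemma is_tm_machine: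
  assumes "\<And>i. i \<in> set P \<Longrightarrow> wf_instr k (length P) i" "2 \<le> length P" "1 \<le> k"
  shows "is_tm (machine k P)"
proof -
  have "case delta (machine k P) q as of (q', acts) \<Rightarrow>
      q' < length P \<and> length acts = k \<and> (\<forall>(b, m)\<in>set acts. b < 3)"
    if "q < length P" "length as = k" "\<forall>a\<in>set as. a < 3" for q as
  proof -
    obtain r f where i: "P ! q = (r, f)" by fastforce
    then have wf: "wf_instr k (length P) (r, f)" using assms(1) that(1) by (metis nth_mem)
    obtain w m q' where f: "f (as ! r) = (w, m, q')" by (cases "f (as ! r)") auto
    have "as ! r < 3" using wf that by (auto simp: wf_instr_def)
    then have "w < 3" "q' < length P" using wf f by (fastforce simp: wf_instr_def)+
    moreover have "\<forall>(b, m)\<in>set ((map (\<lambda>a. (a, Stay)) as)[r := (w, m)]). b < 3"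
      using that(3) \<open>w < 3\<close> set_update_subset_insert[of "map (\<lambda>a. (a, Stay)) as" r "(w, m)"] by fastforce
    ultimately show ?thesis using i f that by (simp add: machine_def)
  qed
  then show ?thesis using assms(2,3) by (simp add: is_tm_def machine_def)
qed

text \<open>The three instructions at \<open>q\<close> form a loop that moves register 0 to the
  output tape: two steps per bit, and one for the pop that finds the register empty and jumps to the
  halting state.\<close>

lemma output_steps:
  fixes q :: nat
  assumes "q \<noteq> 1" "0 < k" "P ! q = pop_instr 0 1 (q + 1) (q + 2)" "q \<noteq> 0"
    and "P ! (q + 1) = (k, \<lambda>x. (1, Move_Right, q))" "P ! (q + 2) = (k, \<lambda>x. (2, Move_Right, q))"
  shows "\<exists>s' h'. (tm_step (machine (Suc k) P) ^^ (2 * length (s 0) + 1))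
        (config_of k q s h (word_tape v, int (length v)))
      = config_of k 1 s' h' (word_tape (v @ s 0), int (length (v @ s 0)))"
proof (induction "s 0" arbitrary: s h v)
  case Nil
  then show ?case using pop_step(1)[of q P 0 _ _ _ k s h] assms by auto
next
  case (Cons b w)
  let ?M = "tm_step (machine (Suc k) P)"
  let ?s = "s(0 := w)" and ?h = "h(0 := h 0 + 1)" and ?q = "if b then q + 2 else q + 1"
  have 1: "(?M ^^ 1) (config_of k q s h (word_tape v, int (length v)))
      = config_of k ?q ?s ?h (word_tape v, int (length v))"
    using pop_step(2)[of q P 0 _ _ _ k s b w h] assms Cons.hyps(2) by auto
  have "P ! ?q = (k, \<lambda>x. (bit_sym b, Move_Right, q))" "?q \<noteq> 1"
    using assms by (auto simp: bit_sym_def)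
  then have 2: "(?M ^^ 1) (config_of k ?q ?s ?h (word_tape v, int (length v)))
      = config_of k q ?s ?h (word_tape (v @ [b]), int (length (v @ [b])))"
    using machine_step[of ?q P k _ "map (\<lambda>r. tape_of (?s r) (?h r)) [0..<k] @ [(word_tape v, int (length v))]"]
    by (auto simp: config_of_def nth_append word_tape_snoc list_update_append)
  obtain s' h' where 3: "(?M ^^ (2 * length w + 1)) (config_of k q ?s ?h (word_tape (v @ [b]), int (length (v @ [b]))))
      = config_of k 1 s' h' (word_tape ((v @ [b]) @ w), int (length ((v @ [b]) @ w)))"
    using Cons.hyps(1)[of ?s ?h "v @ [b]"] by auto
  have "2 * length (s 0) + 1 = 1 + 1 + (2 * length w + 1)" using Cons.hyps(2)[symmetric] by simp
  moreover have "(v @ [b]) @ w = v @ s 0" using Cons.hyps(2) by simp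
  ultimately show ?case using funpow_trans[OF funpow_trans[OF 1 2] 3] by metis
qed

theorem poly_time_computable_exec:
  assumes "1 \<le> n"
    and ex: "\<And>ws. length ws = n \<Longrightarrow> \<exists>s' t. exec c (\<lambda>r. if r < n then ws ! r else []) s' t \<and>
      s' 0 = f ws \<and> t + 2 * length (f ws) + 2 \<le> poly p (sum_list (map length ws))"
  shows "poly_time_computable n f"
proof -
  obtain k where k: "regs c \<subseteq> {..<k}" "n \<le> k" "0 < k"
  proof -
    have "finite (regs c \<union> {..n})" by simp
    then obtain k where "\<forall>r \<in> regs c \<union> {..n}. r < k"
      by (meson finite_nat_set_iff_bounded)
    then have "regs c \<subseteq> {..<k}" "n < k" by auto
    then show thesis using that[of k] by linarith
  qed
  let ?C = "compile c 2"
  let ?e = "2 + length ?C"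
  \<comment> \<open>Address 0 jumps to the code at 2. Address 1 is the halting state, so the
    instruction stored there is never executed.\<close>
  define P where "P = [jump_instr 2, jump_instr 1] @ ?C @
    [pop_instr 0 1 (?e + 1) (?e + 2), (k, \<lambda>x. (1, Move_Right, ?e)), (k, \<lambda>x. (2, Move_Right, ?e))]"
  let ?M = "machine (Suc k) P"
  have P_0: "P ! 0 = jump_instr 2" by (simp add: P_def)
  have P_out: "P ! ?e = pop_instr 0 1 (?e + 1) (?e + 2)" "P ! (?e + 1) = (k, \<lambda>x. (1, Move_Right, ?e))"
    "P ! (?e + 2) = (k, \<lambda>x. (2, Move_Right, ?e))"
    unfolding P_def by (simp_all add: nth_append)
  have tm: "is_tm ?M"
  proof (rule is_tm_machine)
    fix i assume "i \<in> set P"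
    then consider "i = jump_instr 2" | "i = jump_instr 1" | "i \<in> set ?C"
      | "i = pop_instr 0 1 (?e + 1) (?e + 2)" | "i = (k, \<lambda>x. (1, Move_Right, ?e))"
      | "i = (k, \<lambda>x. (2, Move_Right, ?e))"
      unfolding P_def by auto
    then show "wf_instr (Suc k) (length P) i"
    proof cases
      case 3
      have "regs c \<subseteq> {..<Suc k}" using k(1) by auto
      then show ?thesis using wf_compile[OF _ _ 3] by (simp add: P_def)
    qed (auto simp: P_def wf_instr_def jump_instr_def pop_instr_def)
  qed (auto simp: P_def)
  have "tm_computes_within ?M (poly p (sum_list (map length ws))) ws (f ws)" if ws: "length ws = n" for ws
  proof -
    let ?s = "\<lambda>r. if r < n then ws ! r else []"
    obtain s' t where s': "exec c ?s s' t" "s' 0 = f ws"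
      and t: "t + 2 * length (f ws) + 2 \<le> poly p (sum_list (map length ws))"
      using ex[OF ws] by blast
    have init: "tm_init ?M ws = config_of k 0 ?s (\<lambda>_. 0) (word_tape [], 0)"
      using k ws by (auto simp: tm_init_def config_of_def machine_def tape_of_def)
    have 1: "(tm_step ?M ^^ 1) (tm_init ?M ws) = config_of k 2 ?s (\<lambda>_. 0) (word_tape [], 0)"
      using jump_step[of 0 P 2 k ?s "\<lambda>_. 0" "(word_tape [], 0)"] k P_0
      by (subst init) simp
    obtain h1 where 2: "(tm_step ?M ^^ t) (config_of k 2 ?s (\<lambda>_. 0) (word_tape [], 0))
        = config_of k ?e s' h1 (word_tape [], 0)"
    proof -
      let ?pre = "[jump_instr 2, jump_instr 1]"
      have len: "length ?pre = 2" by simp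
      have "P = ?pre @ compile c (length ?pre) @ drop ?e P"
        unfolding len by (simp add: P_def)
      from compile_correct[OF s'(1) this _ k(1,3), of "\<lambda>_. 0" "(word_tape [], 0)"]
      show thesis unfolding len using that by auto
    qed
    obtain s2 h2 where 3: "(tm_step ?M ^^ (2 * length (s' 0) + 1)) (config_of k ?e s' h1 (word_tape [], 0))
      = config_of k 1 s2 h2 (word_tape (s' 0), int (length (s' 0)))"
      using output_steps[OF _ k(3) P_out(1) _ P_out(2,3), of s' h1 "[]"] by auto
    from funpow_trans[OF funpow_trans[OF 1 2] 3]
    have "(tm_step ?M ^^ (1 + t + (2 * length (f ws) + 1))) (tm_init ?M ws)
        = config_of k 1 s2 h2 (word_tape (f ws), int (length (f ws)))"
      by (simp add: s'(2))
    then show ?thesis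
      unfolding tm_computes_within_def
      by (intro exI[of _ "1 + t + (2 * length (f ws) + 1)"]) (use t in \<open>simp add: config_of_def\<close>)
  qed
  moreover have "n \<le> n_tapes ?M" using k by (simp add: machine_def)
  ultimately show ?thesis unfolding poly_time_computable_def using tm by blast
qed

section \<open>Polynomial-time relations on binary trees\<close>

text \<open>The exact costs of \<open>exec\<close> depend on the data; from here on only upper
  bounds are tracked.\<close>

definition runs :: "com \<Rightarrow> store \<Rightarrow> store \<Rightarrow> nat \<Rightarrow> bool" where
  "runs c s s' T \<longleftrightarrow> (\<exists>t\<le>T. exec c s s' t)"

lemma runs_conv: "runs c s s1 T1 \<Longrightarrow> s1 = s' \<Longrightarrow> T1 \<le> T \<Longrightarrow> runs c s s' T"
  unfolding runs_def by (meson order_trans)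

lemma runs_start: "runs c s s' T \<Longrightarrow> s = r \<Longrightarrow> runs c r s' T"
  by simp

lemma runs_Skip: "runs Skip s s 0"
  unfolding runs_def by (auto intro: exec.intros)

lemma runs_Push: "runs (Push r b) s (s(r := b # s r)) 2"
  unfolding runs_def by (auto intro: exec.intros)

lemma runs_Seq: "runs c s s1 T1 \<Longrightarrow> runs d s1 s2 T2 \<Longrightarrow> runs (c ;; d) s s2 (T1 + T2)"
  unfolding runs_def by (meson exec.Seq add_mono)

lemma runs_Branch_Nil: "s r = [] \<Longrightarrow> runs (Branch r c d) s s 1"
  unfolding runs_def by (meson exec.intros order_refl)

lemma runs_Branch_F: "s r = False # w \<Longrightarrow> runs c (s(r := w)) s' T \<Longrightarrow> runs (Branch r c d) s s' (T + 2)"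
  unfolding runs_def using exec.Branch_F by (metis add_le_mono1)

lemma runs_Branch_T: "s r = True # w \<Longrightarrow> runs d (s(r := w)) s' T \<Longrightarrow> runs (Branch r c d) s s' (T + 1)"
  unfolding runs_def using exec.Branch_T by (metis add_le_mono1)

lemma runs_While_Nil: "s r = [] \<Longrightarrow> runs (While r c d) s s 1"
  unfolding runs_def by (meson exec.intros order_refl)

lemma runs_While_Cons:
  assumes "s r = b # w" "runs (if b then d else c) (s(r := w)) s1 T1" "runs (While r c d) s1 s2 T2"
  shows "runs (While r c d) s s2 (T1 + 2 + T2)"
  using assms(2,3) exec.While_Cons[where s = s and r = r, OF assms(1)] unfolding runs_def
  by (meson add_mono order_refl)

section \<open>Clearing, moving and copying registers\<close>

definition clear :: "nat \<Rightarrow> com" where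
  "clear x = While x Skip Skip"

lemma runs_clear: "runs (clear x) s (s(x := [])) (2 * length (s x) + 1)"
proof (induction "s x" arbitrary: s)
  case Nil
  then show ?case unfolding clear_def
    by (intro runs_conv[OF runs_While_Nil[of s x]]) auto
next
  case (Cons b w)
  have "runs (clear x) (s(x := w)) ((s(x := w))(x := [])) (2 * length w + 1)"
    using Cons.hyps(1)[of "s(x := w)"] by simp
  from runs_While_Cons[where s = s and r = x, OF Cons.hyps(2)[symmetric], of Skip Skip "s(x := w)" 0, folded clear_def, OF _ this]
  show ?case using Cons.hyps(2)[symmetric] by (simp add: runs_Skip)
qed

definition mv :: "nat \<Rightarrow> nat \<Rightarrow> com" where
  "mv x y = While x (Push y False) (Push y True)"

lemma runs_mv:
  "x \<noteq> y \<Longrightarrow> runs (mv x y) s (s(x := [], y := rev (s x) @ s y)) (4 * length (s x) + 1)"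
proof (induction "s x" arbitrary: s)
  case Nil
  then show ?case unfolding mv_def
    by (intro runs_conv[OF runs_While_Nil[of s x]]) auto
next
  case (Cons b w)
  let ?s = "s(x := w, y := b # s y)"
  have 1: "runs (if b then Push y True else Push y False) (s(x := w)) ?s 2"
    using runs_Push[of y b "s(x := w)"] Cons.prems by (cases b) auto
  have 2: "runs (mv x y) ?s (?s(x := [], y := rev w @ b # s y)) (4 * length w + 1)"
    using Cons.hyps(1)[of ?s] Cons.prems by simp
  from runs_While_Cons[where s = s and r = x, OF Cons.hyps(2)[symmetric] 1, folded mv_def, OF 2]
  show ?case by (rule runs_conv) (use Cons.hyps(2)[symmetric] Cons.prems in auto)
qed

definition mv2 :: "nat \<Rightarrow> nat \<Rightarrow> nat \<Rightarrow> com" where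
  "mv2 x y z = While x (Push y False ;; Push z False) (Push y True ;; Push z True)"

lemma runs_mv2:
  assumes "x \<noteq> y" "x \<noteq> z" "y \<noteq> z"
  shows "runs (mv2 x y z) s (s(x := [], y := rev (s x) @ s y, z := rev (s x) @ s z)) (6 * length (s x) + 1)"
proof (induction "s x" arbitrary: s)
  case Nil
  then show ?case unfolding mv2_def
    by (intro runs_conv[OF runs_While_Nil[of s x]]) auto
next
  case (Cons b w)
  let ?s = "s(x := w, y := b # s y, z := b # s z)"
  have 1: "runs (if b then Push y True ;; Push z True else Push y False ;; Push z False) (s(x := w)) ?s (2 + 2)"
    using runs_Seq[OF runs_Push[of y b "s(x := w)"] runs_Push[of z b]] assms by (cases b) auto
  have 2: "runs (mv2 x y z) ?s (?s(x := [], y := rev w @ b # s y, z := rev w @ b # s z)) (6 * length w + 1)"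
    using Cons.hyps(1)[of ?s] assms by simp
  from runs_While_Cons[where s = s and r = x, OF Cons.hyps(2)[symmetric] 1, folded mv2_def, OF 2]
  show ?case by (rule runs_conv) (use Cons.hyps(2)[symmetric] assms in auto)
qed

text \<open>A move reverses the word, so the second move restores its order while writing it
  twice.\<close>

definition copy :: "nat \<Rightarrow> com" where
  "copy b = mv b (b + 2) ;; mv2 (b + 2) b (b + 1)"

lemma runs_copy:
  assumes "s (b + 1) = []" "s (b + 2) = []"
  shows "runs (copy b) s (s(b + 1 := s b)) (10 * length (s b) + 2)"
  unfolding copy_def
  by (rule runs_conv, rule runs_Seq, rule runs_mv, simp, rule runs_mv2) (use assms in auto)

primrec pushes :: "nat \<Rightarrow> bool list \<Rightarrow> com" where
  "pushes r [] = Skip"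
| "pushes r (b # w) = pushes r w ;; Push r b"

lemma runs_pushes: "runs (pushes r w) s (s(r := w @ s r)) (2 * length w)"
proof (induction w)
  case Nil
  then show ?case using runs_Skip by simp
next
  case (Cons b w)
  show ?case unfolding pushes.simps
    by (rule runs_conv, rule runs_Seq[OF Cons], rule runs_Push) auto
qed


section \<open>Binary trees and their prefix code\<close>

datatype tree = Leaf | Node tree tree

primrec bits :: "tree \<Rightarrow> bool list" where
  "bits Leaf = [False]"
| "bits (Node t u) = True # bits t @ bits u"

definition tsize :: "tree \<Rightarrow> nat" where
  "tsize t = length (bits t)"

lemma tsize_simps [simp]: "tsize Leaf = 1" "tsize (Node t u) = tsize t + tsize u + 1"
  by (simp_all add: tsize_def)

lemma length_bits [simp]: "length (bits t) = tsize t"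
  by (simp add: tsize_def)

lemma tsize_pos [simp]: "0 < tsize t"
  by (cases t) auto

lemma prefix_free_bits: "prefix_free bits"
proof -
  have "t = u \<and> v = w" if "bits t @ v = bits u @ w" for t u v w
    using that
  proof (induction t arbitrary: u v w)
    case Leaf
    then show ?case by (cases u) auto
  next
    case (Node t1 t2)
    from Node.prems obtain u1 u2 where u: "u = Node u1 u2" by (cases u) auto
    with Node.prems have "bits t1 @ (bits t2 @ v) = bits u1 @ (bits u2 @ w)" by simp
    note 1 = Node.IH(1)[OF this]
    from Node.IH(2)[OF conjunct2[OF 1]] 1 u show ?case by simp
  qed
  then show ?thesis unfolding prefix_free_def by blast
qed

section \<open>Polynomially bounded functions\<close>

lemma poly_nat_mono: "x \<le> y \<Longrightarrow> poly p x \<le> poly p (y :: nat)"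
proof (induction p)
  case (pCons a p)
  then have "x * poly p x \<le> y * poly p y" by (intro mult_le_mono)
  then show ?case by simp
qed simp

definition pbound :: "(nat \<Rightarrow> nat) \<Rightarrow> bool" where
  "pbound g \<longleftrightarrow> (\<exists>p. \<forall>n. g n \<le> poly p n)"

lemma pbound_mono: "pbound g \<Longrightarrow> (\<And>n. f n \<le> g n) \<Longrightarrow> pbound f"
  unfolding pbound_def by (meson order_trans)

lemma pbound_const: "pbound (\<lambda>n. k)"
  unfolding pbound_def by (rule exI[of _ "[:k:]"]) simp

lemma pbound_id: "pbound (\<lambda>n. n)"
  unfolding pbound_def by (rule exI[of _ "[:0, 1:]"]) simp

lemma pbound_add: "pbound f \<Longrightarrow> pbound g \<Longrightarrow> pbound (\<lambda>n. f n + g n)"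
  unfolding pbound_def by (metis add_mono poly_add)

lemma pbound_mult: "pbound f \<Longrightarrow> pbound g \<Longrightarrow> pbound (\<lambda>n. f n * g n)"
  unfolding pbound_def by (metis mult_le_mono poly_mult)

lemma pbound_poly: "pbound g \<Longrightarrow> pbound (\<lambda>n. poly p (g n))"
  unfolding pbound_def by (metis poly_nat_mono poly_pcompose)

lemma pbound_Suc: "pbound g \<Longrightarrow> pbound (\<lambda>n. Suc (g n))"
  using pbound_add[OF _ pbound_const[of 1]] by simp

lemma pbound_power: "pbound g \<Longrightarrow> pbound (\<lambda>n. g n ^ k)"
  by (induction k) (simp_all add: pbound_const pbound_mult)

lemmas pbound_intros =
  pbound_const pbound_id pbound_add pbound_mult pbound_poly pbound_Suc pbound_power

lemma pbound_comp: "pbound f \<Longrightarrow> pbound g \<Longrightarrow> mono f \<Longrightarrow> pbound (\<lambda>n. f (g n))"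
  unfolding pbound_def[of f] by (auto intro: pbound_mono[OF pbound_poly])

section \<open>Closure properties of polynomial-time relations on trees\<close>

definition computes :: "(nat \<Rightarrow> com) \<Rightarrow> (nat \<Rightarrow> nat) \<Rightarrow> (tree \<times> tree) set \<Rightarrow> bool" where
  "computes c T R \<longleftrightarrow> (\<forall>b s t u. (t, u) \<in> R \<longrightarrow> s b = bits t \<longrightarrow> (\<forall>i>b. s i = []) \<longrightarrow>
     tsize u \<le> T (tsize t) \<and> runs (c b) s (s(b := bits u)) (T (tsize t)))"

text \<open>The program takes its input and leaves its output in register \<open>b\<close>, uses only registers above
  \<open>b\<close> as work space and cleans them up; so programs can be nested.\<close>

definition pt_rel :: "(tree \<times> tree) set \<Rightarrow> bool" where
  "pt_rel R \<longleftrightarrow> (\<exists>c p. computes c (poly p) R)"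

lemma pt_relI:
  assumes "pbound T"
    and "\<And>b s t u. (t, u) \<in> R \<Longrightarrow> s b = bits t \<Longrightarrow> (\<And>i. i > b \<Longrightarrow> s i = []) \<Longrightarrow>
      tsize u \<le> T (tsize t) \<and> runs (c b) s (s(b := bits u)) (T (tsize t))"
  shows "pt_rel R"
proof -
  obtain p where "\<And>n. T n \<le> poly p n" using assms(1) unfolding pbound_def by blast
  then have "computes c (poly p) R"
    unfolding computes_def using assms(2) by (meson order_trans runs_conv)
  then show ?thesis unfolding pt_rel_def by blast
qed

lemma computes_runs:
  assumes "computes c T R" "(t, u) \<in> R" "s b = bits t" "\<And>i. i > b \<Longrightarrow> s i = []"
  shows "runs (c b) s (s(b := bits u)) (T (tsize t))"
  using assms unfolding computes_def by blast

lemma computes_size: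
  assumes "computes c T R" "(t, u) \<in> R"
  shows "tsize u \<le> T (tsize t)"
  using assms(1)[unfolded computes_def, rule_format, OF assms(2), of "(\<lambda>_. [])(0 := bits t)" 0] by simp

text \<open>Relations serve as partial functions: a smaller relation is a weaker specification. This
  is how a program on trees becomes one on the codes of a particular type.\<close>

lemma pt_rel_subset: "pt_rel R \<Longrightarrow> Q \<subseteq> R \<Longrightarrow> pt_rel Q"
  unfolding pt_rel_def computes_def by blast

lemma pt_rel_id: "pt_rel {(t, t) | t. True}"
  by (rule pt_relI[where T = "\<lambda>n. n" and c = "\<lambda>_. Skip"])
    (auto intro: pbound_intros runs_conv[OF runs_Skip] simp: fun_upd_idem)

lemma pt_rel_comp:
  assumes "pt_rel R" "pt_rel S"
  shows "pt_rel (R O S)"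
proof -
  obtain c p where c: "computes c (poly p) R"
    using assms(1) unfolding pt_rel_def by blast
  obtain d q where d: "computes d (poly q) S"
    using assms(2) unfolding pt_rel_def by blast
  show ?thesis
  proof (rule pt_relI[where T = "\<lambda>n. poly p n + poly q (poly p n)" and c = "\<lambda>b. c b ;; d b"])
    fix b :: nat and s t u assume "(t, u) \<in> R O S" and s: "s b = bits t" "\<And>i. i > b \<Longrightarrow> s i = []"
    then obtain v where v: "(t, v) \<in> R" "(v, u) \<in> S" by blast
    have le: "poly q (tsize v) \<le> poly q (poly p (tsize t))"
      by (rule poly_nat_mono[OF computes_size[OF c v(1)]])
    have "runs (d b) (s(b := bits v)) (s(b := bits u)) (poly q (tsize v))"
      using computes_runs[OF d v(2), of "s(b := bits v)" b] s by simp
    from runs_Seq[OF computes_runs[OF c v(1), of s b, OF s] this]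
    show "tsize u \<le> poly p (tsize t) + poly q (poly p (tsize t)) \<and>
        runs (c b ;; d b) s (s(b := bits u)) (poly p (tsize t) + poly q (poly p (tsize t)))"
      using computes_size[OF d v(2)] le by (auto intro: runs_conv)
  qed (intro pbound_intros)
qed

lemma pt_rel_const: "pt_rel {(t, u) | t. True}"
proof (rule pt_relI[where T = "\<lambda>n. 2 * n + 1 + 2 * tsize u" and c = "\<lambda>b. clear b ;; pushes b (bits u)"])
  fix b :: nat and s t u' assume "(t, u') \<in> {(t, u) | t. True}" "s b = bits t"
  then show "tsize u' \<le> 2 * tsize t + 1 + 2 * tsize u \<and>
      runs (clear b ;; pushes b (bits u)) s (s(b := bits u')) (2 * tsize t + 1 + 2 * tsize u)"
    using runs_Seq[OF runs_clear[of b s] runs_pushes[of b "bits u"]] by auto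
qed (intro pbound_intros)

definition swap :: "nat \<Rightarrow> com" where
  "swap b = mv b (b + 2) ;; mv (b + 1) (b + 3) ;; mv (b + 3) b ;; mv (b + 2) (b + 1)"

lemma runs_swap:
  assumes "s (b + 2) = []" "s (b + 3) = []"
  shows "runs (swap b) s (s(b := s (b + 1), b + 1 := s b)) (8 * length (s b) + 8 * length (s (b + 1)) + 4)"
  unfolding swap_def
  by (rule runs_conv, rule runs_Seq, rule runs_mv, simp, rule runs_Seq, rule runs_mv, simp,
      rule runs_Seq, rule runs_mv, simp, rule runs_mv) (use assms in auto)

definition cons_regs :: "nat \<Rightarrow> com" where
  "cons_regs b = swap b ;; mv (b + 1) (b + 2) ;; mv (b + 2) b ;; Push b True"

lemma runs_cons_regs:
  assumes "s b = bits t" "s (b + 1) = bits u" "\<And>i. i > b + 1 \<Longrightarrow> s i = []"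
  shows "runs (cons_regs b) s (s(b := bits (Node t u), b + 1 := [])) (16 * tsize t + 16 * tsize u + 10)"
  unfolding cons_regs_def
  by (rule runs_conv, rule runs_Seq, rule runs_swap, simp add: assms, simp add: assms,
      rule runs_Seq, rule runs_mv, simp, rule runs_Seq, rule runs_mv, simp, rule runs_Push)
    (use assms in auto)

lemma pt_rel_pair:
  assumes "pt_rel R" "pt_rel S"
  shows "pt_rel {(t, Node u v) | t u v. (t, u) \<in> R \<and> (t, v) \<in> S}"
proof -
  obtain c p where c: "computes c (poly p) R"
    using assms(1) unfolding pt_rel_def by blast
  obtain d q where d: "computes d (poly q) S"
    using assms(2) unfolding pt_rel_def by blast
  let ?c = "\<lambda>b. copy b ;; c (b + 1) ;; swap b ;; d (b + 1) ;; cons_regs b"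
  let ?T = "\<lambda>n. 18 * n + 25 * poly p n + 17 * poly q n + 16"
  show ?thesis
  proof (rule pt_relI[where T = ?T and c = ?c])
    fix b :: nat and s t w assume "(t, w) \<in> {(t, Node u v) | t u v. (t, u) \<in> R \<and> (t, v) \<in> S}"
      and s: "s b = bits t" "\<And>i. i > b \<Longrightarrow> s i = []"
    then obtain u v where u: "w = Node u v" "(t, u) \<in> R" "(t, v) \<in> S" by blast
    have "runs (?c b) s (s(b := bits w)) (?T (tsize t))"
      by (rule runs_conv, rule runs_Seq, rule runs_copy, simp add: s, simp add: s,
          rule runs_Seq, rule computes_runs[OF c u(2)], simp add: s, simp add: s, rule runs_Seq, rule runs_swap,
          simp add: s, simp add: s, rule runs_Seq, rule computes_runs[OF d u(3)], simp add: s, simp add: s,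
          rule runs_cons_regs[of _ _ u v])
        (use s u(1) computes_size[OF c u(2)] computes_size[OF d u(3)] in auto)
    then show "tsize w \<le> ?T (tsize t) \<and> runs (?c b) s (s(b := bits w)) (?T (tsize t))"
      using computes_size[OF c u(2)] computes_size[OF d u(3)] u(1) by simp
  qed (intro pbound_intros)
qed

lemma pt_rel_if:
  assumes "pt_rel C" "pt_rel R" "pt_rel S"
    and Q: "\<And>t u. (t, u) \<in> Q \<Longrightarrow> \<exists>v. (t, v) \<in> C \<and> (if v = Leaf then (t, u) \<in> R else (t, u) \<in> S)"
  shows "pt_rel Q"
proof -
  obtain e r where e: "computes e (poly r) C"
    using assms(1) unfolding pt_rel_def by blast
  obtain c p where c: "computes c (poly p) R"
    using assms(2) unfolding pt_rel_def by blast
  obtain d q where d: "computes d (poly q) S"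
    using assms(3) unfolding pt_rel_def by blast
  \<comment> \<open>The first bit of the test value decides. The code of \<open>Leaf\<close>
    consists of that bit alone, whereas a \<open>Node\<close> leaves bits behind that have to be
    cleared.\<close>
  let ?c = "\<lambda>b. copy b ;; e (b + 1) ;; Branch (b + 1) (c b) (clear (b + 1) ;; d b)"
  let ?T = "\<lambda>n. 10 * n + 3 * poly r n + poly p n + poly q n + 6"
  show ?thesis
  proof (rule pt_relI[where T = ?T and c = ?c])
    fix b :: nat and s t u assume tu: "(t, u) \<in> Q" and s: "s b = bits t" "\<And>i. i > b \<Longrightarrow> s i = []"
    from Q[OF tu] obtain v where v: "(t, v) \<in> C" "if v = Leaf then (t, u) \<in> R else (t, u) \<in> S" by blast
    have upd: "s(b + 1 := []) = s" using s(2)[of "b + 1"] by (simp add: fun_upd_idem)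
    show "tsize u \<le> ?T (tsize t) \<and> runs (?c b) s (s(b := bits u)) (?T (tsize t))"
    proof (cases v)
      case Leaf
      with v have R: "(t, u) \<in> R" by simp
      have "runs (?c b) s (s(b := bits u)) (?T (tsize t))"
        by (rule runs_conv, rule runs_Seq, rule runs_copy, simp add: s, simp add: s,
            rule runs_Seq, rule computes_runs[OF e v(1)], simp add: s, simp add: s,
            rule runs_Branch_F[of _ _ "[]"], simp add: Leaf, rule computes_runs[OF c R])
          (use s upd in auto)
      then show ?thesis using computes_size[OF c R] by simp
    next
      case (Node v1 v2)
      with v have S: "(t, u) \<in> S" by simp
      have "runs (?c b) s (s(b := bits u)) (?T (tsize t))"
        by (rule runs_conv, rule runs_Seq, rule runs_copy, simp add: s, simp add: s,
            rule runs_Seq, rule computes_runs[OF e v(1)], simp add: s, simp add: s,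
            rule runs_Branch_T[of _ _ "bits v1 @ bits v2"], simp add: Node,
            rule runs_Seq, rule runs_clear, rule computes_runs[OF d S])
          (use s upd computes_size[OF e v(1)] Node in auto)
      then show ?thesis using computes_size[OF d S] by simp
    qed
  qed (intro pbound_intros)
qed

primrec car :: "tree \<Rightarrow> tree" where
  "car Leaf = Leaf"
| "car (Node t u) = t"

primrec cdr :: "tree \<Rightarrow> tree" where
  "cdr Leaf = Leaf"
| "cdr (Node t u) = u"

text \<open>Register \<open>b + 1\<close> counts in unary the subtrees still to be read. It suffices to describe how
  reading one subtree extends any further run of the loop.\<close>

definition split_loop :: "nat \<Rightarrow> com" where
  "split_loop b = While (b + 1) Skip
     (Branch b (Push (b + 2) False) (Push (b + 2) True ;; Push (b + 1) True ;; Push (b + 1) True))"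

lemma runs_split_loop:
  assumes "s (b + 1) = True # d" "s b = bits t @ w"
    and "runs (split_loop b) (s(b := w, b + 1 := d, b + 2 := rev (bits t) @ s (b + 2))) s' T"
  shows "runs (split_loop b) s s' (10 * tsize t + T)"
  using assms
proof (induction t arbitrary: s w d T)
  case Leaf
  have "runs (Branch b (Push (b + 2) False) (Push (b + 2) True ;; Push (b + 1) True ;; Push (b + 1) True))
     (s(b + 1 := d)) (s(b := w, b + 1 := d, b + 2 := False # s (b + 2))) 4"
    by (rule runs_conv, rule runs_Branch_F[of _ _ w], simp add: Leaf, rule runs_Push) auto
  then have "runs (split_loop b) s s' (4 + 2 + T)"
    using runs_While_Cons[where s = s and r = "b + 1", OF Leaf(1), of _ Skip
        "s(b := w, b + 1 := d, b + 2 := False # s (b + 2))" 4 s' T] Leaf(3)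
    by (simp add: split_loop_def fun_upd_def)
  then show ?case by (rule runs_conv) simp_all
next
  case (Node t u)
  let ?s1 = "s(b := bits t @ bits u @ w, b + 1 := True # True # d, b + 2 := True # s (b + 2))"
  let ?s2 = "s(b := bits u @ w, b + 1 := True # d, b + 2 := rev (bits t) @ True # s (b + 2))"
  have "runs (Branch b (Push (b + 2) False) (Push (b + 2) True ;; Push (b + 1) True ;; Push (b + 1) True))
     (s(b + 1 := d)) ?s1 7"
    by (rule runs_conv, rule runs_Branch_T[of _ _ "bits t @ bits u @ w"], simp add: Node, rule runs_Seq,
        rule runs_Push, rule runs_Seq, rule runs_Push, rule runs_Push) auto
  then have 1: "runs (split_loop b) ?s1 s' T1 \<Longrightarrow> runs (split_loop b) s s' (9 + T1)" for T1
    using runs_While_Cons[where s = s and r = "b + 1", OF Node.prems(1), of _ Skip ?s1 7 s' T1]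
    by (simp add: split_loop_def)
  have 2: "runs (split_loop b) ?s2 s' (10 * tsize u + T)"
    by (rule Node.IH(2)[of _ d w], simp, simp, rule runs_start, rule Node.prems(3)) auto
  have "runs (split_loop b) ?s1 s' (10 * tsize t + (10 * tsize u + T))"
    by (rule Node.IH(1)[of _ "True # d" "bits u @ w"], simp, simp, rule runs_start[OF 2]) auto
  from 1[OF this] show ?case by (auto intro: runs_conv)
qed

lemma runs_split:
  assumes "s b = bits t @ w" "s (b + 1) = []" "s (b + 2) = []"
  shows "runs (Push (b + 1) True ;; split_loop b) s
    (s(b := w, b + 2 := rev (bits t))) (10 * tsize t + 3)"
proof -
  let ?s = "s(b := w, b + 1 := [], b + 2 := rev (bits t))"
  have 1: "runs (split_loop b) ?s ?s 1"
    unfolding split_loop_def by (rule runs_While_Nil) simp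
  have "runs (split_loop b) (s(b + 1 := True # s (b + 1))) ?s (10 * tsize t + 1)"
    by (rule runs_split_loop[of _ _ "[]" t w], use assms in simp, use assms in simp, rule runs_start[OF 1])
      (use assms in auto)
  from runs_Seq[OF runs_Push this] show ?thesis
    by (rule runs_conv) (use assms in auto)
qed

lemma pt_rel_car: "pt_rel {(t, car t) | t. True}"
proof (rule pt_relI[where T = "\<lambda>n. 20 * n + 20" and c = "\<lambda>b. Branch b (Push b False)
    ((Push (b + 1) True ;; split_loop b) ;; clear b ;; mv (b + 2) b)"])
  fix b :: nat and s t u assume tu: "(t, u) \<in> {(t, car t) | t. True}"
    and s: "s b = bits t" "\<And>i. i > b \<Longrightarrow> s i = []"
  show "tsize u \<le> 20 * tsize t + 20 \<and> runs (Branch b (Push b False)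
    ((Push (b + 1) True ;; split_loop b) ;; clear b ;; mv (b + 2) b)) s (s(b := bits u)) (20 * tsize t + 20)"
  proof (cases t)
    case Leaf
    then show ?thesis using tu s
      by (auto intro!: runs_conv[OF runs_Branch_F[of _ _ "[]", OF _ runs_Push]])
  next
    case (Node t1 t2)
    have "runs (Branch b (Push b False)
      ((Push (b + 1) True ;; split_loop b) ;; clear b ;; mv (b + 2) b)) s (s(b := bits t1)) (20 * tsize t + 20)"
      by (rule runs_conv, rule runs_Branch_T[of _ _ "bits t1 @ bits t2"], simp add: Node s,
         rule runs_Seq, rule runs_split[of _ _ t1 "bits t2"], simp, simp add: s, simp add: s,
         rule runs_Seq, rule runs_clear, rule runs_mv) (use s Node in auto)
    then show ?thesis using tu Node by simp
  qed
qed (intro pbound_intros)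

lemma pt_rel_cdr: "pt_rel {(t, cdr t) | t. True}"
proof (rule pt_relI[where T = "\<lambda>n. 20 * n + 20" and c = "\<lambda>b. Branch b (Push b False)
    ((Push (b + 1) True ;; split_loop b) ;; clear (b + 2))"])
  fix b :: nat and s t u assume tu: "(t, u) \<in> {(t, cdr t) | t. True}"
    and s: "s b = bits t" "\<And>i. i > b \<Longrightarrow> s i = []"
  show "tsize u \<le> 20 * tsize t + 20 \<and> runs (Branch b (Push b False)
    ((Push (b + 1) True ;; split_loop b) ;; clear (b + 2))) s (s(b := bits u)) (20 * tsize t + 20)"
  proof (cases t)
    case Leaf
    then show ?thesis using tu s
      by (auto intro!: runs_conv[OF runs_Branch_F[of _ _ "[]", OF _ runs_Push]])
  next
    case (Node t1 t2)
    have "runs (Branch b (Push b False)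
      ((Push (b + 1) True ;; split_loop b) ;; clear (b + 2))) s (s(b := bits t2)) (20 * tsize t + 20)"
      by (rule runs_conv, rule runs_Branch_T[of _ _ "bits t1 @ bits t2"], simp add: Node s,
         rule runs_Seq, rule runs_split[of _ _ t1 "bits t2"], simp, simp add: s, simp add: s,
         rule runs_clear) (use s Node in auto)
    then show ?thesis using tu Node by simp
  qed
qed (intro pbound_intros)

definition mismatches :: "bool list \<Rightarrow> bool list \<Rightarrow> nat" where
  "mismatches xs ys = length (filter (\<lambda>(x, y). x \<noteq> y) (zip xs ys))"

lemma mismatches_simps [simp]:
  "mismatches [] ys = 0" "mismatches xs [] = 0"
  "mismatches (x # xs) (y # ys) = (if x = y then 0 else 1) + mismatches xs ys"
  by (auto simp: mismatches_def)

lemma mismatches_0: "mismatches xs ys = 0 \<Longrightarrow> \<exists>v w. xs @ v = ys @ w"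
proof (induction xs arbitrary: ys)
  case (Cons x xs)
  then show ?case by (cases ys) (auto split: if_splits)
qed auto

lemma mismatches_self [simp]: "mismatches xs xs = 0"
  by (induction xs) auto

lemma mismatches_le: "mismatches xs ys \<le> length xs"
  by (induction xs ys rule: list_induct2') auto

text \<open>Because \<open>bits\<close> is prefix-free, codes that agree as far as the shorter one
  reaches are equal. So \<open>compare_loop\<close> may stop there without looking at the
  rest.\<close>

lemma mismatches_bits: "mismatches (bits t) (bits u) = 0 \<longleftrightarrow> t = u"
proof
  assume "mismatches (bits t) (bits u) = 0"
  then obtain v w where "bits t @ v = bits u @ w" using mismatches_0 by blast
  from prefix_freeD[OF prefix_free_bits this] show "t = u" by blast
qed simp

definition compare_loop :: "nat \<Rightarrow> com" where
  "compare_loop b = While (b + 1) (Branch b Skip (Push (b + 2) True)) (Branch b (Push (b + 2) True) Skip)"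

lemma runs_compare_loop:
  "runs (compare_loop b) s
     (s(b + 1 := [], b := drop (length (s (b + 1))) (s b),
        b + 2 := replicate (mismatches (s (b + 1)) (s b)) True @ s (b + 2)))
     (6 * length (s (b + 1)) + 1)"
proof (induction "s (b + 1)" arbitrary: s)
  case Nil
  then show ?case unfolding compare_loop_def
    by (intro runs_conv[OF runs_While_Nil[of s "b + 1"]]) auto
next
  case (Cons x xs)
  let ?s = "s(b + 1 := xs, b := tl (s b), b + 2 := replicate (mismatches [x] (s b)) True @ s (b + 2))"
  have 1: "runs (if x then Branch b (Push (b + 2) True) Skip else Branch b Skip (Push (b + 2) True))
      (s(b + 1 := xs)) ?s 4"
  proof (cases "s b")
    case Nil
    then show ?thesis
      by (cases x) (auto intro!: runs_conv[OF runs_Branch_Nil])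
  next
    case (Cons y ys)
    show ?thesis
    proof (cases y)
      case True
      then have b: "(s(b + 1 := xs)) b = True # ys" using Cons by simp
      show ?thesis
        by (cases x; simp only: if_True if_False; rule runs_conv, rule runs_Branch_T[where s = "s(b + 1 := xs)" and r = b, OF b], rule runs_Skip runs_Push)
          (use True Cons in auto)
    next
      case False
      then have b: "(s(b + 1 := xs)) b = False # ys" using Cons by simp
      show ?thesis
        by (cases x; simp only: if_True if_False; rule runs_conv, rule runs_Branch_F[where s = "s(b + 1 := xs)" and r = b, OF b], rule runs_Skip runs_Push)
          (use False Cons in auto)
    qed
  qed
  have "runs (compare_loop b) ?s
     (?s(b + 1 := [], b := drop (length xs) (tl (s b)),
        b + 2 := replicate (mismatches xs (tl (s b))) True @ ?s (b + 2))) (6 * length xs + 1)"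
    using Cons.hyps(1)[of ?s] by simp
  from runs_While_Cons[where s = s and r = "b + 1", OF Cons.hyps(2)[symmetric] 1, folded compare_loop_def, OF this]
  show ?case
  proof (rule runs_conv)
    show "?s(b + 1 := [], b := drop (length xs) (tl (s b)),
        b + 2 := replicate (mismatches xs (tl (s b))) True @ ?s (b + 2)) =
      s(b + 1 := [], b := drop (length (s (b + 1))) (s b),
        b + 2 := replicate (mismatches (s (b + 1)) (s b)) True @ s (b + 2))"
      unfolding Cons.hyps(2)[symmetric]
      by (cases "s b") (auto simp: fun_eq_iff replicate_app_Cons_same)
  qed (use Cons.hyps(2)[symmetric] in simp)
qed

text \<open>Splitting delivers the first component reversed, hence the move before the comparison.
  The answer for equality is written first and replaced if register \<open>b + 2\<close> has
  recorded a mismatch.\<close>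

lemma pt_rel_eq: "pt_rel {(Node t u, if t = u then Node Leaf Leaf else Leaf) | t u. True}"
proof (rule pt_relI[where T = "\<lambda>n. 50 * n + 50" and c = "\<lambda>b. Branch b Skip
    ((Push (b + 1) True ;; split_loop b) ;; mv (b + 2) (b + 1) ;; compare_loop b ;; clear b ;;
     pushes b (bits (Node Leaf Leaf)) ;; Branch (b + 2) Skip (clear (b + 2) ;; clear b ;; Push b False))"])
  fix b :: nat and s v w
  assume "(v, w) \<in> {(Node t u, if t = u then Node Leaf Leaf else Leaf) | t u. True}"
    and s: "s b = bits v" "\<And>i. i > b \<Longrightarrow> s i = []"
  then obtain t u where v: "v = Node t u" and w: "w = (if t = u then Node Leaf Leaf else Leaf)" by blast
  let ?m = "mismatches (bits t) (bits u)"
  let ?s = "s(b := bits (Node Leaf Leaf), b + 2 := replicate ?m True)"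
  have last: "runs (Branch (b + 2) Skip (clear (b + 2) ;; clear b ;; Push b False)) ?s
      (s(b := bits w)) (2 * tsize t + 20)"
  proof (cases "t = u")
    case True
    have "s(b + 2 := []) = s" using s(2)[of "b + 2"] by (simp add: fun_upd_idem)
    with True show ?thesis
      by (intro runs_conv[OF runs_Branch_Nil]) (use s in \<open>auto simp: w fun_eq_iff\<close>)
  next
    case False
    then obtain m where m: "?m = Suc m" using mismatches_bits by (metis not0_implies_Suc)
    have le: "?m \<le> tsize t" using mismatches_le[of "bits t" "bits u"] by simp
    show ?thesis
      by (rule runs_conv, rule runs_Branch_T[of _ _ "replicate m True"], simp add: m, rule runs_Seq,
          rule runs_clear, rule runs_Seq, rule runs_clear, rule runs_Push)
        (use False s w m le in auto)
  qed
  have "runs (Branch b Skip ((Push (b + 1) True ;; split_loop b) ;; mv (b + 2) (b + 1) ;; compare_loop b ;; clear b ;;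
     pushes b (bits (Node Leaf Leaf)) ;; Branch (b + 2) Skip (clear (b + 2) ;; clear b ;; Push b False)))
     s (s(b := bits w)) (50 * tsize v + 50)"
    by (rule runs_conv, rule runs_Branch_T[of _ _ "bits t @ bits u"], simp add: v s,
        rule runs_Seq, rule runs_split[of _ _ t "bits u"], simp, simp add: s, simp add: s,
        rule runs_Seq, rule runs_mv, simp, rule runs_Seq, rule runs_compare_loop, rule runs_Seq, rule runs_clear,
        rule runs_Seq, rule runs_pushes, rule runs_start[OF last])
      (use s v in auto)
  then show "tsize w \<le> 50 * tsize v + 50 \<and> runs (Branch b Skip ((Push (b + 1) True ;; split_loop b) ;;
     mv (b + 2) (b + 1) ;; compare_loop b ;; clear b ;;
     pushes b (bits (Node Leaf Leaf)) ;; Branch (b + 2) Skip (clear (b + 2) ;; clear b ;; Push b False)))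
     s (s(b := bits w)) (50 * tsize v + 50)"
    by (simp add: w)
qed (intro pbound_intros)

text \<open>The bits of the input serve as the loop counter, so there are exactly
  \<open>tsize t\<close> rounds. The bound \<open>B\<close> on all intermediate values keeps the
  cost of every round polynomial in the size of the original input.\<close>

lemma pt_rel_iterate:
  assumes "pt_rel R" "pbound B"
    and Q: "\<And>t u. (t, u) \<in> Q \<Longrightarrow> \<exists>x. x 0 = t \<and> x (tsize t) = u \<and>
      (\<forall>i<tsize t. (x i, x (Suc i)) \<in> R) \<and> (\<forall>i\<le>tsize t. tsize (x i) \<le> B (tsize t))"
  shows "pt_rel Q"
proof -
  obtain c p where c: "computes c (poly p) R"
    using assms(1) unfolding pt_rel_def by blast
  let ?c = "\<lambda>b. copy b ;; While b (c (b + 1)) (c (b + 1)) ;; mv (b + 1) (b + 2) ;; mv (b + 2) b"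
  let ?T = "\<lambda>n. 10 * n + n * (poly p (B n) + 2) + 8 * B n + 20"
  show ?thesis
  proof (rule pt_relI[where T = ?T and c = ?c])
    fix b :: nat and s t u assume tu: "(t, u) \<in> Q" and s: "s b = bits t" "\<And>i. i > b \<Longrightarrow> s i = []"
    let ?n = "tsize t"
    from Q[OF tu] obtain x where x: "x 0 = t" "x ?n = u" "\<And>i. i < ?n \<Longrightarrow> (x i, x (Suc i)) \<in> R"
      "\<And>i. i \<le> ?n \<Longrightarrow> tsize (x i) \<le> B ?n" by blast
    have loop: "runs (While b (c (b + 1)) (c (b + 1))) (s(b := w, b + 1 := bits (x i)))
        (s(b := [], b + 1 := bits u)) (length w * (poly p (B ?n) + 2) + 1)"
      if "i + length w = ?n" for i w
      using that
    proof (induction w arbitrary: i)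
      case Nil
      then show ?case using x(2) by (intro runs_conv[OF runs_While_Nil]) auto
    next
      case (Cons a w)
      then have i: "i < ?n" by simp
      have le: "poly p (tsize (x i)) \<le> poly p (B ?n)"
        using x(4)[of i] i by (intro poly_nat_mono) simp
      let ?s = "s(b := w, b + 1 := bits (x i))"
      have "runs (c (b + 1)) ?s (?s(b + 1 := bits (x (Suc i)))) (poly p (tsize (x i)))"
        by (rule computes_runs[OF c x(3)[OF i]]) (use s in auto)
      then have "runs (c (b + 1)) ?s (s(b := w, b + 1 := bits (x (Suc i)))) (poly p (B ?n))"
        by (rule runs_conv) (use le in auto)
      then have 1: "runs (if a then c (b + 1) else c (b + 1)) ((s(b := a # w, b + 1 := bits (x i)))(b := w))
          (s(b := w, b + 1 := bits (x (Suc i)))) (poly p (B ?n))"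
        by (simp add: fun_upd_twist)
      have 2: "runs (While b (c (b + 1)) (c (b + 1))) (s(b := w, b + 1 := bits (x (Suc i))))
        (s(b := [], b + 1 := bits u)) (length w * (poly p (B ?n) + 2) + 1)"
        by (rule Cons.IH) (use Cons.prems in simp)
      have "(s(b := a # w, b + 1 := bits (x i))) b = a # w" by simp
      from runs_While_Cons[where s = "s(b := a # w, b + 1 := bits (x i))" and r = b, OF this 1 2]
      show ?case by (rule runs_conv) (auto simp: fun_upd_def)
    qed
    have "runs (?c b) s (s(b := bits u)) (?T ?n)"
      by (rule runs_conv, rule runs_Seq, rule runs_copy, simp add: s, simp add: s, rule runs_Seq,
          rule runs_start[OF loop[of 0 "bits t"]], simp, use s x(1) in force,
          rule runs_Seq, rule runs_mv, simp, rule runs_mv)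
        (use s x(4)[of ?n] x(2) in auto)
    then show "tsize u \<le> ?T ?n \<and> runs (?c b) s (s(b := bits u)) (?T ?n)"
      using x(4)[of ?n] x(2) by simp
  qed (intro pbound_intros assms)
qed


section \<open>Polynomial-time functions on encodable types\<close>

text \<open>Since \<open>from_tree\<close> is total, a verifier may decode any witness without first
  testing whether it is a code.\<close>

class code =
  fixes to_tree :: "'a \<Rightarrow> tree" and from_tree :: "tree \<Rightarrow> 'a"
  assumes from_to_tree [simp]: "from_tree (to_tree x) = x"

lemma to_tree_inject [simp]: "to_tree x = to_tree y \<longleftrightarrow> x = y"
  by (metis from_to_tree)

definition sz :: "'a :: code \<Rightarrow> nat" where
  "sz x = tsize (to_tree x)"

instantiation tree :: code
begin
definition "to_tree (t :: tree) = t"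
definition "from_tree (t :: tree) = t"
instance by standard (simp add: to_tree_tree_def from_tree_tree_def)
end

instantiation bool :: code
begin
definition "to_tree b = (if b then Node Leaf Leaf else Leaf)"
definition "from_tree t \<longleftrightarrow> t \<noteq> Leaf"
instance by standard (simp add: to_tree_bool_def from_tree_bool_def)
end

instantiation prod :: (code, code) code
begin
definition "to_tree p = Node (to_tree (fst p)) (to_tree (snd p))"
definition "from_tree t = (from_tree (car t), from_tree (cdr t))"
instance by standard (simp add: to_tree_prod_def from_tree_prod_def)
end

instantiation list :: (code) code
begin
primrec to_tree_list :: "'a list \<Rightarrow> tree" where
  "to_tree_list [] = Leaf"
| "to_tree_list (x # xs) = Node (to_tree x) (to_tree_list xs)"
primrec from_tree_list :: "tree \<Rightarrow> 'a list" where
  "from_tree_list Leaf = []"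
| "from_tree_list (Node t u) = from_tree t # from_tree_list u"
instance
proof
  show "from_tree (to_tree xs) = xs" for xs :: "'a list" by (induction xs) auto
qed
end

lemma sz_simps [simp]:
  "sz (x, y) = sz x + sz y + 1" "sz ([] :: 'a :: code list) = 1" "sz (z # zs) = sz z + sz zs + 1"
  by (simp_all add: sz_def to_tree_prod_def)

lemma sz_pos [simp]: "0 < sz x"
  by (simp add: sz_def)

lemma sz_bool: "sz (b :: bool) \<le> 3"
  by (simp add: sz_def to_tree_bool_def)

lemma sz_append: "sz (xs @ ys) + 1 = sz xs + sz ys"
  by (induction xs) auto

lemma sz_drop_le: "sz (drop n xs) \<le> sz xs"
  by (induction xs arbitrary: n) (auto simp: drop_Cons split: nat.split intro: le_SucI trans_le_add2)

lemma length_le_sz: "length xs \<le> sz xs"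
  by (induction xs) auto

lemma sz_le_length: "(\<And>x. x \<in> set xs \<Longrightarrow> sz x \<le> k) \<Longrightarrow> sz xs \<le> length xs * (k + 1) + 1"
proof (induction xs)
  case (Cons x xs)
  then have "sz xs \<le> length xs * (k + 1) + 1" "sz x \<le> k" by simp_all
  then show ?case by simp
qed simp

lemma sz_mem: "x \<in> set xs \<Longrightarrow> sz x \<le> sz xs"
  by (induction xs) auto

lemma sz_rev [simp]: "sz (rev xs) = sz xs"
proof (induction xs)
  case (Cons x xs)
  then show ?case using sz_append[of "rev xs" "[x]"] by simp
qed simp

section \<open>Polynomial-time functions and their closure properties\<close>

definition ptime :: "('a :: code \<Rightarrow> 'b :: code) \<Rightarrow> bool" where
  "ptime f \<longleftrightarrow> pt_rel {(to_tree x, to_tree (f x)) | x. True}"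

named_theorems ptimes

lemma ptime_size:
  assumes "ptime f"
  obtains p where "\<And>x. sz (f x) \<le> poly p (sz x)"
  using assms computes_size unfolding ptime_def pt_rel_def sz_def by blast

lemma ptime_pbound:
  assumes "ptime f"
  obtains B where "pbound B" "\<And>x. sz (f x) \<le> B (sz x)" "mono B"
proof -
  obtain p where "\<And>x. sz (f x) \<le> poly p (sz x)" using ptime_size[OF assms] by blast
  then show thesis
    by (rule that[of "poly p", OF pbound_poly[OF pbound_id]]) (simp add: monoI poly_nat_mono)
qed

text \<open>\<open>ptime\<close> sees only the trees, so the same program computes every function
  with the same input and output trees at other types. A nonempty list is coded like a pair and a
  number like its list of binary digits, for instance.\<close>

lemma ptime_retype:
  assumes "ptime f" "\<And>x. \<exists>y. to_tree x = to_tree y \<and> to_tree (g x) = to_tree (f y)"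
  shows "ptime g"
  unfolding ptime_def
  by (rule pt_rel_subset[OF assms(1)[unfolded ptime_def]]) (use assms(2) in force)

lemma ptime_id [ptimes]: "ptime (\<lambda>x. x)"
  unfolding ptime_def by (rule pt_rel_subset[OF pt_rel_id]) blast

lemma ptime_const [ptimes]: "ptime (\<lambda>x. k)"
  unfolding ptime_def by (rule pt_rel_subset[OF pt_rel_const[of "to_tree k"]]) blast

lemma ptime_comp: "ptime f \<Longrightarrow> ptime g \<Longrightarrow> ptime (\<lambda>x. f (g x))"
  unfolding ptime_def
  by (rule pt_rel_subset[OF pt_rel_comp[of "{(to_tree x, to_tree (g x)) | x. True}" "{(to_tree x, to_tree (f x)) | x. True}"]])
    blast+

lemma ptime_Pair [ptimes]:
  assumes "ptime f" "ptime g"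
  shows "ptime (\<lambda>x. (f x, g x))"
  unfolding ptime_def
  by (rule pt_rel_subset[OF pt_rel_pair[OF assms[unfolded ptime_def]]])
    (auto simp: to_tree_prod_def)

lemma ptime_Cons [ptimes]:
  assumes "ptime f" "ptime g"
  shows "ptime (\<lambda>x. f x # g x)"
  by (rule ptime_retype[OF ptime_Pair[OF assms]]) (auto simp: to_tree_prod_def)

lemma ptime_fst [ptimes]: "ptime f \<Longrightarrow> ptime (\<lambda>x. fst (f x))"
  by (rule ptime_comp[of fst]) (auto simp: ptime_def to_tree_prod_def intro!: pt_rel_subset[OF pt_rel_car])

lemma ptime_snd [ptimes]: "ptime f \<Longrightarrow> ptime (\<lambda>x. snd (f x))"
  by (rule ptime_comp[of snd]) (auto simp: ptime_def to_tree_prod_def intro!: pt_rel_subset[OF pt_rel_cdr])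

lemma ptime_car [ptimes]: "ptime f \<Longrightarrow> ptime (\<lambda>x. car (f x))"
  by (rule ptime_comp[of car]) (auto simp: ptime_def to_tree_tree_def intro!: pt_rel_subset[OF pt_rel_car])

lemma ptime_cdr [ptimes]: "ptime f \<Longrightarrow> ptime (\<lambda>x. cdr (f x))"
  by (rule ptime_comp[of cdr]) (auto simp: ptime_def to_tree_tree_def intro!: pt_rel_subset[OF pt_rel_cdr])

lemma ptime_Node [ptimes]: "ptime f \<Longrightarrow> ptime g \<Longrightarrow> ptime (\<lambda>x. Node (f x) (g x))"
  by (rule ptime_retype[OF ptime_Pair[of f g]]) (auto simp: to_tree_prod_def to_tree_tree_def)

lemma ptime_if [ptimes]:
  assumes "ptime C" "ptime f" "ptime g"
  shows "ptime (\<lambda>x. if C x then f x else g x)"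
  unfolding ptime_def
proof (rule pt_rel_if[OF assms(1)[unfolded ptime_def] assms(3,2)[unfolded ptime_def]], clarify)
  fix x
  show "\<exists>v. (to_tree x, v) \<in> {(to_tree x, to_tree (C x)) | x. True} \<and>
      (if v = Leaf then (to_tree x, to_tree (if C x then f x else g x)) \<in> {(to_tree x, to_tree (g x)) | x. True}
       else (to_tree x, to_tree (if C x then f x else g x)) \<in> {(to_tree x, to_tree (f x)) | x. True})"
    by (intro exI[of _ "to_tree (C x)"]) (auto simp: to_tree_bool_def)
qed

lemma ptime_eq [ptimes]:
  assumes "ptime f" "ptime g"
  shows "ptime (\<lambda>x. f x = g x)"
  unfolding ptime_def
proof (rule pt_rel_subset[OF pt_rel_comp[OF ptime_Pair[OF assms, unfolded ptime_def] pt_rel_eq]], clarify)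
  fix x
  show "(to_tree x, to_tree (f x = g x)) \<in> {(to_tree x, to_tree (f x, g x)) | x. True} O
      {(Node t u, if t = u then Node Leaf Leaf else Leaf) | t u. True}"
    by (rule relcompI[of _ "to_tree (f x, g x)"], blast) (auto simp: to_tree_bool_def to_tree_prod_def)
qed

lemma ptime_conj [ptimes]: "ptime f \<Longrightarrow> ptime g \<Longrightarrow> ptime (\<lambda>x. f x \<and> g x)"
  by (rule back_subst[where P = ptime, OF ptime_if[of f g "\<lambda>_. False"]]) (auto intro: ptime_const)

lemma ptime_disj [ptimes]: "ptime f \<Longrightarrow> ptime g \<Longrightarrow> ptime (\<lambda>x. f x \<or> g x)"
  by (rule back_subst[where P = ptime, OF ptime_if[of f "\<lambda>_. True" g]]) (auto intro: ptime_const)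

lemma ptime_Not [ptimes]: "ptime f \<Longrightarrow> ptime (\<lambda>x. \<not> f x)"
  by (rule back_subst[where P = ptime, OF ptime_if[of f "\<lambda>_. False" "\<lambda>_. True"]]) (auto intro: ptime_const)

lemma ptime_case_list:
  assumes "ptime l" "ptime f" "ptime (\<lambda>p. g (fst p) (fst (snd p)) (snd (snd p)))"
  shows "ptime (\<lambda>x. case l x of [] \<Rightarrow> f x | y # ys \<Rightarrow> g x y ys)"
proof -
  let ?g = "\<lambda>p. g (fst p) (fst (snd p)) (snd (snd p))"
  let ?b = "{(Node (to_tree x) (to_tree ys), to_tree (case ys of [] \<Rightarrow> f x | z # zs \<Rightarrow> g x z zs)) | x ys. True}"
  have "pt_rel ?b"
  proof (rule pt_rel_if[OF pt_rel_cdr])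
    show "pt_rel {(to_tree p, to_tree (f (fst p))) | p :: _ \<times> 'b list. True}"
      using ptime_comp[OF assms(2) ptime_fst[OF ptime_id]] unfolding ptime_def .
    show "pt_rel {(to_tree p, to_tree (?g p)) | p. True}"
      using assms(3) unfolding ptime_def .
    fix t u assume "(t, u) \<in> ?b"
    then obtain x ys where t: "t = Node (to_tree x) (to_tree ys)"
      and u: "u = to_tree (case ys of [] \<Rightarrow> f x | z # zs \<Rightarrow> g x z zs)" by blast
    show "\<exists>v. (t, v) \<in> {(t, cdr t) | t. True} \<and> (if v = Leaf
        then (t, u) \<in> {(to_tree p, to_tree (f (fst p))) | p :: _ \<times> 'b list. True}
        else (t, u) \<in> {(to_tree p, to_tree (?g p)) | p. True})"
    proof (cases ys)
      case Nil
      then have "t = to_tree (x, ys)" "u = to_tree (f (fst (x, ys)))"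
        by (simp_all add: t u to_tree_prod_def)
      moreover have "cdr t = Leaf" using Nil by (simp add: t)
      ultimately show ?thesis by (intro exI[of _ "cdr t"]) force
    next
      case (Cons z zs)
      \<comment> \<open>The pair \<open>(x, z # zs)\<close> and the triple \<open>(x, z, zs)\<close>
        have the same tree, so the second case needs no conversion.\<close>
      then have "t = to_tree (x, z, zs)" "u = to_tree (?g (x, z, zs))"
        by (simp_all add: t u to_tree_prod_def)
      moreover have "cdr t \<noteq> Leaf" using Cons by (simp add: t)
      ultimately show ?thesis by (intro exI[of _ "cdr t"]) force
    qed
  qed
  from pt_rel_comp[OF ptime_Pair[OF ptime_id assms(1), unfolded ptime_def] this]
  show ?thesis unfolding ptime_def by (rule pt_rel_subset) (auto simp: to_tree_prod_def)
qed

text \<open>The number of rounds is the tree size of the pair \<open>(c, g c)\<close>, which is the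
  input of the loop in \<open>pt_rel_iterate\<close>. The parameter \<open>c\<close> travels along
  unchanged, so it remains available after the loop.\<close>

lemma ptime_funpow:
  fixes f :: "'s :: code \<Rightarrow> 's" and g :: "'c :: code \<Rightarrow> 's"
  assumes f: "ptime f" and g: "ptime g" and B: "pbound B" "\<And>c i. sz ((f ^^ i) (g c)) \<le> B (sz c)"
  shows "ptime (\<lambda>c. (f ^^ (sz c + sz (g c) + 1)) (g c))"
proof -
  let ?f = "\<lambda>p :: 'c \<times> 's. (fst p, f (snd p))"
  obtain q where q: "\<And>n. B n \<le> poly q n" using B(1) unfolding pbound_def by blast
  have f': "ptime ?f" by (intro ptimes ptime_comp[OF f])
  have iter: "(?f ^^ i) (c, s) = (c, (f ^^ i) s)" for i c s
    by (induction i) auto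
  let ?Q = "{(to_tree (c, g c), to_tree (c, (f ^^ (sz c + sz (g c) + 1)) (g c))) | c. True}"
  have "pt_rel ?Q"
  proof (rule pt_rel_iterate[OF f'[unfolded ptime_def], where B = "\<lambda>n. n + poly q n + 1"])
    fix t u assume "(t, u) \<in> ?Q"
    then obtain c where t: "t = to_tree (c, g c)" and u: "u = to_tree (c, (f ^^ (sz c + sz (g c) + 1)) (g c))"
      by blast
    have n: "tsize t = sz c + sz (g c) + 1" by (simp add: t sz_def to_tree_prod_def)
    have "sz (c, (f ^^ i) (g c)) \<le> tsize t + poly q (tsize t) + 1" for i
    proof -
      have "sz ((f ^^ i) (g c)) \<le> poly q (sz c)" using B(2) q order_trans by blast
      also have "\<dots> \<le> poly q (tsize t)" by (rule poly_nat_mono) (simp add: n)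
      finally show ?thesis using n by simp
    qed
    moreover have "(to_tree (c, (f ^^ i) (g c)), to_tree (c, (f ^^ Suc i) (g c)))
        \<in> {(to_tree x, to_tree (?f x)) | x. True}" for i
      by (intro CollectI exI[of _ "(c, (f ^^ i) (g c))"]) simp
    moreover have "to_tree (c, (f ^^ tsize t) (g c)) = u" by (simp only: n u)
    moreover have "to_tree (c, (f ^^ 0) (g c)) = t" by (simp add: t)
    ultimately show "\<exists>x. x 0 = t \<and> x (tsize t) = u \<and>
        (\<forall>i<tsize t. (x i, x (Suc i)) \<in> {(to_tree x, to_tree (?f x)) | x. True}) \<and>
        (\<forall>i\<le>tsize t. tsize (x i) \<le> tsize t + poly q (tsize t) + 1)"
      unfolding sz_def by (intro exI[of _ "\<lambda>i. to_tree (c, (f ^^ i) (g c))"]) blast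
  qed (intro pbound_intros)
  from pt_rel_comp[OF pt_rel_comp[OF ptime_Pair[OF ptime_id g, unfolded ptime_def] this] pt_rel_cdr]
  show ?thesis unfolding ptime_def
  proof (rule pt_rel_subset, clarify)
    fix c
    let ?s = "(f ^^ (sz c + sz (g c) + 1)) (g c)"
    show "(to_tree c, to_tree ?s) \<in> ({(to_tree x, to_tree (x, g x)) | x. True} O ?Q) O {(t, cdr t) | t. True}"
      by (rule relcompI[of _ "to_tree (c, ?s)"], rule relcompI[of _ "to_tree (c, g c)"], blast, blast)
        (simp add: to_tree_prod_def)
  qed
qed

text \<open>The loop state holds the parameter, the remaining list and the accumulator. A step on an
  exhausted list does nothing, so the surplus rounds of \<open>ptime_funpow\<close> are harmless.
  The essential hypothesis is the polynomial bound on the accumulator after every prefix.\<close>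

lemma ptime_fold:
  fixes f :: "'c :: code \<Rightarrow> 'x :: code \<Rightarrow> 's :: code \<Rightarrow> 's"
  assumes f: "ptime (\<lambda>p. f (fst p) (fst (snd p)) (snd (snd p)))"
    and xs: "ptime xs" and s: "ptime s"
    and B: "pbound B" "\<And>c ys zs. xs c = ys @ zs \<Longrightarrow> sz (fold (f c) ys (s c)) \<le> B (sz c)"
  shows "ptime (\<lambda>c. fold (f c) (xs c) (s c))"
proof -
  let ?step = "\<lambda>p :: 'c \<times> 'x list \<times> 's. case fst (snd p) of [] \<Rightarrow> p
      | y # ys \<Rightarrow> (fst p, ys, f (fst p) y (snd (snd p)))"
  let ?g = "\<lambda>c. (c, xs c, s c)"
  obtain A where A: "pbound A" "\<And>c. sz (xs c) \<le> A (sz c)" using ptime_pbound[OF xs] by blast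
  have iter: "(?step ^^ i) (c, ys, a) = (c, drop i ys, fold (f c) (take i ys) a)" for i c ys a
  proof (induction i arbitrary: ys a)
    case (Suc i)
    show ?case unfolding funpow_Suc_right comp_def
      by (cases ys) (simp_all add: Suc)
  qed simp
  have step: "ptime ?step"
    by (intro ptime_case_list ptimes
        ptime_comp[OF f, of "\<lambda>p. (fst (fst p), fst (snd p), snd (snd (fst p)))", simplified])
  have "ptime (\<lambda>c. (?step ^^ (sz c + sz (?g c) + 1)) (?g c))"
  proof (rule ptime_funpow[OF step])
    show "ptime ?g" by (intro ptimes xs s)
    show "pbound (\<lambda>n. n + A n + B n + 2)" by (intro pbound_intros A(1) B(1))
    fix c i
    have "sz (drop i (xs c)) \<le> A (sz c)" using sz_drop_le A(2) order_trans by blast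
    moreover have "sz (fold (f c) (take i (xs c)) (s c)) \<le> B (sz c)"
      by (rule B(2)[of _ _ "drop i (xs c)"]) simp
    ultimately show "sz ((?step ^^ i) (?g c)) \<le> sz c + A (sz c) + B (sz c) + 2"
      by (simp add: iter)
  qed
  from ptime_snd[OF ptime_snd[OF this]] show ?thesis
  proof (rule back_subst[where P = ptime])
    have "take (sz c + sz (?g c) + 1) (xs c) = xs c" for c
      using length_le_sz[of "xs c"] by simp
    then show "(\<lambda>c. snd (snd ((?step ^^ (sz c + sz (?g c) + 1)) (?g c)))) = (\<lambda>c. fold (f c) (xs c) (s c))"
      unfolding iter snd_conv by metis
  qed
qed


subsection \<open>Input and output on tapes\<close>

text \<open>The word is first reversed into \<open>k\<close>, so each round puts a cell in front of
  a finished list. The pushes spell, last bit first, the prefix \<open>[True, False]\<close> for an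
  element \<open>False\<close> and \<open>[True, True, False, False]\<close> for an element
  \<open>True\<close>.\<close>

definition read_word :: "nat \<Rightarrow> nat \<Rightarrow> com" where
  "read_word r k = mv r k ;; Push r False ;; While k (Push r False ;; Push r True)
     (Push r False ;; Push r False ;; Push r True ;; Push r True)"

lemma runs_read_word:
  assumes "r \<noteq> k" "s k = []"
  shows "runs (read_word r k) s (s(r := bits (to_tree (s r)))) (20 * length (s r) + 10)"
proof -
  let ?c = "While k (Push r False ;; Push r True) (Push r False ;; Push r False ;; Push r True ;; Push r True)"
  have loop: "runs ?c (s(r := bits (to_tree v), k := w)) (s(r := bits (to_tree (rev w @ v)))) (10 * length w + 1)" for v w
  proof (induction w arbitrary: v)
    case Nil
    then show ?case using assms by (auto intro!: runs_conv[OF runs_While_Nil])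
  next
    case (Cons a w)
    let ?s = "s(r := bits (to_tree v), k := a # w)"
    have 0: "?s k = a # w" by simp
    have 1: "runs (if a then Push r False ;; Push r False ;; Push r True ;; Push r True else Push r False ;; Push r True)
        (?s(k := w)) (s(r := bits (to_tree (a # v)), k := w)) 8"
    proof (cases a)
      case True
      have "runs (Push r False ;; Push r False ;; Push r True ;; Push r True) (?s(k := w))
          (s(r := bits (to_tree (a # v)), k := w)) 8"
        by (rule runs_conv, (rule runs_Seq runs_Push)+)
          (use assms True in \<open>auto simp: to_tree_bool_def fun_eq_iff\<close>)
      then show ?thesis using True by simp
    next
      case False
      have "runs (Push r False ;; Push r True) (?s(k := w))
          (s(r := bits (to_tree (a # v)), k := w)) 8"
        by (rule runs_conv, (rule runs_Seq runs_Push)+)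
          (use assms False in \<open>auto simp: to_tree_bool_def fun_eq_iff\<close>)
      then show ?thesis using False by simp
    qed
    from runs_While_Cons[where s = ?s and r = k, OF 0 1 Cons] show ?case
      by (rule runs_conv) auto
  qed
  show ?thesis unfolding read_word_def
    by (rule runs_conv, rule runs_Seq, rule runs_mv, rule assms, rule runs_Seq, rule runs_Push,
        rule runs_start[OF loop[of "[]" "rev (s r)"]])
      (use assms in \<open>auto simp: fun_eq_iff\<close>)
qed

text \<open>A \<open>True\<close> popped by the loop announces a list cell. The inner branch decodes
  its element and drops the two bits \<open>False\<close> that complete an element
  \<open>True\<close>. The final \<open>False\<close> codes the empty list and leaves register 0
  empty, which ends the loop.\<close>

definition write_word :: com where
  "write_word = While 0 Skip (Branch 0 (Push 1 False) (Branch 0 Skip Skip ;; Branch 0 Skip Skip ;; Push 1 True)) ;; 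
     mv 1 0"

lemma runs_write_word:
  assumes "s 0 = bits (to_tree (w :: bool list))" "s 1 = []"
  shows "runs write_word s (s(0 := w)) (20 * length w + 10)"
proof -
  let ?d = "Branch 0 (Push 1 False) (Branch 0 Skip Skip ;; Branch 0 Skip Skip ;; Push 1 True)"
  have loop: "runs (While 0 Skip ?d) (s(0 := bits (to_tree w), 1 := v)) (s(0 := [], 1 := rev w @ v))
      (12 * length w + 4)" for v and w :: "bool list"
  proof (induction w arbitrary: v)
    case Nil
    show ?case
      by (rule runs_conv, rule runs_While_Cons[where b = False and w = "[]"], simp, simp, rule runs_Skip,
          rule runs_While_Nil) auto
  next
    case (Cons a w)
    have "runs ?d (s(0 := bits (to_tree a) @ bits (to_tree w), 1 := v)) (s(0 := bits (to_tree w), 1 := a # v)) 9"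
    proof (cases a)
      case True
      show ?thesis
        by (rule runs_conv, rule runs_Branch_T[where w = "False # False # bits (to_tree w)"], simp add: True to_tree_bool_def,
            rule runs_Seq, rule runs_Branch_F[where w = "False # bits (to_tree w)"], simp, rule runs_Skip,
            rule runs_Seq, rule runs_Branch_F[where w = "bits (to_tree w)"], simp, rule runs_Skip, rule runs_Push)
          (use True in \<open>auto simp: fun_eq_iff\<close>)
    next
      case False
      show ?thesis
        by (rule runs_conv, rule runs_Branch_F[where w = "bits (to_tree w)"], simp add: False to_tree_bool_def,
            rule runs_Push) (use False in \<open>auto simp: fun_eq_iff\<close>)
    qed
    then have 1: "runs (if True then ?d else Skip)
        ((s(0 := bits (to_tree (a # w)), 1 := v))(0 := bits (to_tree a) @ bits (to_tree w)))
        (s(0 := bits (to_tree w), 1 := a # v)) 9"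
      by (simp only: if_True) (erule runs_start, auto)
    have 0: "(s(0 := bits (to_tree (a # w)), 1 := v)) 0 = True # bits (to_tree a) @ bits (to_tree w)"
      by simp
    show ?case
      by (rule runs_conv, rule runs_While_Cons[where s = "s(0 := bits (to_tree (a # w)), 1 := v)" and r = 0, OF 0 1 Cons])
        auto
  qed
  show ?thesis unfolding write_word_def
    by (rule runs_conv, rule runs_Seq, rule runs_start[OF loop[of w "[]"]], use assms in \<open>simp add: fun_eq_iff\<close>,
        rule runs_mv, simp) (use assms in auto)
qed

lemma sz_word: "sz (w :: bool list) \<le> 4 * length w + 1"
  by (induction w) (auto simp: sz_def to_tree_bool_def)

lemma poly_time_computable_runs:
  assumes "1 \<le> n" "pbound T" "\<And>ws. length ws = n \<Longrightarrow> \<exists>s'. runs c (\<lambda>r. if r < n then ws ! r else []) s'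
      (T (sum_list (map length ws))) \<and> s' 0 = f ws \<and> length (f ws) \<le> T (sum_list (map length ws))"
  shows "poly_time_computable n f"
proof -
  have "pbound (\<lambda>n. T n + 2 * T n + 2)" by (intro pbound_intros assms)
  then obtain p where p: "\<And>n. T n + 2 * T n + 2 \<le> poly p n" unfolding pbound_def by blast
  show ?thesis
  proof (rule poly_time_computable_exec[OF assms(1), where c = c and p = p])
    fix ws :: "bool list list" assume "length ws = n"
    from assms(3)[OF this] obtain s' where s': "runs c (\<lambda>r. if r < n then ws ! r else []) s'
      (T (sum_list (map length ws)))" "s' 0 = f ws" "length (f ws) \<le> T (sum_list (map length ws))" by blast
    then obtain t where "t \<le> T (sum_list (map length ws))" "exec c (\<lambda>r. if r < n then ws ! r else []) s' t"
      unfolding runs_def by blast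
    with s' show "\<exists>s' t. exec c (\<lambda>r. if r < n then ws ! r else []) s' t \<and> s' 0 = f ws \<and>
        t + 2 * length (f ws) + 2 \<le> poly p (sum_list (map length ws))"
      using p[of "sum_list (map length ws)"]
      by (intro exI[of _ s'] exI[of _ t]) auto
  qed
qed

theorem ptime_computable_1:
  assumes "ptime (f :: bool list \<Rightarrow> bool list)"
  shows "poly_time_computable 1 (\<lambda>ws. f (ws ! 0))"
proof -
  obtain c p where c: "computes c (poly p) {(to_tree x, to_tree (f x)) | x. True}"
    using assms unfolding ptime_def pt_rel_def by blast
  show ?thesis
  proof (rule poly_time_computable_runs[where c = "read_word 0 1 ;; c 0 ;; write_word"])
    show "pbound (\<lambda>n. 20 * n + 21 * poly p (4 * n + 1) + 20)" by (intro pbound_intros)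
    fix ws :: "bool list list" assume ws: "length ws = 1"
    let ?s = "\<lambda>r. if r < 1 then ws ! r else []" and ?x = "ws ! 0"
    have n: "sum_list (map length ws) = length ?x" using ws by (cases ws) auto
    have 1: "poly p (tsize (to_tree ?x)) \<le> poly p (4 * length ?x + 1)"
      using sz_word[of ?x] by (intro poly_nat_mono) (simp add: sz_def)
    have 2: "length (f ?x) \<le> poly p (4 * length ?x + 1)"
      using computes_size[OF c, of "to_tree ?x" "to_tree (f ?x)"] 1 length_le_sz[of "f ?x"]
      by (auto simp: sz_def)
    have "runs (read_word 0 1 ;; c 0 ;; write_word) ?s (?s(0 := f ?x)) (20 * length ?x + 21 * poly p (4 * length ?x + 1) + 20)"
      by (rule runs_conv, rule runs_Seq, rule runs_read_word, simp, simp, rule runs_Seq,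
          rule computes_runs[OF c, of "to_tree ?x" "to_tree (f ?x)"], blast, simp, simp,
          rule runs_write_word[of _ "f ?x"]) (use 1 2 in auto)
    with 2 show "\<exists>s'. runs (read_word 0 1 ;; c 0 ;; write_word) ?s s'
        (20 * sum_list (map length ws) + 21 * poly p (4 * sum_list (map length ws) + 1) + 20) \<and>
        s' 0 = f ?x \<and> length (f ?x) \<le> 20 * sum_list (map length ws) + 21 * poly p (4 * sum_list (map length ws) + 1) + 20"
      unfolding n by (intro exI[of _ "?s(0 := f ?x)"]) auto
  qed simp
qed

theorem ptime_computable_2:
  assumes "ptime (\<lambda>p :: bool list \<times> bool list. f (fst p) (snd p) :: bool list)"
  shows "poly_time_computable 2 (\<lambda>ws. f (ws ! 0) (ws ! 1))"
proof -
  obtain c p where c: "computes c (poly p) {(to_tree x, to_tree (f (fst x) (snd x))) | x. True}"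
    using assms unfolding ptime_def pt_rel_def by blast
  let ?c = "read_word 0 2 ;; read_word 1 2 ;; cons_regs 0 ;; c 0 ;; write_word"
  show ?thesis
  proof (rule poly_time_computable_runs[where c = ?c])
    show "pbound (\<lambda>n. 200 * n + 21 * poly p (4 * n + 3) + 200)" by (intro pbound_intros)
    fix ws :: "bool list list" assume ws: "length ws = 2"
    let ?s = "\<lambda>r. if r < 2 then ws ! r else []" and ?x = "ws ! 0" and ?y = "ws ! 1"
    let ?z = "f ?x ?y"
    have n: "sum_list (map length ws) = length ?x + length ?y"
      using ws by (auto simp: numeral_2_eq_2 length_Suc_conv)
    have sz: "tsize (to_tree ?x) \<le> 4 * length ?x + 1" "tsize (to_tree ?y) \<le> 4 * length ?y + 1"
      using sz_word[of ?x] sz_word[of ?y] by (simp_all add: sz_def)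
    have 1: "poly p (tsize (to_tree (?x, ?y))) \<le> poly p (4 * (length ?x + length ?y) + 3)"
      using sz by (intro poly_nat_mono) (simp add: to_tree_prod_def)
    have 2: "length ?z \<le> poly p (4 * (length ?x + length ?y) + 3)"
      using computes_size[OF c, of "to_tree (?x, ?y)" "to_tree ?z"] 1 length_le_sz[of ?z]
      by (fastforce simp: sz_def)
    have "runs ?c ?s (?s(0 := ?z, 1 := [])) (200 * (length ?x + length ?y) + 21 * poly p (4 * (length ?x + length ?y) + 3) + 200)"
      by (rule runs_conv, rule runs_Seq, rule runs_read_word, simp, simp, rule runs_Seq, rule runs_read_word, simp, simp,
          rule runs_Seq, rule runs_cons_regs[of _ _ "to_tree ?x" "to_tree ?y"], simp, simp, simp, rule runs_Seq,
          rule computes_runs[OF c, of "to_tree (?x, ?y)" "to_tree ?z"], force, simp add: to_tree_prod_def, simp,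
          rule runs_write_word[of _ ?z]) (use 1 2 sz in auto)
    with 2 show "\<exists>s'. runs ?c ?s s'
        (200 * sum_list (map length ws) + 21 * poly p (4 * sum_list (map length ws) + 3) + 200) \<and>
        s' 0 = ?z \<and> length ?z \<le> 200 * sum_list (map length ws) + 21 * poly p (4 * sum_list (map length ws) + 3) + 200"
      unfolding n by (intro exI[of _ "?s(0 := ?z, 1 := [])"]) auto
  qed simp
qed

subsection \<open>Lists\<close>

lemma sz_prefix_le: "sz ys \<le> sz (ys @ zs)"
  using sz_append[of ys zs] sz_pos[of zs] by linarith

text \<open>The common pattern behind \<open>rev\<close>, append and \<open>map\<close>: after any
  prefix the accumulator has gained at most one element of bounded size per list entry.\<close>

lemma ptime_fold_Cons:
  assumes g: "ptime (\<lambda>p. g (fst p) (snd p))" and xs: "ptime xs" and s: "ptime s"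
  shows "ptime (\<lambda>c. fold (\<lambda>x a. g c x # a) (xs c) (s c))"
proof -
  obtain G where G: "pbound G" "mono G" "\<And>p. sz (g (fst p) (snd p)) \<le> G (sz p)"
    using ptime_pbound[OF g] by blast
  obtain X where X: "pbound X" "mono X" "\<And>c. sz (xs c) \<le> X (sz c)"
    using ptime_pbound[OF xs] by blast
  obtain A where A: "pbound A" "mono A" "\<And>c. sz (s c) \<le> A (sz c)"
    using ptime_pbound[OF s] by blast
  show ?thesis
  proof (rule ptime_fold[where B = "\<lambda>n. X n * (G (n + X n + 1) + 1) + A n"])
    show "ptime (\<lambda>p. g (fst p) (fst (snd p)) # snd (snd p))"
      by (intro ptimes ptime_comp[OF g, of "\<lambda>p. (fst p, fst (snd p))", simplified])
    show "pbound (\<lambda>n. X n * (G (n + X n + 1) + 1) + A n)"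
      by (intro pbound_intros pbound_comp[OF G(1) _ G(2)] X A)
    fix c ys zs assume eq: "xs c = ys @ zs"
    let ?k = "G (sz c + X (sz c) + 1)"
    have "fold (\<lambda>x a. g c x # a) ys a = rev (map (g c) ys) @ a" for a
      by (induction ys arbitrary: a) auto
    moreover have "sz (rev (map (g c) ys) @ s c) \<le> length ys * (?k + 1) + sz (s c)"
    proof -
      have "sz (g c y) \<le> ?k" if "y \<in> set ys" for y
      proof -
        have "sz y \<le> X (sz c)" using sz_mem[of y "xs c"] that eq X(3)[of c] by simp
        then show ?thesis using G(3)[of "(c, y)"] monoD[OF G(2), of "sz (c, y)" "sz c + X (sz c) + 1"] by simp
      qed
      then have "sz (map (g c) ys) \<le> length ys * (?k + 1) + 1"
        using sz_le_length[of "map (g c) ys" ?k] by auto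
      then show ?thesis using sz_append[of "rev (map (g c) ys)" "s c"] by simp
    qed
    moreover have "length ys * (?k + 1) \<le> X (sz c) * (?k + 1)"
      using length_le_sz[of "xs c"] X(3)[of c] eq by (intro mult_le_mono1) simp
    ultimately show "sz (fold (\<lambda>x a. g c x # a) ys (s c)) \<le> X (sz c) * (?k + 1) + A (sz c)"
      using A(3)[of c] by simp
  qed (rule xs s)+
qed

lemma ptime_rev [ptimes]: "ptime xs \<Longrightarrow> ptime (\<lambda>c. rev (xs c))"
proof -
  assume xs: "ptime xs"
  have "ptime (\<lambda>c. fold (\<lambda>x a. x # a) (xs c) [])"
    by (intro ptime_fold_Cons ptimes xs)
  moreover have "fold (\<lambda>x a. x # a) ys a = rev ys @ a" for ys :: "'b list" and a
    by (induction ys arbitrary: a) auto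
  ultimately show ?thesis by simp
qed

lemma ptime_append [ptimes]:
  assumes "ptime xs" "ptime ys" shows "ptime (\<lambda>c. xs c @ ys c)"
proof -
  have "ptime (\<lambda>c. fold (\<lambda>x a. x # a) (rev (xs c)) (ys c))"
    by (intro ptime_fold_Cons ptimes assms)
  moreover have "fold (\<lambda>x a. x # a) zs a = rev zs @ a" for zs :: "'b list" and a
    by (induction zs arbitrary: a) auto
  ultimately show ?thesis by simp
qed

lemma ptime_map [ptimes]:
  assumes "ptime (\<lambda>p. g (fst p) (snd p))" "ptime xs"
  shows "ptime (\<lambda>c. map (\<lambda>x. g c x) (xs c))"
proof -
  have "ptime (\<lambda>c. rev (fold (\<lambda>x a. g c x # a) (xs c) []))"
    by (intro ptime_fold_Cons ptimes assms)
  moreover have "fold (\<lambda>x a. g c x # a) ys a = rev (map (g c) ys) @ a" for ys a c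
    by (induction ys arbitrary: a) auto
  ultimately show ?thesis by simp
qed

lemma sz_filter_le: "sz (filter P xs) \<le> sz xs"
  by (induction xs) auto

lemma ptime_filter [ptimes]:
  assumes P: "ptime (\<lambda>p. P (fst p) (snd p))" and xs: "ptime xs"
  shows "ptime (\<lambda>c. filter (\<lambda>x. P c x) (xs c))"
proof -
  obtain X where X: "pbound X" "mono X" "\<And>c. sz (xs c) \<le> X (sz c)"
    using ptime_pbound[OF xs] by blast
  have eq: "fold (\<lambda>x a. if P c x then x # a else a) ys a = rev (filter (P c) ys) @ a" for ys a c
    by (induction ys arbitrary: a) auto
  have "ptime (\<lambda>c. fold (\<lambda>x a. if P c x then x # a else a) (xs c) [])"
  proof (rule ptime_fold[OF _ xs ptime_const X(1)])
    show "ptime (\<lambda>p. if P (fst p) (fst (snd p)) then fst (snd p) # snd (snd p) else snd (snd p))"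
      by (intro ptimes ptime_comp[OF P, of "\<lambda>p. (fst p, fst (snd p))", simplified])
    fix c ys zs assume "xs c = ys @ zs"
    then show "sz (fold (\<lambda>x a. if P c x then x # a else a) ys []) \<le> X (sz c)"
      using sz_filter_le[of "P c" ys] sz_prefix_le[of ys zs] X(3)[of c]
      by (simp add: eq)
  qed
  then show ?thesis using ptime_rev by (fastforce simp: eq)
qed

lemma sz_concat_le: "sz (concat xss) \<le> sz xss"
proof (induction xss)
  case (Cons xs xss)
  then show ?case using sz_append[of xs "concat xss"] by simp
qed simp

lemma ptime_concat [ptimes]:
  assumes xs: "ptime xs" shows "ptime (\<lambda>c. concat (xs c))"
proof -
  obtain X where X: "pbound X" "mono X" "\<And>c. sz (xs c) \<le> X (sz c)"
    using ptime_pbound[OF xs] by blast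
  have eq: "fold (\<lambda>x a. a @ x) ys a = a @ concat ys" for ys and a :: "'b list"
    by (induction ys arbitrary: a) auto
  have "ptime (\<lambda>c. fold (\<lambda>x a. a @ x) (xs c) [])"
  proof (rule ptime_fold[OF _ xs ptime_const X(1)])
    show "ptime (\<lambda>p :: 'a \<times> 'b list \<times> 'b list. snd (snd p) @ fst (snd p))" by (intro ptimes)
    fix c ys zs assume "xs c = ys @ zs"
    then show "sz (fold (\<lambda>x a. a @ x) ys []) \<le> X (sz c)"
      using sz_concat_le[of ys] sz_prefix_le[of ys zs] X(3)[of c] by (simp add: eq)
  qed
  then show ?thesis by (simp add: eq)
qed

lemma ptime_Ball [ptimes]:
  assumes P: "ptime (\<lambda>p. P (fst p) (snd p))" and xs: "ptime xs"
  shows "ptime (\<lambda>c. \<forall>x\<in>set (xs c). P c x)"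
proof -
  have eq: "fold (\<lambda>x a. P c x \<and> a) ys a \<longleftrightarrow> (\<forall>x\<in>set ys. P c x) \<and> a" for ys a c
    by (induction ys arbitrary: a) auto
  have "ptime (\<lambda>c. fold (\<lambda>x a. P c x \<and> a) (xs c) True)"
  proof (rule ptime_fold[OF _ xs ptime_const pbound_const])
    show "ptime (\<lambda>p. P (fst p) (fst (snd p)) \<and> snd (snd p))"
      by (intro ptimes ptime_comp[OF P, of "\<lambda>p. (fst p, fst (snd p))", simplified])
  qed (rule sz_bool)
  then show ?thesis by (simp add: eq)
qed

lemma ptime_Bex [ptimes]:
  assumes "ptime (\<lambda>p. P (fst p) (snd p))" "ptime xs"
  shows "ptime (\<lambda>c. \<exists>x\<in>set (xs c). P c x)"
proof -
  have "ptime (\<lambda>c. \<not> (\<forall>x\<in>set (xs c). \<not> P c x))" by (intro ptimes assms)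
  then show ?thesis by simp
qed

lemma ptime_mem [ptimes]:
  assumes "ptime x" "ptime xs" shows "ptime (\<lambda>c. x c \<in> set (xs c))"
proof -
  have "ptime (\<lambda>c. \<exists>y\<in>set (xs c). y = x c)" 
    by (intro ptimes assms ptime_comp[OF assms(1), of fst])
  then show ?thesis by simp
qed

lemma ptime_tl [ptimes]: "ptime xs \<Longrightarrow> ptime (\<lambda>c. tl (xs c))"
proof -
  assume "ptime xs"
  then have "ptime (\<lambda>c. case xs c of [] \<Rightarrow> [] | y # ys \<Rightarrow> ys)"
    by (intro ptime_case_list ptimes)
  then show ?thesis by (simp add: tl_def)
qed

text \<open>For lists that stand for numbers in unary, this is truncated subtraction.\<close>

lemma ptime_drop_length [ptimes]:
  assumes xs: "ptime xs" and ys: "ptime ys"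
  shows "ptime (\<lambda>c. drop (length (ys c)) (xs c))"
proof -
  obtain X where X: "pbound X" "mono X" "\<And>c. sz (xs c) \<le> X (sz c)"
    using ptime_pbound[OF xs] by blast
  have eq: "fold (\<lambda>y a. tl a) ys a = drop (length ys) a" for ys :: "'c list" and a :: "'b list"
    by (induction ys arbitrary: a) (auto simp: drop_Suc)
  have "ptime (\<lambda>c. fold (\<lambda>y a. tl a) (ys c) (xs c))"
  proof (rule ptime_fold[OF _ ys xs X(1)])
    show "ptime (\<lambda>p :: 'a \<times> 'c \<times> 'b list. tl (snd (snd p)))" by (intro ptimes)
    show "sz (fold (\<lambda>y. tl) us (xs c)) \<le> X (sz c)" for c and us :: "'c list"
      using sz_drop_le X(3)[of c] order_trans unfolding eq by blast
  qed
  then show ?thesis by (simp add: eq)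
qed

lemma ptime_zip [ptimes]:
  assumes xs: "ptime xs" and ys: "ptime ys"
  shows "ptime (\<lambda>c. zip (xs c) (ys c))"
proof -
  let ?f = "\<lambda>x p. case fst p of [] \<Rightarrow> p | y # ys \<Rightarrow> (ys, (x, y) # snd p)"
  obtain X where X: "pbound X" "mono X" "\<And>c. sz (xs c) \<le> X (sz c)"
    using ptime_pbound[OF xs] by blast
  obtain Y where Y: "pbound Y" "mono Y" "\<And>c. sz (ys c) \<le> Y (sz c)"
    using ptime_pbound[OF ys] by blast
  have eq: "fold ?f us (vs, a) = (drop (length us) vs, rev (zip us vs) @ a)"
    for us :: "'b list" and vs :: "'c list" and a
  proof (induction us arbitrary: vs a)
    case (Cons u us)
    show ?case by (cases vs) (simp_all add: Cons)
  qed simp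
  have szip: "sz (zip us vs) \<le> sz us + sz vs" for us :: "'b list" and vs :: "'c list"
    by (induction us vs rule: list_induct2') auto
  have "ptime (\<lambda>c. fold (\<lambda>x p. case fst p of [] \<Rightarrow> p | y # ys \<Rightarrow> (ys, (x, y) # snd p)) (xs c) (ys c, []))"
  proof (rule ptime_fold[OF _ xs, where B = "\<lambda>n. Y n + (X n + Y n) + 1"])
    show "ptime (\<lambda>p :: 'a \<times> 'b \<times> 'c list \<times> ('b \<times> 'c) list. case fst (snd (snd p)) of
        [] \<Rightarrow> snd (snd p) | y # ys \<Rightarrow> (ys, (fst (snd p), y) # snd (snd (snd p))))"
      by (intro ptime_case_list ptimes)
    show "ptime (\<lambda>c. (ys c, [] :: ('b \<times> 'c) list))" by (intro ptimes ys)
    show "pbound (\<lambda>n. Y n + (X n + Y n) + 1)" by (intro pbound_intros X Y)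
    fix c us vs assume "xs c = us @ vs"
    then have "sz us \<le> X (sz c)" using sz_prefix_le[of us vs] X(3)[of c] by simp
    moreover have "sz (drop (length us) (ys c)) \<le> Y (sz c)" using sz_drop_le Y(3) order_trans by blast
    ultimately show "sz (fold ?f us (ys c, [])) \<le> Y (sz c) + (X (sz c) + Y (sz c)) + 1"
      using szip[of us "ys c"] Y(3)[of c] by (simp add: eq)
  qed
  then have "ptime (\<lambda>c. rev (zip (xs c) (ys c)))" by (simp add: eq ptime_snd[of "\<lambda>c. (drop (length (xs c)) (ys c), rev (zip (xs c) (ys c)))", simplified])
  from ptime_rev[OF this] show ?thesis by simp
qed


subsection \<open>Binary natural numbers\<close>

primrec bval :: "bool list \<Rightarrow> nat" where
  "bval [] = 0"
| "bval (b # w) = of_bool b + 2 * bval w"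

lemma bval_binary [simp]: "bval (binary n) = n"
proof (induction n rule: less_induct)
  case (less n)
  show ?case
  proof (cases "n = 0")
    case False
    then have "bval (binary n) = of_bool (odd n) + 2 * (n div 2)"
      using less[of "n div 2"] by (simp add: binary_rec)
    then show ?thesis by (cases "odd n") simp_all
  qed (simp add: binary_rec)
qed

lemma bval_append: "bval (u @ v) = bval u + 2 ^ length u * bval v"
  by (induction u) (auto simp: algebra_simps)

lemma bval_less: "bval w < 2 ^ length w"
  by (induction w) auto

lemma binary_eq_Nil [simp]: "binary n = [] \<longleftrightarrow> n = 0"
  by (cases "n = 0") (auto simp: binary_rec)

lemma binary_of_bool_add: "binary (of_bool b + 2 * n) = (if b \<or> n \<noteq> 0 then b # binary n else [])"
  by (cases "n = 0"; cases b) (auto simp: binary_rec)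

text \<open>This is the removal of leading zeros. Scanned from the most significant end, a digit is
  kept if it is 1 or if a digit has been kept before.\<close>

lemma binary_bval: "binary (bval w) = fold (\<lambda>b a. if b \<or> a \<noteq> [] then b # a else []) (rev w) []"
  by (induction w) (auto simp: binary_rec binary_of_bool_add)

lemma length_binary_bval: "length (binary (bval w)) \<le> length w"
  by (induction w) (auto simp: binary_rec binary_of_bool_add)

lemma length_binary_less:
  "n < 2 ^ k \<Longrightarrow> length (binary n) \<le> k"
proof (induction k arbitrary: n)
  case (Suc k)
  show ?case
  proof (cases "n = 0")
    case False
    then show ?thesis using Suc.IH[of "n div 2"] Suc.prems by (simp add: binary_rec)
  qed (simp add: binary_rec)
qed (simp add: binary_rec)

lemma less_length_binary: "n < 2 ^ length (binary n)"
  using bval_less[of "binary n"] by simp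

lemma length_binary_mono: "m \<le> n \<Longrightarrow> length (binary m) \<le> length (binary n)"
  using length_binary_less less_length_binary order_le_less_trans by blast

lemma length_binary_le: "length (binary n) \<le> n"
  by (rule length_binary_less) (rule less_exp)

lemma length_binary_mult: "length (binary (m * n)) \<le> length (binary m) + length (binary n)"
proof (rule length_binary_less)
  have "m * n < 2 ^ length (binary m) * 2 ^ length (binary n)"
    using less_length_binary by (intro mult_strict_mono) auto
  then show "m * n < 2 ^ (length (binary m) + length (binary n))" by (simp add: power_add)
qed

lemma length_binary_add: "length (binary (m + n)) \<le> length (binary m) + length (binary n)"
proof (rule length_binary_less)
  obtain a b where ab: "(2 :: nat) ^ length (binary m) = Suc a" "(2 :: nat) ^ length (binary n) = Suc b"
    by (metis not0_implies_Suc power_not_zero zero_neq_numeral)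
  have "m \<le> a" "n \<le> b" using less_length_binary[of m] less_length_binary[of n] ab by simp_all
  then have "m + n < Suc a * Suc b" by simp
  then show "m + n < 2 ^ (length (binary m) + length (binary n))" by (simp add: power_add ab)
qed

instantiation nat :: code
begin
definition "to_tree n = to_tree (binary n)"
definition "from_tree t = bval (from_tree t)"
instance by standard (simp add: to_tree_nat_def from_tree_nat_def)
end

lemma sz_nat_le: "sz (n :: nat) \<le> 4 * length (binary n) + 1"
  using sz_word[of "binary n"] by (simp add: sz_def to_tree_nat_def)

lemma length_binary_le_sz: "length (binary n) \<le> sz n"
  using length_le_sz[of "binary n"] by (simp add: sz_def to_tree_nat_def)

lemma sz_nat_le_lin: "n \<le> m \<Longrightarrow> sz n \<le> 4 * m + 1"
  using sz_nat_le[of n] length_binary_le[of n] by simp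

lemma ptime_binary [ptimes]: "ptime n \<Longrightarrow> ptime (\<lambda>c. binary (n c))"
  by (rule ptime_comp[of binary], rule ptime_retype[OF ptime_id]) (auto simp: to_tree_nat_def)

lemma ptime_bval [ptimes]: "ptime w \<Longrightarrow> ptime (\<lambda>c. bval (w c))"
proof (rule ptime_comp[of bval])
  have "ptime (\<lambda>w. fold (\<lambda>b a. if b \<or> a \<noteq> [] then b # a else []) (rev w) [])"
  proof (rule ptime_fold[where B = "\<lambda>n. 4 * n + 1"])
    fix w ys zs :: "bool list" assume eq: "rev w = ys @ zs"
    have "length (fold (\<lambda>b a. if b \<or> a \<noteq> [] then b # a else []) ys []) \<le> length w"
      using length_binary_bval[of "rev ys"] arg_cong[OF eq, of length] by (simp add: binary_bval)
    then show "sz (fold (\<lambda>b a. if b \<or> a \<noteq> [] then b # a else []) ys []) \<le> 4 * sz w + 1"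
      using sz_word[of "fold (\<lambda>b a. if b \<or> a \<noteq> [] then b # a else []) ys []"] length_le_sz[of w] by linarith
  qed (intro ptimes pbound_intros)+
  then show "ptime bval"
    by (rule ptime_retype) (auto simp: to_tree_nat_def binary_bval)
qed

text \<open>Each number is padded with as many zeros as the other has digits, which makes the
  lengths equal without comparing them.\<close>

definition bit_pairs :: "nat \<Rightarrow> nat \<Rightarrow> (bool \<times> bool) list" where
  "bit_pairs m n = zip (binary m @ map (\<lambda>_. False) (binary n)) (binary n @ map (\<lambda>_. False) (binary m))"

lemma ptime_bit_pairs [ptimes]: "ptime m \<Longrightarrow> ptime n \<Longrightarrow> ptime (\<lambda>c. bit_pairs (m c) (n c))"
  unfolding bit_pairs_def by (intro ptimes)

lemma bval_replicate_False [simp]: "bval (map (\<lambda>_. False) xs) = 0"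
  by (induction xs) auto

lemma bval_bit_pairs [simp]:
  "bval (map fst (bit_pairs m n)) = m" "bval (map snd (bit_pairs m n)) = n"
  by (simp_all add: bit_pairs_def bval_append)

text \<open>A full adder. The state consists of the carry and the digits so far, the latest first;
  the new carry is a majority, and the double equality is the parity of three bits.\<close>

definition adder :: "bool \<times> bool \<Rightarrow> bool \<times> bool list \<Rightarrow> bool \<times> bool list" where
  "adder p s = (fst p \<and> snd p \<or> fst s \<and> (fst p \<or> snd p), (((fst p = snd p) = fst s) # snd s))"

lemma bval_fold_adder:
  "bval (rev (snd (fold adder ps (c, w))) @ [fst (fold adder ps (c, w))])
   = bval (rev w) + 2 ^ length w * (of_bool c + bval (map fst ps) + bval (map snd ps))"
proof (induction ps arbitrary: c w)
  case (Cons p ps)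
  show ?case unfolding fold.simps comp_def adder_def[of p] Cons
    by (cases "fst p"; cases "snd p"; cases c) (simp_all add: bval_append algebra_simps)
qed (simp add: bval_append)

lemma length_fold_adder: "length (snd (fold adder ps (c, w))) = length ps + length w"
  by (induction ps arbitrary: c w) (auto simp: adder_def)

lemma ptime_add [ptimes]:
  assumes "ptime m" "ptime n" shows "ptime (\<lambda>c. m c + n c :: nat)"
proof (rule back_subst[where P = ptime])
  let ?ps = "\<lambda>c. bit_pairs (m c) (n c)"
  obtain X where X: "pbound X" "mono X" "\<And>c. sz (?ps c) \<le> X (sz c)"
    using ptime_pbound[OF ptime_bit_pairs[OF assms]] by blast
  let ?s = "\<lambda>c. fold adder (?ps c) (False, [])"
  have "ptime ?s"
  proof (rule ptime_fold[where B = "\<lambda>n. 3 + (4 * X n + 1) + 1"])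
    show "ptime (\<lambda>p :: 'a \<times> (bool \<times> bool) \<times> bool \<times> bool list. adder (fst (snd p)) (snd (snd p)))"
      unfolding adder_def by (intro ptimes)
    fix c ys zs assume "?ps c = ys @ zs"
    then have "length (snd (fold adder ys (False, []))) \<le> X (sz c)"
      using length_le_sz[of "?ps c"] X(3)[of c] by (simp add: length_fold_adder)
    then show "sz (fold adder ys (False, [])) \<le> 3 + (4 * X (sz c) + 1) + 1"
      using sz_bool[of "fst (fold adder ys (False, []))"] sz_word[of "snd (fold adder ys (False, []))"]
      by (cases "fold adder ys (False, [])") auto
  qed (intro ptimes pbound_intros X assms)+
  then show "ptime (\<lambda>c. bval (rev (snd (?s c)) @ [fst (?s c)]))" by (intro ptimes)
  show "(\<lambda>c. bval (rev (snd (?s c)) @ [fst (?s c)])) = (\<lambda>c. m c + n c)"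
    unfolding bval_fold_adder by simp
qed

lemma ptime_Suc [ptimes]: "ptime n \<Longrightarrow> ptime (\<lambda>c. Suc (n c))"
  using ptime_add[of n "\<lambda>_. 1", OF _ ptime_const] by simp

lemma ptime_mult [ptimes]:
  assumes m: "ptime m" and n: "ptime n" shows "ptime (\<lambda>c. m c * n c :: nat)"
proof (rule back_subst[where P = ptime])
  \<comment> \<open>Horner's rule, from the most significant bit of the first factor.\<close>
  let ?f = "\<lambda>k b a. a + a + (if b then k else 0 :: nat)"
  have eq: "fold (?f k) (rev w) 0 = bval w * k" for k w
    by (induction w) (auto simp: algebra_simps)
  obtain M where M: "pbound M" "mono M" "\<And>c. sz (m c) \<le> M (sz c)" using ptime_pbound[OF m] by blast
  obtain N where N: "pbound N" "mono N" "\<And>c. sz (n c) \<le> N (sz c)" using ptime_pbound[OF n] by blast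
  show "ptime (\<lambda>c. fold (?f (n c)) (rev (binary (m c))) 0)"
  proof (rule ptime_fold[where B = "\<lambda>k. 4 * (M k + N k) + 1"])
    show "ptime (\<lambda>p. snd (snd p) + snd (snd p) + (if fst (snd p) then n (fst p) else 0))"
      by (intro ptimes ptime_comp[OF n, of fst])
    fix c ys zs assume "rev (binary (m c)) = ys @ zs"
    then have b: "binary (m c) = rev zs @ rev ys" by (metis rev_append rev_rev_ident)
    \<comment> \<open>The bits read so far are the leading digits of the first factor, so no
      intermediate value exceeds the final product.\<close>
    have "bval (rev ys) \<le> m c"
      using bval_binary[of "m c"] unfolding b bval_append by (metis le_add2 le_trans mult_le_mono1 nat_mult_1 one_le_numeral one_le_power)
    then have "length (binary (bval (rev ys) * n c)) \<le> length (binary (m c * n c))"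
      by (intro length_binary_mono mult_le_mono1)
    also have "\<dots> \<le> M (sz c) + N (sz c)"
      using length_binary_mult[of "m c" "n c"] length_binary_le_sz[of "m c"] length_binary_le_sz[of "n c"]
        M(3)[of c] N(3)[of c] by linarith
    finally show "sz (fold (?f (n c)) ys 0) \<le> 4 * (M (sz c) + N (sz c)) + 1"
      using sz_nat_le[of "bval (rev ys) * n c"] eq[of "n c" "rev ys"] by simp
  qed (intro ptimes pbound_intros M N m)+
  show "(\<lambda>c. fold (?f (n c)) (rev (binary (m c))) 0) = (\<lambda>c. m c * n c)"
    unfolding eq by simp
qed

lemma ptime_le [ptimes]:
  assumes "ptime m" "ptime n" shows "ptime (\<lambda>c. m c \<le> (n c :: nat))"
proof (rule back_subst[where P = ptime])
  \<comment> \<open>The least significant bits come first, so a later difference overrides the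
    verdict reached so far, and that verdict is all that has to be remembered.\<close>
  let ?f = "\<lambda>p r. if fst p = snd p then r else snd p"
  have eq: "fold ?f ps r \<longleftrightarrow> bval (map fst ps) < bval (map snd ps) \<or> bval (map fst ps) = bval (map snd ps) \<and> r" for ps r
  proof (induction ps arbitrary: r)
    case (Cons p ps)
    have "Suc (2 * x) \<noteq> 2 * y" "2 * y \<noteq> Suc (2 * x)" "Suc (2 * x) < 2 * y \<longleftrightarrow> x < y"
      "2 * x < Suc (2 * y) \<longleftrightarrow> x < y \<or> x = y" for x y :: nat by presburger+
    then show ?case by (cases "fst p"; cases "snd p") (simp_all add: Cons)
  qed simp
  show "ptime (\<lambda>c. fold ?f (bit_pairs (m c) (n c)) True)"
    by (rule ptime_fold[where B = "\<lambda>_. 3"]) (intro ptimes assms pbound_intros sz_bool)+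
  show "(\<lambda>c. fold ?f (bit_pairs (m c) (n c)) True) = (\<lambda>c. m c \<le> n c)"
    unfolding eq by auto
qed

lemma ptime_less [ptimes]: "ptime m \<Longrightarrow> ptime n \<Longrightarrow> ptime (\<lambda>c. m c < (n c :: nat))"
  unfolding not_le[symmetric] by (intro ptimes)

lemma ptime_max [ptimes]: "ptime m \<Longrightarrow> ptime n \<Longrightarrow> ptime (\<lambda>c. max (m c) (n c :: nat))"
  unfolding max_def by (intro ptimes)

lemma ptime_length [ptimes]:
  assumes xs: "ptime xs" shows "ptime (\<lambda>c. length (xs c))"
proof -
  obtain X where X: "pbound X" "mono X" "\<And>c. sz (xs c) \<le> X (sz c)"
    using ptime_pbound[OF xs] by blast
  have eq: "fold (\<lambda>_ n. Suc n) ys k = length ys + k" for ys :: "'b list" and k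
    by (induction ys arbitrary: k) auto
  have "ptime (\<lambda>c. fold (\<lambda>_ n. Suc n) (xs c) 0)"
  proof (rule ptime_fold[OF _ xs, where B = "\<lambda>n. 4 * X n + 1"])
    fix c ys zs assume "xs c = ys @ zs"
    then show "sz (fold (\<lambda>_ n. Suc n) ys 0) \<le> 4 * X (sz c) + 1"
      unfolding eq using length_le_sz[of "xs c"] X(3)[of c] by (intro sz_nat_le_lin) simp
  qed (intro ptimes pbound_intros X)+
  then show ?thesis by (simp add: eq)
qed

lemma ptime_sum_list [ptimes]:
  assumes xs: "ptime xs" shows "ptime (\<lambda>c. sum_list (xs c :: nat list))"
proof -
  obtain X where X: "pbound X" "mono X" "\<And>c. sz (xs c) \<le> X (sz c)"
    using ptime_pbound[OF xs] by blast
  have eq: "fold (\<lambda>x n. x + n) ys k = sum_list ys + k" for ys :: "nat list" and k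
    by (induction ys arbitrary: k) auto
  have le: "length (binary (sum_list ys)) \<le> sz ys" for ys
  proof (induction ys)
    case (Cons y ys)
    then show ?case using length_binary_add[of y "sum_list ys"] length_binary_le_sz[of y] by simp
  qed (simp add: binary_rec)
  have "ptime (\<lambda>c. fold (\<lambda>x n. x + n) (xs c) 0)"
  proof (rule ptime_fold[OF _ xs, where B = "\<lambda>n. 4 * X n + 1"])
    fix c ys zs assume "xs c = ys @ zs"
    then have "sz ys \<le> X (sz c)" using sz_prefix_le[of ys zs] X(3)[of c] by simp
    then show "sz (fold (\<lambda>x n. x + n) ys 0) \<le> 4 * X (sz c) + 1"
      unfolding eq using le[of ys] sz_nat_le[of "sum_list ys"] by simp
  qed (intro ptimes pbound_intros X)+
  then show ?thesis by (simp add: eq)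
qed

text \<open>The end point is the length of a list because an interval up to a number is
  exponentially long in the number's binary code.\<close>

lemma ptime_upt_length [ptimes]:
  assumes xs: "ptime xs" shows "ptime (\<lambda>c. [0..<length (xs c)])"
proof -
  obtain X where X: "pbound X" "mono X" "\<And>c. sz (xs c) \<le> X (sz c)"
    using ptime_pbound[OF xs] by blast
  have eq: "fold (\<lambda>_ a. a @ [length a]) ys [0..<k] = [0..<length ys + k]" for ys :: "'b list" and k
  proof (induction ys arbitrary: k)
    case (Cons y ys)
    then show ?case using Cons[of "Suc k"] by simp
  qed simp
  note eq = eq[of _ 0, simplified]
  have "ptime (\<lambda>c. fold (\<lambda>_ a. a @ [length a]) (xs c) [])"
  proof (rule ptime_fold[OF _ xs, where B = "\<lambda>n. X n * (4 * X n + 2) + 1"])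
    fix c ys zs assume "xs c = ys @ zs"
    then have l: "length ys \<le> X (sz c)" using length_le_sz[of "xs c"] X(3)[of c] by simp
    have "sz [0..<length ys] \<le> length [0..<length ys] * ((4 * X (sz c) + 1) + 1) + 1"
      by (rule sz_le_length) (use l sz_nat_le_lin in auto)
    also have "\<dots> \<le> X (sz c) * (4 * X (sz c) + 2) + 1"
      using l by (simp del: mult_Suc_right mult_Suc)
    finally show "sz (fold (\<lambda>_ a. a @ [length a]) ys []) \<le> X (sz c) * (4 * X (sz c) + 2) + 1"
      by (simp only: eq)
  qed (intro ptimes pbound_intros X)+
  then show ?thesis by (simp add: eq)
qed

text \<open>Loops run over lists, so the running time of a verifier and the length of its witness
  are needed in unary. The polynomial \<open>a + x * p\<close> becomes \<open>a\<close> elements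
  followed by one copy of the list for \<open>p\<close> per element.\<close>

lemma ptime_list_of_poly_length:
  "\<exists>u :: 'a :: code list \<Rightarrow> bool list. ptime u \<and> (\<forall>xs. length (u xs) = poly p (length xs))"
proof (induction p)
  case 0
  then show ?case by (intro exI[of _ "\<lambda>_. []"]) (simp add: ptime_const)
next
  case (pCons a p)
  then obtain u :: "'a list \<Rightarrow> bool list" where u: "ptime u" "\<And>xs. length (u xs) = poly p (length xs)" by blast
  have "ptime (\<lambda>xs. replicate a False @ concat (map (\<lambda>_. u xs) xs))"
    by (intro ptimes ptime_comp[OF u(1), of fst])
  then show ?case
    by (intro exI[of _ "\<lambda>xs. replicate a False @ concat (map (\<lambda>_. u xs) xs)"])
      (simp add: u length_concat comp_def sum_list_triv)
qed


subsection \<open>Decoding\<close>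

lemma ptime_from_tree_bool [ptimes]: "ptime t \<Longrightarrow> ptime (\<lambda>c. from_tree (t c) :: bool)"
  unfolding from_tree_bool_def by (intro ptimes)

lemma ptime_from_tree_prod:
  "ptime (from_tree :: tree \<Rightarrow> 'a :: code) \<Longrightarrow> ptime (from_tree :: tree \<Rightarrow> 'b :: code) \<Longrightarrow>
    ptime (from_tree :: tree \<Rightarrow> 'a \<times> 'b)"
  unfolding from_tree_prod_def
  by (intro ptimes ptime_comp[of from_tree car] ptime_comp[of from_tree cdr])

text \<open>Reading a tree as a list of trees along its right spine does not change the tree, so
  only decoding the elements remains.\<close>

lemma ptime_from_tree_list:
  assumes "ptime (from_tree :: tree \<Rightarrow> 'a :: code)"
  shows "ptime (from_tree :: tree \<Rightarrow> 'a list)"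
proof -
  have 1: "to_tree (from_tree t :: tree list) = t" for t
    by (induction t) (simp_all add: to_tree_tree_def from_tree_tree_def)
  have 2: "(from_tree t :: 'a list) = map from_tree (from_tree t :: tree list)" for t
    by (induction t) (simp_all add: from_tree_tree_def)
  have "ptime (from_tree :: tree \<Rightarrow> tree list)"
    by (rule ptime_retype[OF ptime_id]) (rule exI[of _ "to_tree (from_tree x :: tree list)" for x], simp add: 1 to_tree_tree_def)
  then have "ptime (\<lambda>t. map (\<lambda>t. from_tree t :: 'a) (from_tree t :: tree list))"
    by (intro ptimes ptime_comp[OF assms])
  also have "(\<lambda>t. map (\<lambda>t. from_tree t :: 'a) (from_tree t :: tree list)) = from_tree"
    using 2 by (simp add: fun_eq_iff)
  finally show ?thesis .
qed

lemma ptime_from_tree_nat: "ptime (from_tree :: tree \<Rightarrow> nat)"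
  unfolding from_tree_nat_def
  by (intro ptimes ptime_from_tree_list)

definition parse_bit :: "bool \<Rightarrow> tree list \<Rightarrow> tree list" where
  "parse_bit b st = (if b then case st of [] \<Rightarrow> [] | t # ts \<Rightarrow> (case ts of [] \<Rightarrow> [t] | u # us \<Rightarrow> Node t u # us)
     else Leaf # st)"

text \<open>Reading a prefix code backwards needs only a stack of finished subtrees.\<close>

definition parse :: "bool list \<Rightarrow> tree" where
  "parse w = (case fold parse_bit (rev w) [] of [] \<Rightarrow> Leaf | t # ts \<Rightarrow> t)"

lemma fold_parse_bits: "fold parse_bit (rev (bits t)) st = t # st"
  by (induction t arbitrary: st) (auto simp: parse_bit_def)

lemma parse_bits [simp]: "parse (bits t) = t"
  by (simp add: parse_def fold_parse_bits)

lemma ptime_parse: "ptime parse"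
proof -
  have step: "sz (parse_bit b st) \<le> sz st + 2" for b st
    by (auto simp: parse_bit_def sz_def to_tree_tree_def split: list.splits)
  have le: "sz (fold parse_bit ys st) \<le> sz st + 2 * length ys" for ys st
  proof (induction ys arbitrary: st)
    case (Cons y ys)
    have "sz (fold parse_bit ys (parse_bit y st)) \<le> sz (parse_bit y st) + 2 * length ys" by (rule Cons)
    then show ?case using step[of y st] by simp
  qed simp
  have "ptime (\<lambda>w. fold parse_bit (rev w) [])"
  proof (rule ptime_fold[where B = "\<lambda>n. 2 * n + 1"])
    show "ptime (\<lambda>p :: bool list \<times> bool \<times> tree list. parse_bit (fst (snd p)) (snd (snd p)))"
      unfolding parse_bit_def by (intro ptimes ptime_case_list)
    fix w ys zs :: "bool list" assume "rev w = ys @ zs"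
    then have "length ys \<le> length w" by (metis length_append length_rev le_add1)
    then show "sz (fold parse_bit ys []) \<le> 2 * sz w + 1"
      using le[of ys "[]"] length_le_sz[of w] by simp
  qed (intro ptimes pbound_intros)+
  then show ?thesis unfolding parse_def by (intro ptimes ptime_case_list)
qed

section \<open>Quotients and perturbations\<close>

lemma sum_quotient:
  assumes "finite S" "equiv S R"
  shows "(\<Sum>D\<in>S // R. \<Sum>t\<in>D. f t) = (\<Sum>t\<in>S. f t :: real)"
proof -
  have "(\<Sum>t\<in>\<Union>(S // R). f t) = (\<Sum>D\<in>S // R. \<Sum>t\<in>D. f t)"
  proof (rule sum.Union_disjoint[unfolded comp_def])
    show "\<forall>A\<in>S // R. finite A" using assms finite_equiv_class equiv_type by blast
    show "\<forall>A\<in>S // R. \<forall>B\<in>S // R. A \<noteq> B \<longrightarrow> A \<inter> B = {}"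
      using quotient_disj[OF assms(2)] by blast
  qed
  then show ?thesis by (simp add: Union_quotient[OF assms(2)])
qed

text \<open>Apart from its number of states the quotient is unconstrained. Numbering the classes by
  a bijection gives an isomorphic chain on natural numbers.\<close>

lemma has_eps_quotient_of_size_iff:
  assumes M: "is_lmc M"
  shows "has_eps_quotient_of_size M \<epsilon> k \<longleftrightarrow>
    (\<exists>\<tau>. (\<forall>s\<in>states M. is_distr (states M) (\<tau> s) \<and> (\<Sum>t\<in>states M. \<bar>\<tau> s t - prob M s t\<bar>) \<le> \<epsilon>) \<and>
         card (states M // bisimilarity (M\<lparr>prob := \<tau>\<rparr>)) = k)"
    (is "?lhs \<longleftrightarrow> ?rhs")
proof
  assume ?lhs
  then obtain Q :: "(nat, 'b) lmc" and \<tau> where Q: "card (states Q) = k"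
    and \<tau>: "\<forall>s\<in>states M. is_distr (states M) (\<tau> s) \<and> (\<Sum>t\<in>states M. \<bar>\<tau> s t - prob M s t\<bar>) \<le> \<epsilon>"
    and iso: "lmc_isomorphic Q (quotient_lmc (M\<lparr>prob := \<tau>\<rparr>) (bisimilarity (M\<lparr>prob := \<tau>\<rparr>)))"
    unfolding has_eps_quotient_of_size_def is_eps_quotient_def Let_def by blast
  have "\<exists>f. bij_betw f (states Q) (states (quotient_lmc (M\<lparr>prob := \<tau>\<rparr>) (bisimilarity (M\<lparr>prob := \<tau>\<rparr>))))"
    using iso unfolding lmc_isomorphic_def by (elim conjE exE) (rule exI)
  then obtain f where "bij_betw f (states Q) (states M // bisimilarity (M\<lparr>prob := \<tau>\<rparr>))"
    by (auto simp: quotient_lmc_def)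
  then have "card (states M // bisimilarity (M\<lparr>prob := \<tau>\<rparr>)) = k"
    using bij_betw_same_card Q by metis
  with \<tau> show ?rhs by (intro exI[of _ \<tau>] conjI)
next
  assume ?rhs
  then obtain \<tau> where \<tau>: "\<And>s. s \<in> states M \<Longrightarrow> is_distr (states M) (\<tau> s)"
      "\<And>s. s \<in> states M \<Longrightarrow> (\<Sum>t\<in>states M. \<bar>\<tau> s t - prob M s t\<bar>) \<le> \<epsilon>"
    and k: "card (states M // bisimilarity (M\<lparr>prob := \<tau>\<rparr>)) = k" by blast
  let ?N = "M\<lparr>prob := \<tau>\<rparr>" and ?S = "states M"
  let ?B = "bisimilarity ?N"
  let ?q = "quotient_lmc ?N ?B"
  have fin: "finite ?S" "?S \<noteq> {}" using M by (auto simp: is_lmc_def)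
  have eq: "equiv ?S ?B"
    using bisimilarity_largest(1)[of ?N] fin by (simp add: prob_bisimulation_def)
  have finq: "finite (?S // ?B)" using fin eq by (metis equiv_type finite_quotient)
  obtain g where g: "bij_betw g {0..<k} (?S // ?B)"
    using ex_bij_betw_nat_finite[OF finq] k by auto
  let ?Q = "\<lparr>states = {0..<k}, labels = labels M, prob = \<lambda>i j. prob ?q (g i) (g j), label = \<lambda>i. label ?q (g i)\<rparr>"
  have "k \<noteq> 0" using k finq fin by (auto simp: quotient_def)
  have rep: "(SOME s. s \<in> C) \<in> ?S" "C \<subseteq> ?S" if "C \<in> ?S // ?B" for C
  proof -
    show "C \<subseteq> ?S" using that eq by (metis Union_quotient Union_upper)
    then show "(SOME s. s \<in> C) \<in> ?S"
      using in_quotient_imp_non_empty[OF eq that] by (metis ex_in_conv someI_ex subsetD)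
  qed
  have "is_distr {0..<k} (\<lambda>j. prob ?q (g i) (g j))" if "i < k" for i
  proof -
    let ?s = "SOME s. s \<in> g i"
    have gi: "g i \<in> ?S // ?B" using g that by (auto simp: bij_betw_def)
    note d = \<tau>(1)[OF rep(1)[OF gi], unfolded is_distr_def]
    have "0 \<le> (\<Sum>t\<in>g j. \<tau> ?s t)" if "j < k" for j
    proof -
      have "g j \<in> ?S // ?B" using g that by (auto simp: bij_betw_def)
      from rep(2)[OF this] d show ?thesis by (meson subsetD sum_nonneg)
    qed
    moreover have "(\<Sum>j\<in>{0..<k}. \<Sum>t\<in>g j. \<tau> ?s t) = (\<Sum>D\<in>?S // ?B. \<Sum>t\<in>D. \<tau> ?s t)"
      using sum.reindex_bij_betw[OF g] by simp
    ultimately show ?thesis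
      using d sum_quotient[OF fin(1) eq] by (auto simp: is_distr_def quotient_lmc_def)
  qed
  moreover have "label ?q (g i) \<in> labels M" if "i < k" for i
  proof -
    have "g i \<in> ?S // ?B" using g that by (auto simp: bij_betw_def)
    from rep(1)[OF this] show ?thesis using M by (simp add: is_lmc_def quotient_lmc_def)
  qed
  ultimately have "is_lmc ?Q" using \<open>k \<noteq> 0\<close> M by (auto simp: is_lmc_def)
  moreover have "lmc_isomorphic ?Q ?q"
    unfolding lmc_isomorphic_def using g by (auto simp: quotient_lmc_def)
  ultimately have "is_eps_quotient \<epsilon> ?Q M"
    unfolding is_eps_quotient_def Let_def using \<tau> by blast
  then show ?lhs unfolding has_eps_quotient_of_size_def by (intro exI[of _ ?Q]) simp
qed

text \<open>Both distributions have mass 1, so the discrepancy on \<open>E\<close> reappears with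
  opposite sign on the complement and is counted twice by the l1 distance.\<close>

lemma distr_diff_le:
  assumes "finite S" "is_distr S \<mu>" "is_distr S \<nu>" "E \<subseteq> S"
  shows "\<bar>(\<Sum>t\<in>E. \<mu> t) - (\<Sum>t\<in>E. \<nu> t)\<bar> \<le> (\<Sum>t\<in>S. \<bar>\<mu> t - \<nu> t\<bar>) / 2"
proof -
  have split: "(\<Sum>t\<in>S. f t) = (\<Sum>t\<in>E. f t) + (\<Sum>t\<in>S - E. f t)" for f :: "'a \<Rightarrow> real"
    using assms(1,4) by (simp add: sum.subset_diff)
  have "(\<Sum>t\<in>E. \<mu> t) - (\<Sum>t\<in>E. \<nu> t) = - ((\<Sum>t\<in>S - E. \<mu> t) - (\<Sum>t\<in>S - E. \<nu> t))"
    using assms(2,3) split[of \<mu>] split[of \<nu>] by (simp add: is_distr_def)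
  moreover have "\<bar>(\<Sum>t\<in>A. \<mu> t) - (\<Sum>t\<in>A. \<nu> t)\<bar> \<le> (\<Sum>t\<in>A. \<bar>\<mu> t - \<nu> t\<bar>)" for A
    unfolding sum_subtractf[symmetric] by (rule sum_abs)
  from this[of E] this[of "S - E"] calculation
  have "\<bar>(\<Sum>t\<in>E. \<mu> t) - (\<Sum>t\<in>E. \<nu> t)\<bar> \<le> (\<Sum>t\<in>S - E. \<bar>\<mu> t - \<nu> t\<bar>)"
      "\<bar>(\<Sum>t\<in>E. \<mu> t) - (\<Sum>t\<in>E. \<nu> t)\<bar> \<le> (\<Sum>t\<in>E. \<bar>\<mu> t - \<nu> t\<bar>)"
    by (simp_all only: abs_minus_cancel)
  then show ?thesis using split[of "\<lambda>t. \<bar>\<mu> t - \<nu> t\<bar>"] by linarith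
qed

lemma kernel_quotient:
  assumes "R = {(s, t). s \<in> S \<and> t \<in> S \<and> c s = c t}"
  shows "equiv S R" "S // R = (\<lambda>j. {t \<in> S. c t = j}) ` c ` S" "card (S // R) = card (c ` S)"
proof -
  show "equiv S R" unfolding assms by (auto simp: equiv_def refl_on_def sym_def trans_def)
  show eq: "S // R = (\<lambda>j. {t \<in> S. c t = j}) ` c ` S"
  proof -
    have "R `` {s} = {t \<in> S. c t = c s}" if "s \<in> S" for s
      using that unfolding assms by auto
    then show ?thesis unfolding quotient_def by auto
  qed
  have "inj_on (\<lambda>j. {t \<in> S. c t = j}) (c ` S)" by (rule inj_onI) blast
  then show "card (S // R) = card (c ` S)" unfolding eq by (rule card_image)
qed

section \<open>The gadget with five classes\<close>

text \<open>States \<open>0\<close> and \<open>1\<close> are absorbing. States \<open>2\<close> and \<open>3\<close> carry the same label but are too far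
  apart to be merged, and every state in \<open>{4..<4 + L}\<close> lies exactly halfway between them, hence can
  be merged with either; the set \<open>X\<close> of those merged with \<open>2\<close> is the guess. The remaining states can
  be merged with each other iff their probabilities of entering the class of \<open>2\<close> fit into a window of
  width \<open>\<epsilon>\<close>.\<close>

locale gadget =
  fixes M :: "(nat, nat) lmc" and L R :: nat and \<epsilon> :: real
  assumes lmc: "is_lmc M" and states: "states M = {..<4 + L + R}" and R: "0 < R"
    and eps: "0 < \<epsilon>" "\<epsilon> \<le> 1/2"
    and label: "label M 0 = 0" "label M 1 = 1" "\<And>s. 2 \<le> s \<Longrightarrow> s < 4 + L \<Longrightarrow> label M s = 2"
      "\<And>s. 4 + L \<le> s \<Longrightarrow> s < 4 + L + R \<Longrightarrow> label M s = 3"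
    and prob_2: "prob M 2 0 = 1/2 + \<epsilon>" "prob M 2 1 = 1/2 - \<epsilon>"
    and prob_3: "prob M 3 0 = 1/2 - \<epsilon>" "prob M 3 1 = 1/2 + \<epsilon>"
    and prob_mid: "\<And>s. 4 \<le> s \<Longrightarrow> s < 4 + L \<Longrightarrow> prob M s 0 = 1/2"
      "\<And>s. 4 \<le> s \<Longrightarrow> s < 4 + L \<Longrightarrow> prob M s 1 = 1/2"
    and prob_small: "\<And>s t. 2 \<le> s \<Longrightarrow> s < 4 + L \<Longrightarrow> 2 \<le> t \<Longrightarrow> t < 4 + L + R \<Longrightarrow> prob M s t = 0"
    and prob_row: "\<And>s t. 4 + L \<le> s \<Longrightarrow> s < 4 + L + R \<Longrightarrow> t < 2 \<or> 4 + L \<le> t \<and> t < 4 + L + R \<Longrightarrow> prob M s t = 0"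
      "\<And>s. 4 + L \<le> s \<Longrightarrow> s < 4 + L + R \<Longrightarrow> \<epsilon> / 2 \<le> prob M s 2 \<and> \<epsilon> / 2 \<le> prob M s 3"
begin

definition weight :: "nat set \<Rightarrow> nat \<Rightarrow> real" where
  "weight X s = prob M s 2 + (\<Sum>t\<in>X. prob M s t)"

lemma distr: "s < 4 + L + R \<Longrightarrow> is_distr {..<4 + L + R} (prob M s)"
  using lmc states by (simp add: is_lmc_def)

lemma solution_of_quotient:
  assumes "has_eps_quotient_of_size M \<epsilon> 5"
  shows "\<exists>X v. X \<subseteq> {4..<4 + L} \<and> (\<forall>s\<in>{4 + L..<4 + L + R}. \<bar>v - weight X s\<bar> \<le> \<epsilon> / 2)"
proof -
  let ?S = "{..<4 + L + R}"
  from assms[unfolded has_eps_quotient_of_size_iff[OF lmc] states]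
  obtain \<tau> where \<tau>: "\<And>s. s \<in> ?S \<Longrightarrow> is_distr ?S (\<tau> s)"
      "\<And>s. s \<in> ?S \<Longrightarrow> (\<Sum>t\<in>?S. \<bar>\<tau> s t - prob M s t\<bar>) \<le> \<epsilon>"
    and card: "card (?S // bisimilarity (M\<lparr>prob := \<tau>\<rparr>)) = 5" by blast
  let ?N = "M\<lparr>prob := \<tau>\<rparr>"
  define B where "B = bisimilarity ?N"
  have bis: "prob_bisimulation ?N B"
    unfolding B_def by (rule bisimilarity_largest) (simp add: states)
  then have eq: "equiv ?S B" and lab: "\<And>s t. (s, t) \<in> B \<Longrightarrow> label M s = label M t"
    and mass: "\<And>s t E. (s, t) \<in> B \<Longrightarrow> E \<in> ?S // B \<Longrightarrow> (\<Sum>u\<in>E. \<tau> s u) = (\<Sum>u\<in>E. \<tau> t u)"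
    by (auto simp: prob_bisimulation_def states)
  have B_S: "s \<in> ?S \<and> t \<in> ?S" if "(s, t) \<in> B" for s t
    using that equiv_type[OF eq] by blast
  have tv: "\<bar>(\<Sum>t\<in>E. \<tau> s t) - (\<Sum>t\<in>E. prob M s t)\<bar> \<le> \<epsilon> / 2" if "s \<in> ?S" "E \<subseteq> ?S" for s E
    using distr_diff_le[OF _ \<tau>(1) distr, of s s E] \<tau>(2)[of s] that by auto
  have lab_cases: "label M s = (if s = 0 then 0 else if s = 1 then 1 else if s < 4 + L then 2 else 3)"
    if "s \<in> ?S" for s using label that by auto
  have cls0: "B `` {0} = {0}"
  proof -
    have "(0, 0) \<in> B" using eq by (simp add: equiv_def refl_on_def)
    moreover have "t = 0" if "(0, t) \<in> B" for t
      using lab[OF that] lab_cases[of t] B_S[OF that] label(1) by (auto split: if_splits)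
    ultimately show ?thesis by auto
  qed
  \<comment> \<open>State 0 alone has its label, so \<open>{0}\<close> is a class. The probabilities
    of moving there from 2 and 3 differ by 2\<epsilon>, and each can change by at most
    \<epsilon>/2.\<close>
  have ne: "(2, 3) \<notin> B"
  proof
    assume "(2, 3) \<in> B"
    moreover have "{0} \<in> ?S // B" using quotientI[of 0 ?S B] cls0 by simp
    ultimately have "\<tau> 2 0 = \<tau> 3 0" using mass[of 2 3 "{0}"] by simp
    moreover have "\<bar>\<tau> 2 0 - (1/2 + \<epsilon>)\<bar> \<le> \<epsilon> / 2" "\<bar>\<tau> 3 0 - (1/2 - \<epsilon>)\<bar> \<le> \<epsilon> / 2"
      using tv[of 2 "{0}"] tv[of 3 "{0}"] prob_2 prob_3 by simp_all
    ultimately show False using eps by linarith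
  qed
  let ?r = "4 + L"
  let ?cs = "{B `` {0}, B `` {1}, B `` {2}, B `` {3}, B `` {?r}}"
  have iff: "B `` {s} = B `` {t} \<longleftrightarrow> (s, t) \<in> B" if "s \<in> ?S" "t \<in> ?S" for s t
    using eq_equiv_class_iff[OF eq that] .
  have nlab: "(s, t) \<notin> B" if "label M s \<noteq> label M t" for s t using lab that by blast
  \<comment> \<open>Five pairwise inequivalent states exhaust the five classes, so every other state
    is equivalent to one of them.\<close>
  have "?cs \<subseteq> ?S // B" using R by (auto intro!: quotientI)
  moreover have "card ?cs = 5"
    using R ne by (simp add: iff nlab label label(2)[unfolded One_nat_def] card_insert_if)
  moreover have "finite (?S // B)" using eq by (metis equiv_type finite_lessThan finite_quotient)
  ultimately have cs: "?S // B = ?cs" using card unfolding B_def[symmetric] by (metis card_subset_eq)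
  have in_cs: "(0, s) \<in> B \<or> (1, s) \<in> B \<or> (2, s) \<in> B \<or> (3, s) \<in> B \<or> (?r, s) \<in> B" if "s \<in> ?S" for s
  proof -
    have "B `` {s} \<in> ?cs" using quotientI[OF that, of B] cs by simp
    then show ?thesis
      using R that iff[of 0 s] iff[of 1 s] iff[of 2 s] iff[of 3 s] iff[of ?r s] by auto
  qed
  define X where "X = {s. 4 \<le> s \<and> s < 4 + L \<and> (2, s) \<in> B}"
  have two: "(2, 2) \<in> B" using eq by (simp add: equiv_def refl_on_def)
  have A: "B `` {2} = insert 2 X"
  proof -
    have "s = 2 \<or> 4 \<le> s \<and> s < 4 + L" if "(2, s) \<in> B" for s
      using lab[OF that] lab_cases[of s] B_S[OF that] label(3)[of 2] ne that
      by (cases "s = 3") (auto split: if_splits)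
    then show ?thesis using two by (auto simp: X_def)
  qed
  \<comment> \<open>All rows are equivalent to \<open>?r\<close>, so after the perturbation they
    have the same mass on the class of 2. This common value is the required \<open>v\<close>, and it
    is at most \<epsilon>/2 away from each original mass.\<close>
  have "\<bar>(\<Sum>u\<in>insert 2 X. \<tau> ?r u) - weight X s\<bar> \<le> \<epsilon> / 2" if "s \<in> {4 + L..<4 + L + R}" for s
  proof -
    have s: "s \<in> ?S" using that by auto
    have "label M s = 3" using label(4) that by auto
    then have "(?r, s) \<in> B" using in_cs[OF s] nlab[of _ s] label by fastforce
    then have "(\<Sum>u\<in>insert 2 X. \<tau> ?r u) = (\<Sum>u\<in>insert 2 X. \<tau> s u)"
      using mass[of ?r s "insert 2 X"] A quotientI[of 2 ?S B] by auto
    moreover have "insert 2 X \<subseteq> ?S" by (auto simp: X_def)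
    moreover have "weight X s = (\<Sum>u\<in>insert 2 X. prob M s u)"
      by (simp add: weight_def X_def)
    ultimately show ?thesis using tv[OF s, of "insert 2 X"] by simp
  qed
  moreover have "X \<subseteq> {4..<4 + L}" by (auto simp: X_def)
  ultimately show ?thesis by blast
qed

lemma quotient_of_solution:
  assumes X: "X \<subseteq> {4..<4 + L}" and v: "\<And>s. s \<in> {4 + L..<4 + L + R} \<Longrightarrow> \<bar>v - weight X s\<bar> \<le> \<epsilon> / 2"
  shows "has_eps_quotient_of_size M \<epsilon> 5"
proof -
  let ?S = "{..<4 + L + R}"
  define coin where "coin a t = (if t = 0 then 1/2 + a else if t = 1 then 1/2 - a else 0 :: real)" for a and t :: nat
  define d where "d s = v - weight X s" for s
  \<comment> \<open>State 2 and the literals in \<open>X\<close> meet at probability 1/2 +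
    \<epsilon>/2 for state 0, state 3 and the other literals at 1/2 - \<epsilon>/2. Each row shifts
    the mass \<open>d s\<close> from 3 to 2, which makes its mass on the class of 2 equal to
    \<open>v\<close>.\<close>
  define \<tau> where "\<tau> s = (if s < 2 then prob M s
      else if s < 4 + L then coin (if s \<in> insert 2 X then \<epsilon> / 2 else - (\<epsilon> / 2))
      else (prob M s)(2 := prob M s 2 + d s, 3 := prob M s 3 - d s))" for s
  define cl :: "nat \<Rightarrow> nat" where
    "cl s = (if s < 2 then s else if s < 4 + L then (if s \<in> insert 2 X then 2 else 3) else 4)" for s
  have sum_coin: "(\<Sum>t\<in>?S. f (coin a t) t) = f (1/2 + a) 0 + f (1/2 - a) 1"
    if "\<And>t. 2 \<le> t \<Longrightarrow> t \<in> ?S \<Longrightarrow> f 0 t = 0" for a and f :: "real \<Rightarrow> nat \<Rightarrow> real"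
  proof -
    have "(\<Sum>t\<in>?S. f (coin a t) t) = (\<Sum>t\<in>{0, 1}. f (coin a t) t)"
      by (rule sum.mono_neutral_right) (use that in \<open>auto simp: coin_def\<close>)
    then show ?thesis by (simp add: coin_def)
  qed
  have distr_coin: "is_distr ?S (coin a)" if "\<bar>a\<bar> \<le> 1/2" for a
    using that sum_coin[of "\<lambda>x _. x" a] by (auto simp: is_distr_def coin_def)
  have sum_row: "(\<Sum>t\<in>E. \<tau> s t) = (\<Sum>t\<in>E. prob M s t) + (if 2 \<in> E then d s else 0) - (if 3 \<in> E then d s else 0)"
    if "4 + L \<le> s" "finite E" for s E
  proof -
    have "\<tau> s t = prob M s t + (if t = 2 then d s else 0) - (if t = 3 then d s else 0)" for t
      using that by (simp add: \<tau>_def)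
    then show ?thesis using that(2) by (simp add: sum.distrib sum_subtractf)
  qed
  have row: "is_distr ?S (\<tau> s)" "(\<Sum>t\<in>?S. \<bar>\<tau> s t - prob M s t\<bar>) \<le> \<epsilon>"
    if "4 + L \<le> s" "s < 4 + L + R" for s
  proof -
    have d: "\<bar>d s\<bar> \<le> \<epsilon> / 2" using v[of s] that by (simp add: d_def)
    have "0 \<le> prob M s 2 + d s" "0 \<le> prob M s 3 - d s"
      using d prob_row(2)[OF that] by (auto simp: abs_le_iff)
    then show "is_distr ?S (\<tau> s)"
      using distr[OF that(2)] sum_row[OF that(1), of ?S] that by (auto simp: is_distr_def \<tau>_def)
    have "(\<Sum>t\<in>?S. \<bar>\<tau> s t - prob M s t\<bar>) = (\<Sum>t\<in>{2, 3}. \<bar>\<tau> s t - prob M s t\<bar>)"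
      by (rule sum.mono_neutral_right) (use that in \<open>auto simp: \<tau>_def\<close>)
    also have "\<dots> \<le> \<epsilon>" using d that by (simp add: \<tau>_def)
    finally show "(\<Sum>t\<in>?S. \<bar>\<tau> s t - prob M s t\<bar>) \<le> \<epsilon>" .
  qed
  have small: "is_distr ?S (\<tau> s)" "(\<Sum>t\<in>?S. \<bar>\<tau> s t - prob M s t\<bar>) \<le> \<epsilon>"
    if "2 \<le> s" "s < 4 + L" for s
  proof -
    let ?a = "if s \<in> insert 2 X then \<epsilon> / 2 else - (\<epsilon> / 2)"
    have \<tau>: "\<tau> s = coin ?a" using that by (simp add: \<tau>_def)
    show "is_distr ?S (\<tau> s)" unfolding \<tau> by (rule distr_coin) (use eps in auto)
    have "(\<Sum>t\<in>?S. \<bar>coin ?a t - prob M s t\<bar>) = \<bar>1/2 + ?a - prob M s 0\<bar> + \<bar>1/2 - ?a - prob M s 1\<bar>"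
      by (rule sum_coin) (use prob_small that in auto)
    moreover have "s = 2 \<or> s = 3 \<or> 4 \<le> s" using that by auto
    moreover have "2 \<notin> X" "3 \<notin> X" using X by auto
    ultimately show "(\<Sum>t\<in>?S. \<bar>\<tau> s t - prob M s t\<bar>) \<le> \<epsilon>"
      unfolding \<tau> using prob_2 prob_3 prob_mid[of s] that eps by auto
  qed
  have \<tau>: "is_distr ?S (\<tau> s) \<and> (\<Sum>t\<in>?S. \<bar>\<tau> s t - prob M s t\<bar>) \<le> \<epsilon>" if "s \<in> ?S" for s
  proof -
    consider "s < 2" | "2 \<le> s" "s < 4 + L" | "4 + L \<le> s" "s < 4 + L + R"
      using \<open>s \<in> ?S\<close> by (meson lessThan_iff not_less)
    then show ?thesis
    proof cases
      case 1
      then have "\<tau> s = prob M s" by (simp add: \<tau>_def)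
      then show ?thesis using distr[of s] that eps by simp
    qed (use small row in blast)+
  qed
  let ?N = "M\<lparr>prob := \<tau>\<rparr>"
  define B where "B = bisimilarity ?N"
  have bis: "prob_bisimulation ?N B" and largest: "\<And>Q. prob_bisimulation ?N Q \<Longrightarrow> Q \<subseteq> B"
    unfolding B_def by (rule bisimilarity_largest; simp add: states)+
  define K where "K = {(s, t). s \<in> ?S \<and> t \<in> ?S \<and> cl s = cl t}"
  note K = kernel_quotient[OF K_def]
  have lab_cases: "label M s = (if s = 0 then 0 else if s = 1 then 1 else if s < 4 + L then 2 else 3)"
    if "s \<in> ?S" for s using label that by auto
  have X_le: "x < 4 + L" "4 \<le> x" if "x \<in> X" for x using X that by auto
  have "prob_bisimulation ?N K"
    unfolding prob_bisimulation_def
  proof (safe)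
    show "equiv (states ?N) K" using K(1) by (simp add: states)
    fix s t assume "(s, t) \<in> K"
    then have st: "s \<in> ?S" "t \<in> ?S" "cl s = cl t" by (auto simp: K_def)
    show "label ?N s = label ?N t"
      using st(3) lab_cases[OF st(1)] lab_cases[OF st(2)] by (auto simp: cl_def split: if_splits)
    fix E assume "E \<in> states ?N // K"
    then obtain j where E: "E = {u \<in> ?S. cl u = j}" using K(2) by (auto simp: states)
    show "(\<Sum>u\<in>E. prob ?N s u) = (\<Sum>u\<in>E. prob ?N t u)"
    proof (cases "4 + L \<le> s")
      case False
      then have "s = t \<or> 2 \<le> s \<and> s < 4 + L \<and> 2 \<le> t \<and> t < 4 + L \<and> (s \<in> insert 2 X \<longleftrightarrow> t \<in> insert 2 X)"
        using st(3) by (auto simp: cl_def split: if_splits)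
      then have "\<tau> s = \<tau> t" by (auto simp: \<tau>_def)
      then show ?thesis by simp
    next
      case True
      then have "4 + L \<le> t" using st(3) by (auto simp: cl_def split: if_splits)
      have "(\<Sum>u\<in>E. \<tau> r u) = (if j = 2 then v else if j = 3 then 1 - v else 0)" if r: "4 + L \<le> r" "r \<in> ?S" for r
      proof -
        let ?A = "insert 2 X"
        have zero: "\<tau> r u = 0" if "u < 2 \<or> 4 + L \<le> u \<and> u \<in> ?S" for u
          using prob_row(1)[of r u] r that by (auto simp: \<tau>_def)
        have A: "(\<Sum>u\<in>?A. \<tau> r u) = v"
        proof -
          have "2 \<notin> X" "3 \<notin> X" "finite X" using X finite_subset[OF X] by auto
          then show ?thesis using sum_row[OF r(1), of ?A] by (simp add: d_def weight_def)
        qed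
        consider "j = 2" | "j = 3" | "j \<noteq> 2" "j \<noteq> 3" by blast
        then show ?thesis
        proof cases
          case 1
          then have "E = ?A" using X_le by (fastforce simp: E cl_def split: if_splits)
          then show ?thesis using A 1 by simp
        next
          case 2
          \<comment> \<open>The mass on the class of 3 is what the total mass 1 leaves, since a row
            has no mass outside the classes of 2 and 3.\<close>
          have E': "E = {u. 2 \<le> u \<and> u < 4 + L \<and> u \<notin> ?A}" using 2 by (auto simp: E cl_def split: if_splits)
          have "(\<Sum>u\<in>?S - E. \<tau> r u) = (\<Sum>u\<in>?A. \<tau> r u)"
          proof (intro sum.mono_neutral_right ballI)
            show "?A \<subseteq> ?S - E" using X_le(1) E' by (auto intro: trans_less_add1)
            fix u assume "u \<in> (?S - E) - ?A"
            then show "\<tau> r u = 0" by (intro zero) (auto simp: E' not_le)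
          qed simp
          moreover have "(\<Sum>u\<in>?S. \<tau> r u) = (\<Sum>u\<in>?S - E. \<tau> r u) + (\<Sum>u\<in>E. \<tau> r u)"
            by (rule sum.subset_diff) (auto simp: E)
          ultimately show ?thesis using \<tau>[OF r(2)] A 2 by (simp add: is_distr_def)
        next
          case 3
          then have "\<tau> r u = 0" if "u \<in> E" for u
            using that by (intro zero) (auto simp: E cl_def split: if_splits)
          then show ?thesis using 3 by simp
        qed
      qed
      from this[OF True st(1)] this[OF \<open>4 + L \<le> t\<close> st(2)] show ?thesis by simp
    qed
  qed
  then have "K \<subseteq> B" by (rule largest)
  moreover have "B \<subseteq> K"
  proof clarify
    fix s t assume st: "(s, t) \<in> B"
    have eq: "equiv ?S B" and lab: "\<And>s t. (s, t) \<in> B \<Longrightarrow> label M s = label M t"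
      and mass: "\<And>s t E. (s, t) \<in> B \<Longrightarrow> E \<in> ?S // B \<Longrightarrow> (\<Sum>u\<in>E. \<tau> s u) = (\<Sum>u\<in>E. \<tau> t u)"
      using bis by (auto simp: prob_bisimulation_def states)
    have B_S: "s \<in> ?S \<and> t \<in> ?S" if "(s, t) \<in> B" for s t
      using that equiv_type[OF eq] by blast
    have "B `` {0} = {0}"
    proof -
      have "(0, 0) \<in> B" using eq by (simp add: equiv_def refl_on_def)
      moreover have "t = 0" if "(0, t) \<in> B" for t
        using lab[OF that] lab_cases[of t] B_S[OF that] label(1) by (auto split: if_splits)
      ultimately show ?thesis by auto
    qed
    \<comment> \<open>Labels separate all classes except those of 2 and 3, and these differ in the
      probability of moving to state 0, as \<epsilon> is positive.\<close>
    then have "\<tau> s 0 = \<tau> t 0" using mass[OF st, of "{0}"] quotientI[of 0 ?S B] by simp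
    then have "cl s = cl t"
      using lab[OF st] lab_cases[of s] lab_cases[of t] B_S[OF st] eps
      by (auto simp: cl_def \<tau>_def coin_def split: if_splits)
    then show "(s, t) \<in> K" using B_S[OF st] by (simp add: K_def)
  qed
  ultimately have "B = K" by blast
  moreover have "cl ` ?S = {0, 1, 2, 3, 4}"
  proof
    have "{0, 1, 2, 3, 4} = cl ` {0, 1, 2, 3, 4 + L}" using X_le(2)[of 3] by (auto simp: cl_def)
    also have "\<dots> \<subseteq> cl ` ?S" using R by (intro image_mono) auto
    finally show "{0, 1, 2, 3, 4} \<subseteq> cl ` ?S" .
  qed (auto simp: cl_def)
  ultimately have "card (?S // B) = 5" using K(3) by simp
  then show ?thesis
    unfolding has_eps_quotient_of_size_iff[OF lmc] states using \<tau> B_def by blast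
qed

end

section \<open>Satisfiability reduces to quotients of size five\<close>

type_synonym 'v literal = "bool \<times> 'v"

definition sat :: "'v literal list list \<Rightarrow> bool" where
  "sat cs \<longleftrightarrow> (\<exists>\<alpha>. \<forall>c\<in>set cs. \<exists>l\<in>set c. \<alpha> (snd l) = fst l)"

text \<open>\<open>List.insert\<close> removes duplicates, so each literal is represented by exactly
  one state and the weights count true literals correctly.\<close>

definition vars :: "'v literal list list \<Rightarrow> 'v list" where
  "vars cs = fold List.insert (map snd (concat cs)) []"

lemma set_vars: "set (vars cs) = snd ` set (concat cs)"
proof -
  have "set (fold List.insert xs a) = set xs \<union> set a" for xs a :: "'a list"
    by (induction xs arbitrary: a) auto
  then show ?thesis by (auto simp: vars_def)
qed

lemma distinct_vars: "distinct (vars cs)"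
proof -
  have "distinct a \<Longrightarrow> distinct (fold List.insert xs a)" for xs a :: "'a list"
    by (induction xs arbitrary: a) auto
  then show ?thesis by (simp add: vars_def)
qed

lemma ptime_vars: "ptime (vars :: 'v :: code literal list list \<Rightarrow> 'v list)"
proof -
  have le: "sz (fold List.insert ys a) \<le> sz ys + sz a" for ys a :: "'v list"
  proof (induction ys arbitrary: a)
    case (Cons y ys)
    have "sz (List.insert y a) \<le> sz y + sz a + 1" by (auto simp: List.insert_def)
    then show ?case using Cons[of "List.insert y a"] by simp
  qed simp
  have xs: "ptime (\<lambda>cs :: 'v literal list list. map snd (concat cs))" by (intro ptimes)
  then obtain B where B: "pbound B" "\<And>cs :: 'v literal list list. sz (map snd (concat cs)) \<le> B (sz cs)"
    using ptime_pbound by blast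
  show ?thesis
    unfolding vars_def
  proof (rule ptime_fold[OF _ xs ptime_const, where B = "\<lambda>n. B n + 1"])
    show "pbound (\<lambda>n. B n + 1)" by (intro pbound_intros B)
    show "sz (fold List.insert ys []) \<le> B (sz cs) + 1" if "map snd (concat cs) = ys @ zs"
      for cs :: "'v literal list list" and ys zs
      using le[of ys "[]"] sz_prefix_le[of ys zs] B(2)[of cs] that by simp
  qed (unfold List.insert_def, intro ptimes)
qed

definition lits :: "'v literal list list \<Rightarrow> 'v literal list" where
  "lits cs = map (Pair True) (vars cs) @ map (Pair False) (vars cs)"

lemma distinct_lits: "distinct (lits cs)"
  using distinct_vars[of cs] by (auto simp: lits_def distinct_map inj_on_def)

lemma set_lits: "l \<in> set (lits cs) \<longleftrightarrow> snd l \<in> set (vars cs)"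
  by (cases l) (auto simp: lits_def)

text \<open>A row \<open>(b, r, A)\<close> stands for a state that moves to state \<open>2\<close> with weight \<open>b\<close>, to each literal
  in \<open>A\<close> with weight \<open>1\<close> and to state \<open>3\<close> with the remaining weight, where \<open>4 * K\<close> is the total
  weight and \<open>r\<close> is the list of length \<open>4 * K - b\<close>. The first two rows confine the window to
  \<open>{K + 1..2 * K}\<close>.\<close>

definition sat_row :: "nat \<Rightarrow> nat \<Rightarrow> 'v literal list \<Rightarrow> nat \<times> bool list \<times> 'v literal list" where
  "sat_row K b A = (b, replicate (4 * K - b) True, A)"

definition sat_rows :: "nat \<Rightarrow> 'v literal list list \<Rightarrow> (nat \<times> bool list \<times> 'v literal list) list" where
  "sat_rows K cs = sat_row K (K + 1) [] # sat_row K (2 * K) [] # map (sat_row K K) cs @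
     map (\<lambda>v. sat_row K K [(True, v), (False, v)]) (vars cs) @
     map (\<lambda>v. sat_row K (2 * K - 1) [(True, v), (False, v)]) (vars cs)"

text \<open>The weight left for state 3 is a difference. It is computed as the length of a shortened
  unary list, which \<open>ptime_drop_length\<close> covers.\<close>

definition row_weights :: "'v literal list \<Rightarrow> nat list \<Rightarrow> nat \<times> bool list \<times> 'v literal list \<Rightarrow> nat list" where
  "row_weights ls z r = [0, 0, fst r, length (drop (length (filter (\<lambda>l. l \<in> set (snd (snd r))) ls)) (fst (snd r)))] @
     map (\<lambda>l. if l \<in> set (snd (snd r)) then 1 else 0) ls @ z"

text \<open>Relative to the total 4K, the weights 3K - 1 and K + 1 are 1/2 + \<epsilon> and 1/2 -
  \<epsilon> for \<epsilon> = (K - 1)/(4K), as the gadget requires for states 2 and 3.\<close>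

definition sat_matrix :: "nat \<Rightarrow> 'v literal list \<Rightarrow> (nat \<times> bool list \<times> 'v literal list) list \<Rightarrow> nat list list" where
  "sat_matrix K ls rs =
     ([4 * K, 0, 0, 0] @ map (\<lambda>_. 0) ls @ map (\<lambda>_. 0) rs) #
     ([0, 4 * K, 0, 0] @ map (\<lambda>_. 0) ls @ map (\<lambda>_. 0) rs) #
     ([3 * K - 1, K + 1, 0, 0] @ map (\<lambda>_. 0) ls @ map (\<lambda>_. 0) rs) #
     ([K + 1, 3 * K - 1, 0, 0] @ map (\<lambda>_. 0) ls @ map (\<lambda>_. 0) rs) #
     map (\<lambda>_. [2 * K, 2 * K, 0, 0] @ map (\<lambda>_. 0) ls @ map (\<lambda>_. 0) rs) ls @
     map (row_weights ls (map (\<lambda>_. 0) rs)) rs"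

definition sat_code :: "nat \<Rightarrow> 'v literal list list \<Rightarrow> lmc_code" where
  "sat_code K cs =
     \<lparr>label_names = [0, 1, 2, 3],
      state_labels = [0, 1, 2, 2] @ map (\<lambda>_. 2) (lits cs) @ map (\<lambda>_. 3) (sat_rows K cs),
      prob_rows = map (map (\<lambda>a. (a, 4 * K))) (sat_matrix K (lits cs) (sat_rows K cs))\<rparr>"

section \<open>The chain of a list of clauses is an instance of the gadget\<close>

locale short_clauses =
  fixes K :: nat and cs :: "'v literal list list"
  assumes K: "2 \<le> K" and short: "\<And>c. c \<in> set cs \<Longrightarrow> length c \<le> K"
begin

abbreviation (input) "ls \<equiv> lits cs"
abbreviation (input) "rs \<equiv> sat_rows K cs"
abbreviation (input) "nn \<equiv> 4 + length ls + length rs"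
abbreviation (input) "wmat \<equiv> sat_matrix K ls rs"
abbreviation (input) "M \<equiv> lmc_of_code (sat_code K cs)"

lemma rows_cases:
  assumes "r \<in> set rs"
  obtains b A where "r = sat_row K b A" "b \<le> 2 * K" "K \<le> b" "length A \<le> K" "set A \<subseteq> set ls"
proof -
  have 1: "set c \<subseteq> set ls" if "c \<in> set cs" for c
    using that by (intro subsetI) (simp only: set_lits set_vars, rule imageI, auto)
  have 2: "set [(True, v), (False, v)] \<subseteq> set ls" if "v \<in> set (vars cs)" for v
    using that by (auto simp: set_lits)
  consider "r = sat_row K (K + 1) []" | "r = sat_row K (2 * K) []"
    | c where "c \<in> set cs" "r = sat_row K K c"
    | v where "v \<in> set (vars cs)" "r = sat_row K K [(True, v), (False, v)]"
    | v where "v \<in> set (vars cs)" "r = sat_row K (2 * K - 1) [(True, v), (False, v)]"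
    using assms by (auto simp: sat_rows_def)
  then show thesis
  proof cases
    case (3 c)
    then show thesis using that[OF 3(2)] short[OF 3(1)] 1[OF 3(1)] K by simp
  next
    case (4 v)
    then show thesis using that[OF 4(2)] 2[OF 4(1)] K by simp
  next
    case (5 v)
    then show thesis using that[OF 5(2)] 2[OF 5(1)] K by simp
  qed (use that K in simp_all)
qed

text \<open>Together with the bounds in \<open>rows_cases\<close> this keeps the subtraction in a
  row from truncating, so that every row has total weight 4K.\<close>

lemma count_le: "length (filter (\<lambda>l. l \<in> set A) ls) \<le> length A"
proof -
  have "length (filter (\<lambda>l. l \<in> set A) ls) = card (set (filter (\<lambda>l. l \<in> set A) ls))"
    by (metis distinct_card distinct_filter distinct_lits)
  also have "\<dots> \<le> card (set A)" by (rule card_mono) auto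
  also have "\<dots> \<le> length A" by (rule card_length)
  finally show ?thesis .
qed

lemma row_weights_sat_row:
  "row_weights ls z (sat_row K b A) = [0, 0, b, 4 * K - b - length (filter (\<lambda>l. l \<in> set A) ls)] @
     map (\<lambda>l. if l \<in> set A then 1 else 0) ls @ z"
  by (simp add: row_weights_def sat_row_def)

lemma mat_row:
  assumes "w \<in> set wmat"
  shows "length w = nn" "sum_list w = 4 * K"
proof -
  have zero: "sum_list (map (\<lambda>_. 0 :: nat) xs) = 0" for xs :: "'b list" by (induction xs) auto
  have "length w = nn \<and> sum_list w = 4 * K" if w: "w \<in> set (map (row_weights ls (map (\<lambda>_. 0) rs)) rs)"
  proof -
    obtain r where r: "r \<in> set rs" "w = row_weights ls (map (\<lambda>_. 0) rs) r" using w by auto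
    from rows_cases[OF r(1)] obtain b A where A: "r = sat_row K b A" "b \<le> 2 * K" "length A \<le> K" by metis
    have "sum_list (map (\<lambda>l. if l \<in> set A then 1 else 0) xs) = length (filter (\<lambda>l. l \<in> set A) xs)" for xs
      by (induction xs) auto
    then show ?thesis using r(2) A count_le[of A] by (simp add: row_weights_sat_row zero)
  qed
  then show "length w = nn" "sum_list w = 4 * K"
    using assms K by (auto simp: sat_matrix_def zero)
qed

lemma length_mat: "length wmat = nn"
  by (simp add: sat_matrix_def)

lemma length_labels: "length (state_labels (sat_code K cs)) = nn"
  by (simp add: sat_code_def)

lemma prob_M: "s < nn \<Longrightarrow> t < nn \<Longrightarrow> prob M s t = real (wmat ! s ! t) / real (4 * K)"
  using mat_row(1)[of "wmat ! s"] length_mat by (simp add: lmc_of_code_def sat_code_def)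

lemma states_M: "states M = {..<nn}"
  by (simp add: lmc_of_code_def length_labels)

lemma is_lmc_M: "is_lmc M"
proof -
  have "is_distr {..<nn} (prob M s)" if s: "s < nn" for s
  proof -
    have w: "wmat ! s \<in> set wmat" using s length_mat by simp
    have "(\<Sum>t<nn. prob M s t) = (\<Sum>t<nn. real (wmat ! s ! t)) / real (4 * K)"
      using s by (simp add: prob_M sum_divide_distrib)
    also have "(\<Sum>t<nn. real (wmat ! s ! t)) = real (sum_list (wmat ! s))"
      by (simp add: sum_list_sum_nth mat_row(1)[OF w] atLeast0LessThan)
    finally show ?thesis using mat_row(2)[OF w] K s by (simp add: is_distr_def prob_M)
  qed
  moreover have "label M s \<in> {0, 1, 2, 3}" if "s < nn" for s
    using nth_mem[of s "state_labels (sat_code K cs)"] that length_labels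
    by (auto simp: lmc_of_code_def sat_code_def)
  ultimately show ?thesis
    unfolding is_lmc_def states_M by (simp add: lmc_of_code_def sat_code_def lessThan_empty_iff)
qed

lemma valid_sat_code: "valid_lmc_code (sat_code K cs)"
proof -
  have "length w = nn \<and> (\<forall>(a, b)\<in>set w. 0 < b)" if "w \<in> set (prob_rows (sat_code K cs))" for w
    using that K mat_row(1) by (auto simp: sat_code_def)
  moreover have "length (prob_rows (sat_code K cs)) = nn" by (simp add: sat_code_def length_mat)
  ultimately show ?thesis
    unfolding valid_lmc_code_def Let_def length_labels using is_lmc_M by blast
qed

lemma mat_upper:
  "wmat ! 0 = [4 * K, 0, 0, 0] @ map (\<lambda>_. 0) ls @ map (\<lambda>_. 0) rs"
  "wmat ! 1 = [0, 4 * K, 0, 0] @ map (\<lambda>_. 0) ls @ map (\<lambda>_. 0) rs"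
  "wmat ! 2 = [3 * K - 1, K + 1, 0, 0] @ map (\<lambda>_. 0) ls @ map (\<lambda>_. 0) rs"
  "wmat ! 3 = [K + 1, 3 * K - 1, 0, 0] @ map (\<lambda>_. 0) ls @ map (\<lambda>_. 0) rs"
  "i < length ls \<Longrightarrow> wmat ! (4 + i) = [2 * K, 2 * K, 0, 0] @ map (\<lambda>_. 0) ls @ map (\<lambda>_. 0) rs"
  by (simp_all add: sat_matrix_def nth_append)

lemma mat_lower:
  "i < length rs \<Longrightarrow> wmat ! (4 + length ls + i) = row_weights ls (map (\<lambda>_. 0) rs) (rs ! i)"
  by (simp add: sat_matrix_def nth_append)

lemma nth_zeros: "2 \<le> t \<Longrightarrow> t < nn \<Longrightarrow> ([a, b, 0, 0] @ map (\<lambda>_. 0) ls @ map (\<lambda>_. 0) rs) ! t = (0 :: nat)"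
proof -
  assume "2 \<le> t" "t < nn"
  then have "t = 2 \<or> t = 3 \<or> (\<exists>i. t = 4 + i \<and> i < length ls + length rs)"
    by presburger
  then show ?thesis by (auto simp: nth_append)
qed

lemma nth_row_weights:
  assumes "i < length ls"
  shows "row_weights ls z (sat_row K b A) ! (4 + i) = (if ls ! i \<in> set A then 1 else 0)"
  using assms by (simp add: row_weights_sat_row nth_append)

lemma rs_nonempty: "0 < length rs"
  by (simp add: sat_rows_def)

sublocale G: gadget M "length ls" "length rs" "real (K - 1) / real (4 * K)"
proof
  show "is_lmc M" by (rule is_lmc_M)
  show "states M = {..<4 + length ls + length rs}" by (rule states_M)
  show "0 < length rs" by (rule rs_nonempty)
  show "0 < real (K - 1) / real (4 * K)" "real (K - 1) / real (4 * K) \<le> 1 / 2"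
    using K by (auto simp: field_simps)
  show "label M 0 = 0" "label M 1 = 1" by (simp_all add: lmc_of_code_def sat_code_def)
  show "label M s = 2" if "2 \<le> s" "s < 4 + length ls" for s
  proof -
    from that have "s = 2 \<or> s = 3 \<or> (\<exists>i. s = 4 + i \<and> i < length ls)" by presburger
    then show ?thesis by (auto simp: lmc_of_code_def sat_code_def nth_append)
  qed
  show "label M s = 3" if "4 + length ls \<le> s" "s < nn" for s
  proof -
    from that obtain i where "s = 4 + (length ls + i)" "i < length rs"
      by (metis add.assoc le_Suc_ex nat_add_left_cancel_less)
    then show ?thesis by (simp add: lmc_of_code_def sat_code_def nth_append)
  qed
  have n2: "2 < nn" "3 < nn" "0 < nn" "1 < nn" by simp_all
  have K1: "real (3 * K - 1) / real (4 * K) = 1/2 + real (K - 1) / real (4 * K)"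
    "real (K + 1) / real (4 * K) = 1/2 - real (K - 1) / real (4 * K)"
    using K by (simp_all add: field_simps of_nat_diff)
  show "prob M 2 0 = 1/2 + real (K - 1) / real (4 * K)" "prob M 2 1 = 1/2 - real (K - 1) / real (4 * K)"
    "prob M 3 0 = 1/2 - real (K - 1) / real (4 * K)" "prob M 3 1 = 1/2 + real (K - 1) / real (4 * K)"
    unfolding K1[symmetric] using prob_M[of 2 0] prob_M[of 2 1] prob_M[of 3 0] prob_M[of 3 1]
    by (simp_all add: mat_upper)
  show "prob M s 0 = 1/2" "prob M s 1 = 1/2" if "4 \<le> s" "s < 4 + length ls" for s
  proof -
    from that obtain i where "s = 4 + i" "i < length ls" by (metis le_Suc_ex nat_add_left_cancel_less)
    then show "prob M s 0 = 1/2" "prob M s 1 = 1/2"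
      using prob_M[of s 0] prob_M[of s 1] K mat_upper(5)[of i] by simp_all
  qed
  show "prob M s t = 0" if "2 \<le> s" "s < 4 + length ls" "2 \<le> t" "t < nn" for s t
  proof -
    from that have "s = 2 \<or> s = 3 \<or> (\<exists>i. s = 4 + i \<and> i < length ls)" by presburger
    then have "wmat ! s ! t = 0"
      using nth_zeros[OF that(3,4)] mat_upper(3,4) mat_upper(5) by auto
    then show ?thesis using prob_M[of s t] that by simp
  qed
  show "prob M s t = 0" if "4 + length ls \<le> s" "s < nn"
    "t < 2 \<or> 4 + length ls \<le> t \<and> t < nn" for s t
  proof -
    from that(1,2) obtain i where i: "s = 4 + length ls + i" "i < length rs"
      by (metis le_Suc_ex nat_add_left_cancel_less)
    obtain b A where A: "rs ! i = sat_row K b A" using rows_cases[OF nth_mem[OF i(2)]] by metis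
    from that(3) have "t = 0 \<or> t = 1 \<or> (\<exists>j. t = 4 + (length ls + j) \<and> j < length rs)"
      by (metis One_nat_def add.assoc le_Suc_ex less_2_cases nat_add_left_cancel_less)
    then have "wmat ! s ! t = 0"
      using mat_lower[OF i(2)] A i(1) by (auto simp: row_weights_sat_row nth_append)
    then show ?thesis using prob_M[of s t] that by auto
  qed
  show "real (K - 1) / real (4 * K) / 2 \<le> prob M s 2 \<and> real (K - 1) / real (4 * K) / 2 \<le> prob M s 3"
    if "4 + length ls \<le> s" "s < nn" for s
  proof -
    from that obtain i where i: "s = 4 + length ls + i" "i < length rs"
      by (metis le_Suc_ex nat_add_left_cancel_less)
    obtain b A where A: "rs ! i = sat_row K b A" "b \<le> 2 * K" "K \<le> b" "length A \<le> K"
      using rows_cases[OF nth_mem[OF i(2)]] by metis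
    have "wmat ! s ! 2 = b" "wmat ! s ! 3 = 4 * K - b - length (filter (\<lambda>l. l \<in> set A) ls)"
      using mat_lower[OF i(2)] A i(1) by (auto simp: row_weights_sat_row nth_append)
    then have "K - 1 \<le> 2 * (wmat ! s ! 2)" "K - 1 \<le> 2 * (wmat ! s ! 3)"
      using A(2-4) count_le[of A] by auto
    then have "real (K - 1) \<le> 2 * real (wmat ! s ! 2)" "real (K - 1) \<le> 2 * real (wmat ! s ! 3)"
      by linarith+
    then show ?thesis using prob_M[of s 2] prob_M[of s 3] that K
      by (simp add: field_simps)
  qed
qed

definition chosen :: "nat set \<Rightarrow> 'v literal set" where
  "chosen X = {ls ! i | i. i < length ls \<and> 4 + i \<in> X}"

lemma weight_row:
  assumes X: "X \<subseteq> {4..<4 + length ls}" and i: "i < length rs" and r: "rs ! i = sat_row K b A"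
  shows "G.weight X (4 + length ls + i) = real (b + card (set A \<inter> chosen X)) / real (4 * K)"
proof -
  let ?s = "4 + length ls + i"
  have fin: "finite X" using X finite_subset by blast
  have X_le: "4 \<le> t" "t - 4 < length ls" if "t \<in> X" for t
  proof -
    have "4 \<le> t" "t < 4 + length ls" using X that by auto
    then show "4 \<le> t" "t - 4 < length ls" by linarith+
  qed
  have "prob M ?s t = real (if ls ! (t - 4) \<in> set A then 1 else 0) / real (4 * K)" if t: "t \<in> X" for t
  proof -
    obtain j where j: "t = 4 + j" "j < length ls"
      using X t by (metis atLeastLessThan_iff le_Suc_ex nat_add_left_cancel_less subsetD)
    then have "wmat ! ?s ! t = (if ls ! j \<in> set A then 1 else 0)"
      unfolding mat_lower[OF i] r j(1) by (intro nth_row_weights)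
    then show ?thesis using prob_M[of ?s t] i j by simp
  qed
  then have "(\<Sum>t\<in>X. prob M ?s t) = (\<Sum>t\<in>X. real (if ls ! (t - 4) \<in> set A then 1 else 0)) / real (4 * K)"
    by (simp add: sum_divide_distrib)
  also have "(\<Sum>t\<in>X. real (if ls ! (t - 4) \<in> set A then 1 else 0)) = real (card {t \<in> X. ls ! (t - 4) \<in> set A})"
  proof -
    have "(\<Sum>t\<in>X. real (if ls ! (t - 4) \<in> set A then 1 else 0)) = (\<Sum>t\<in>{t \<in> X. ls ! (t - 4) \<in> set A}. 1)"
      by (subst sum.inter_filter[OF fin]) (rule sum.cong, auto)
    then show ?thesis by simp
  qed
  also have "card {t \<in> X. ls ! (t - 4) \<in> set A} = card (set A \<inter> chosen X)"
  proof (rule bij_betw_same_card[of "\<lambda>t. ls ! (t - 4)"], rule bij_betw_imageI)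
    show "inj_on (\<lambda>t. ls ! (t - 4)) {t \<in> X. ls ! (t - 4) \<in> set A}"
    proof (rule inj_onI)
      fix x y assume "x \<in> {t \<in> X. ls ! (t - 4) \<in> set A}" "y \<in> {t \<in> X. ls ! (t - 4) \<in> set A}"
        and eq: "ls ! (x - 4) = ls ! (y - 4)"
      then have "4 \<le> x" "x - 4 < length ls" "4 \<le> y" "y - 4 < length ls" using X_le by auto
      then show "x = y" using nth_eq_iff_index_eq[OF distinct_lits, of "x - 4" cs "y - 4"] eq by simp
    qed
    show "(\<lambda>t. ls ! (t - 4)) ` {t \<in> X. ls ! (t - 4) \<in> set A} = set A \<inter> chosen X"
    proof
      show "(\<lambda>t. ls ! (t - 4)) ` {t \<in> X. ls ! (t - 4) \<in> set A} \<subseteq> set A \<inter> chosen X"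
      proof (rule image_subsetI)
        fix t assume "t \<in> {t \<in> X. ls ! (t - 4) \<in> set A}"
        moreover from this X_le have "4 \<le> t" "t - 4 < length ls" by auto
        ultimately show "ls ! (t - 4) \<in> set A \<inter> chosen X"
          unfolding chosen_def by (intro IntI CollectI exI[of _ "t - 4"]) auto
      qed
      show "set A \<inter> chosen X \<subseteq> (\<lambda>t. ls ! (t - 4)) ` {t \<in> X. ls ! (t - 4) \<in> set A}"
      proof
        fix l assume "l \<in> set A \<inter> chosen X"
        then obtain i where "l = ls ! i" "4 + i \<in> X" "l \<in> set A" by (auto simp: chosen_def)
        then show "l \<in> (\<lambda>t. ls ! (t - 4)) ` {t \<in> X. ls ! (t - 4) \<in> set A}"
          by (intro image_eqI[of _ _ "4 + i"]) auto
      qed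
    qed
  qed
  finally have "(\<Sum>t\<in>X. prob M ?s t) = real (card (set A \<inter> chosen X)) / real (4 * K)" .
  moreover have "prob M ?s 2 = real b / real (4 * K)"
    using prob_M[of ?s 2] i mat_lower[OF i] r by (simp add: row_weights_sat_row)
  ultimately show ?thesis unfolding G.weight_def by (simp add: add_divide_distrib)
qed

lemma quotient_iff_chosen:
  "has_eps_quotient_of_size M (real (K - 1) / real (4 * K)) 5 \<longleftrightarrow>
    (\<exists>T \<subseteq> set ls. \<forall>b A. sat_row K b A \<in> set rs \<longrightarrow> K + 1 \<le> b + card (set A \<inter> T) \<and> b + card (set A \<inter> T) \<le> 2 * K)"
    (is "?lhs \<longleftrightarrow> ?rhs")
proof
  assume ?lhs
  from G.solution_of_quotient[OF this] obtain X v where X: "X \<subseteq> {4..<4 + length ls}"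
    and v: "\<And>s. s \<in> {4 + length ls..<nn} \<Longrightarrow> \<bar>v - G.weight X s\<bar> \<le> real (K - 1) / real (4 * K) / 2" by blast
  have scale: "\<bar>x - y / d\<bar> * d = \<bar>x * d - y\<bar>" if "0 < d" for x y d :: real
  proof -
    have "x * d - y = (x - y / d) * d" using that by (simp add: field_simps)
    then show ?thesis using that by (simp add: abs_mult)
  qed
  have win: "\<bar>v * real (4 * K) - real (b + card (set A \<inter> chosen X))\<bar> \<le> real K / 2 - 1 / 2"
    if A: "sat_row K b A \<in> set rs" for b A
  proof -
    obtain i where i: "i < length rs" "rs ! i = sat_row K b A" using A by (metis in_set_conv_nth)
    have K0: "real (4 * K) > 0" using K by simp
    have "\<bar>v - real (b + card (set A \<inter> chosen X)) / real (4 * K)\<bar> \<le> real (K - 1) / real (4 * K) / 2"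
      using v[of "4 + length ls + i"] i weight_row[OF X i] by simp
    then have "\<bar>v - real (b + card (set A \<inter> chosen X)) / real (4 * K)\<bar> * real (4 * K)
        \<le> real (K - 1) / real (4 * K) / 2 * real (4 * K)"
      using K0 by (intro mult_right_mono) auto
    moreover have "\<bar>v - real (b + card (set A \<inter> chosen X)) / real (4 * K)\<bar> * real (4 * K)
        = \<bar>v * real (4 * K) - real (b + card (set A \<inter> chosen X))\<bar>"
      by (rule scale[OF K0])
    moreover have "real (K - 1) / real (4 * K) / 2 * real (4 * K) = real K / 2 - 1 / 2"
      using K by (simp add: of_nat_diff field_simps)
    ultimately show ?thesis by (simp only:)
  qed
  \<comment> \<open>The two constant rows are K - 1 units of 1/(4K) apart, the full width of the
    window, so \<open>v\<close> must be their midpoint.\<close>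
  have "sat_row K (K + 1) [] \<in> set rs" "sat_row K (2 * K) [] \<in> set rs" by (auto simp: sat_rows_def)
  from win[OF this(1)] win[OF this(2)]
  have v: "v * real (4 * K) = 3 / 2 * real K + 1 / 2" by simp
  have "K + 1 \<le> b + card (set A \<inter> chosen X) \<and> b + card (set A \<inter> chosen X) \<le> 2 * K"
    if "sat_row K b A \<in> set rs" for b A
  proof -
    let ?x = "b + card (set A \<inter> chosen X)"
    have "real K + 1 \<le> real ?x" "real ?x \<le> 2 * real K"
      using win[OF that, unfolded v] by linarith+
    then have "real (K + 1) \<le> real ?x" "real ?x \<le> real (2 * K)" by simp_all
    then show ?thesis unfolding of_nat_le_iff by simp
  qed
  moreover have "chosen X \<subseteq> set ls" by (auto simp: chosen_def)
  ultimately show ?rhs by blast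
next
  assume ?rhs
  then obtain T where T: "T \<subseteq> set ls" and win: "\<And>b A. sat_row K b A \<in> set rs \<Longrightarrow>
      K + 1 \<le> b + card (set A \<inter> T) \<and> b + card (set A \<inter> T) \<le> 2 * K" by blast
  define X where "X = {4 + i | i. i < length ls \<and> ls ! i \<in> T}"
  have X: "X \<subseteq> {4..<4 + length ls}" by (auto simp: X_def)
  have "chosen X = {ls ! i | i. i < length ls \<and> ls ! i \<in> T}" by (auto simp: X_def chosen_def)
  also have "\<dots> = T" using T by (auto simp del: split_paired_All) (metis in_set_conv_nth subsetD)
  finally have "chosen X = T" .
  let ?v = "(3 * real K + 1) / (2 * real (4 * K))"
  have "\<bar>?v - G.weight X s\<bar> \<le> real (K - 1) / real (4 * K) / 2" if "s \<in> {4 + length ls..<nn}" for s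
  proof -
    from that obtain i where i: "s = 4 + length ls + i" "i < length rs"
      by (metis atLeastLessThan_iff le_Suc_ex nat_add_left_cancel_less)
    obtain b A where A: "rs ! i = sat_row K b A" using rows_cases[OF nth_mem[OF i(2)]] by metis
    let ?x = "b + card (set A \<inter> T)"
    have x: "K + 1 \<le> ?x" "?x \<le> 2 * K" using win[of b A] nth_mem[OF i(2)] A by auto
    have "real ?x / real (4 * K) = 2 * real ?x / (2 * real (4 * K))"
      by (rule mult_divide_mult_cancel_left[symmetric]) simp
    then have "\<bar>?v - real ?x / real (4 * K)\<bar> = \<bar>(3 * real K + 1 - 2 * real ?x) / (2 * real (4 * K))\<bar>"
      by (simp only: diff_divide_distrib)
    also have "\<dots> = \<bar>3 * real K + 1 - 2 * real ?x\<bar> / (2 * real (4 * K))" using K by simp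
    also have "\<dots> \<le> real (K - 1) / (2 * real (4 * K))"
    proof (rule divide_right_mono)
      have "real (K + 1) \<le> real ?x" "real ?x \<le> real (2 * K)" using x by (simp_all only: of_nat_le_iff)
      then show "\<bar>3 * real K + 1 - 2 * real ?x\<bar> \<le> real (K - 1)" using K by (simp add: of_nat_diff abs_le_iff)
    qed simp
    finally show ?thesis unfolding i(1) weight_row[OF X i(2) A] \<open>chosen X = T\<close> by simp
  qed
  then show ?lhs using G.quotient_of_solution[OF X] by blast
qed

theorem quotient_iff_sat: "has_eps_quotient_of_size M (real (K - 1) / real (4 * K)) 5 \<longleftrightarrow> sat cs"
  unfolding quotient_iff_chosen
proof
  assume "\<exists>T\<subseteq>set ls. \<forall>b A. sat_row K b A \<in> set rs \<longrightarrow> K + 1 \<le> b + card (set A \<inter> T) \<and> b + card (set A \<inter> T) \<le> 2 * K"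
  then obtain T where T: "T \<subseteq> set ls" and win: "\<And>b A. sat_row K b A \<in> set rs \<Longrightarrow>
      K + 1 \<le> b + card (set A \<inter> T) \<and> b + card (set A \<inter> T) \<le> 2 * K" by blast
  have "\<exists>l\<in>set c. ((True, snd l) \<in> T) = fst l" if c: "c \<in> set cs" for c
  proof -
    have "sat_row K K c \<in> set rs" using c by (auto simp: sat_rows_def)
    from win[OF this] have "card (set c \<inter> T) \<noteq> 0" by linarith
    then obtain l where l: "l \<in> set c" "l \<in> T" by (metis card.empty disjoint_iff)
    show ?thesis
    proof (rule bexI[OF _ l(1)], rule ccontr)
      \<comment> \<open>A literal in \<open>T\<close> that disagrees with the assignment is
        negative, and then both literals of its variable lie in \<open>T\<close>. The row that
        starts at 2K - 1 admits only one.\<close>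
      assume neq: "((True, snd l) \<in> T) \<noteq> fst l"
      let ?A = "[(True, snd l), (False, snd l)]"
      have "snd l \<in> set (vars cs)" using l(2) T set_lits by blast
      then have "sat_row K (2 * K - 1) ?A \<in> set rs" by (auto simp: sat_rows_def)
      from win[OF this] have le: "card (set ?A \<inter> T) \<le> 1" using K by linarith
      have "set ?A \<subseteq> T" using neq l(2) by (cases l; cases "fst l") auto
      then have "set ?A \<inter> T = set ?A" by blast
      then have "card (set ?A) \<le> 1" using le by simp
      then show False by simp
    qed
  qed
  then show "sat cs" unfolding sat_def by (intro exI[of _ "\<lambda>v. (True, v) \<in> T"]) blast
next
  assume "sat cs"
  then obtain \<alpha> where \<alpha>: "\<And>c. c \<in> set cs \<Longrightarrow> \<exists>l\<in>set c. \<alpha> (snd l) = fst l"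
    unfolding sat_def by blast
  define T where "T = {l \<in> set ls. \<alpha> (snd l) = fst l}"
  have clause: "1 \<le> card (set c \<inter> T)" "card (set c \<inter> T) \<le> K" if c: "c \<in> set cs" for c
  proof -
    obtain l where l: "l \<in> set c" "\<alpha> (snd l) = fst l" using \<alpha>[OF c] by blast
    then have "l \<in> set c \<inter> T" using c by (auto simp: T_def set_lits set_vars)
    then show "1 \<le> card (set c \<inter> T)" by (metis List.finite_set One_nat_def Suc_leI card_gt_0_iff empty_iff finite_Int)
    have "card (set c \<inter> T) \<le> card (set c)" by (rule card_mono) auto
    then show "card (set c \<inter> T) \<le> K" using card_length[of c] short[OF c] by linarith
  qed
  have var: "card (set [(True, v), (False, v)] \<inter> T) = 1" if "v \<in> set (vars cs)" for v
  proof -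
    have "set [(True, v), (False, v)] \<inter> T = {(\<alpha> v, v)}"
      using that by (cases "\<alpha> v") (auto simp: T_def set_lits)
    then show ?thesis by simp
  qed
  have "K + 1 \<le> b + card (set A \<inter> T) \<and> b + card (set A \<inter> T) \<le> 2 * K" if "sat_row K b A \<in> set rs" for b A
  proof -
    from that consider "b = K + 1" "A = []" | "b = 2 * K" "A = []" | "A \<in> set cs" "b = K"
      | v where "v \<in> set (vars cs)" "b = K \<or> b = 2 * K - 1" "A = [(True, v), (False, v)]"
      by (auto simp: sat_rows_def sat_row_def)
    then show ?thesis
    proof cases
      case 3
      then show ?thesis using clause[of A] by simp
    next
      case 4
      then show ?thesis using var[of v] K by auto
    qed (use K in auto)
  qed
  moreover have "T \<subseteq> set ls" by (auto simp: T_def)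
  ultimately show "\<exists>T\<subseteq>set ls. \<forall>b A. sat_row K b A \<in> set rs \<longrightarrow>
      K + 1 \<le> b + card (set A \<inter> T) \<and> b + card (set A \<inter> T) \<le> 2 * K" by blast
qed

end

lemma ptime_enc_list [ptimes]:
  assumes "ptime (\<lambda>p. f (fst p) (snd p))" "ptime xs"
  shows "ptime (\<lambda>c. enc_list (f c) (xs c))"
  unfolding enc_list_def by (intro ptimes assms)

lemma ptime_enc_nat [ptimes]: "ptime n \<Longrightarrow> ptime (\<lambda>c. enc_nat (n c))"
  unfolding enc_nat_def by (intro ptimes)

lemma ptime_enc_fraction [ptimes]: "ptime p \<Longrightarrow> ptime (\<lambda>c. enc_fraction (p c))"
proof -
  have "enc_fraction q = enc_nat (fst q) @ enc_nat (snd q)" for q by (cases q) simp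
  then show "ptime p \<Longrightarrow> ptime (\<lambda>c. enc_fraction (p c))" by (simp only:) (intro ptimes)
qed

text \<open>\<open>K\<close> is fixed, so numbers and unary lists that depend on it alone are
  constants of the program.\<close>

lemma ptime_sat_code:
  "ptime (\<lambda>cs :: 'v :: code literal list list. enc_lmc (sat_code K cs))"
  unfolding enc_lmc_def sat_code_def sat_matrix_def sat_rows_def row_weights_def sat_row_def lits_def
    lmc_code.simps
  by (intro ptimes ptime_comp[OF ptime_vars])

section \<open>Turing machine computations as satisfiability\<close>

text \<open>Cells are addressed relative to the head: the atom \<open>[1, t, j, i, a]\<close> says that at time \<open>t\<close> the
  cell of tape \<open>j\<close> at distance \<open>i - N\<close> from the head contains \<open>a\<close>, so no atoms for head positions are
  needed. The atom \<open>[0, t, q]\<close> says that the state is \<open>q\<close>, and \<open>2 # t # q # as\<close> that moreover the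
  symbols \<open>as\<close> are read. Except for the choice of the witness all clauses are Horn clauses that push
  the truth of these atoms forward in time.\<close>

definition move_shift :: "move \<Rightarrow> nat" where
  "move_shift m = nat (1 - displacement m)"

lemma int_move_shift [simp]: "int (move_shift m) = 1 - displacement m"
  by (cases m) (simp_all add: move_shift_def)

text \<open>In the halting state the machine idles, as \<open>tm_step\<close> does, so every run can
  be inspected at one fixed time.\<close>

definition next_action :: "tm \<Rightarrow> nat \<Rightarrow> nat list \<Rightarrow> nat \<times> (nat \<times> move) list" where
  "next_action M q as = (if q = 1 then (1, map (\<lambda>a. (a, Stay)) as) else delta M q as)"

lemma tm_step_next_action:
  "tm_step M (q, ts) = (fst (next_action M q (map read_tape ts)),
     map2 act_on_tape (snd (next_action M q (map read_tape ts))) ts)"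
proof (cases "q = 1")
  case True
  have "map2 act_on_tape (map (\<lambda>a. (a, Stay)) (map read_tape ts)) ts = ts"
    by (rule nth_equalityI) (auto simp: act_Stay)
  then show ?thesis using True by (simp add: next_action_def)
qed (simp add: next_action_def split: prod.split)

type_synonym entry = "nat \<times> nat list \<times> (nat \<times> nat) list \<times> nat \<times> (nat \<times> nat \<times> nat) list"

text \<open>A row of the transition table with everything the clauses need. The table belongs to the
  fixed verifier, so the reduction treats it as a constant.\<close>

definition entry_of :: "tm \<Rightarrow> nat \<Rightarrow> nat list \<Rightarrow> entry" where
  "entry_of M q as = (q, as, List.enumerate 0 as, fst (next_action M q as),
     map (\<lambda>p. (fst p, move_shift (snd (snd p)), fst (snd p))) (List.enumerate 0 (snd (next_action M q as))))"

definition entries :: "tm \<Rightarrow> entry list" where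
  "entries M = concat (map (\<lambda>q. map (entry_of M q) (List.n_lists (n_tapes M) [0..<n_symbols M])) [0..<n_states M])"

lemma set_entries: "set (entries M) = {entry_of M q as | q as.
    q < n_states M \<and> length as = n_tapes M \<and> (\<forall>a\<in>set as. a < n_symbols M)}"
proof -
  have "set (entries M) = {entry_of M q as | q as.
      q \<in> {0..<n_states M} \<and> length as = n_tapes M \<and> set as \<subseteq> {0..<n_symbols M}}"
    by (simp only: entries_def set_concat set_map set_upt set_n_lists image_image) blast
  moreover have "set as \<subseteq> {0..<n_symbols M} \<longleftrightarrow> (\<forall>a\<in>set as. a < n_symbols M)" for as by auto
  ultimately show ?thesis by simp
qed

type_synonym clauses = "nat list literal list list"

text \<open>The index of a cell drops by d when the head moves by d. Starting from index
  \<open>Suc i\<close>, the new index is i + (1 - d), and 1 - d is the natural number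
  \<open>move_shift\<close>. The head's own cell has index \<open>Suc k\<close>, hence the written
  symbol gets index \<open>k + move_shift m\<close>. The auxiliary atom starting with 2 keeps the
  remaining clauses short: they test it instead of all the symbols read.\<close>

definition step_clauses :: "entry list \<Rightarrow> nat list \<Rightarrow> nat \<Rightarrow> nat list \<Rightarrow> nat \<Rightarrow> clauses" where
  "step_clauses es syms k il t = concat (map (\<lambda>e.
     ((False, [0, t, fst e]) # map (\<lambda>r. (False, [1, t, fst r, Suc k, snd r])) (fst (snd (snd e))) @
        [(True, 2 # t # fst e # fst (snd e))]) #
     [(False, 2 # t # fst e # fst (snd e)), (True, [0, Suc t, fst (snd (snd (snd e)))])] #
     concat (map (\<lambda>r.
       [(False, 2 # t # fst e # fst (snd e)), (True, [1, Suc t, fst r, k + fst (snd r), snd (snd r)])] #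
       concat (map (\<lambda>i. map (\<lambda>a.
          [(False, 2 # t # fst e # fst (snd e)), (False, [1, t, fst r, Suc i, a]),
           (True, [1, Suc t, fst r, i + fst (snd r), a])]) syms) (filter (\<lambda>i. i \<noteq> k) il)))
       (snd (snd (snd (snd e)))))) es)"

text \<open>Position 0 has index \<open>Suc k\<close>. Only the witness tape 1 is left open: each of
  its first \<open>length v\<close> cells holds a blank or a bit, and a blank forces a blank after
  it. So a word of length at most \<open>length v\<close> is guessed.\<close>

definition init_clauses :: "nat list \<Rightarrow> nat \<Rightarrow> nat list \<Rightarrow> bool list \<Rightarrow> bool list \<Rightarrow> clauses" where
  "init_clauses js k il x v =
     [(True, [0, 0, 0])] #
     concat (map (\<lambda>j. map (\<lambda>i. [(True, [1, 0, j, i, 0])]) il) js) @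
     map (\<lambda>i. [(True, [1, 0, 0, i, 0])]) (filter (\<lambda>i. i \<le> k) il) @
     map (\<lambda>p. [(True, [1, 0, 0, Suc k + fst p, if snd p then 2 else 1])]) (zip [0..<length x] x) @
     map (\<lambda>i. [(True, [1, 0, 0, Suc k + length x + i, 0])]) il @
     map (\<lambda>i. [(True, [1, 0, 1, i, 0])]) (filter (\<lambda>i. i \<le> k) il) @
     map (\<lambda>l. [(True, [1, 0, 1, Suc k + l, 0]), (True, [1, 0, 1, Suc k + l, 1]), (True, [1, 0, 1, Suc k + l, 2])])
       [0..<length v] @
     map (\<lambda>l. [(False, [1, 0, 1, Suc k + l, 0]), (True, [1, 0, 1, Suc k + Suc l, 0])]) [0..<length v] @
     map (\<lambda>i. [(True, [1, 0, 1, Suc k + length v + i, 0])]) il"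

text \<open>The lengths of \<open>u\<close> and \<open>v\<close> are the number T of steps and the
  maximal length of a witness. The head has index 2T + 1 among 4T + 3 cells. Knowledge about the
  cells shrinks by one at each end per step, and after T steps it still reaches T cells to either
  side of the head. The last clauses forbid the bit \<open>False\<close> on the output tape.\<close>

definition tableau :: "tm \<Rightarrow> bool list \<Rightarrow> bool list \<Rightarrow> bool list \<Rightarrow> clauses" where
  "tableau M x v u =
     init_clauses [2..<n_tapes M] (2 * length u) [0..<length (u @ u @ u @ u @ [True, True, True])] x v @
     concat (map (\<lambda>t. step_clauses (entries M) [0..<n_symbols M] (2 * length u)
       [0..<length (u @ u @ u @ u @ [True, True, True])] t) [0..<length u]) @
     map (\<lambda>i. [(False, [1, length u, n_tapes M - 1, i, 1])]) [0..<length (u @ u @ u @ u @ [True, True, True])]"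

lemma ptime_tableau: "ptime (\<lambda>p. tableau M (fst p) (fst (snd p)) (snd (snd p)))"
  unfolding tableau_def init_clauses_def step_clauses_def by (intro ptimes)

text \<open>The longest step clause has a literal for the state, one for each tape and the
  conclusion. The bound also covers the choice among three symbols for a witness cell.\<close>

lemma length_tableau_clause: 
  assumes "is_tm M" "c \<in> set (tableau M x v u)"
  shows "length c \<le> n_tapes M + 3"
proof -
  have *: "length rs = n_tapes M" if "(q, as, rs, q', acts) \<in> set (entries M)" for q as rs q' acts
    using that by (auto simp: set_entries entry_of_def)
  show ?thesis
    using assms(2) by (auto simp: tableau_def init_clauses_def step_clauses_def dest!: *)
qed

definition holds :: "('v \<Rightarrow> bool) \<Rightarrow> 'v literal list list \<Rightarrow> bool" where
  "holds \<alpha> cs \<longleftrightarrow> (\<forall>c\<in>set cs. \<exists>l\<in>set c. \<alpha> (snd l) = fst l)"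

lemma sat_holds: "sat cs \<longleftrightarrow> (\<exists>\<alpha>. holds \<alpha> cs)"
  by (simp add: sat_def holds_def)

lemma holds_simps:
  "holds \<alpha> []" "holds \<alpha> (c # cs) \<longleftrightarrow> (\<exists>l\<in>set c. \<alpha> (snd l) = fst l) \<and> holds \<alpha> cs"
  "holds \<alpha> (cs @ ds) \<longleftrightarrow> holds \<alpha> cs \<and> holds \<alpha> ds"
  "holds \<alpha> (concat (map f xs)) \<longleftrightarrow> (\<forall>x\<in>set xs. holds \<alpha> (f x))"
  "holds \<alpha> (map g xs) \<longleftrightarrow> (\<forall>x\<in>set xs. \<exists>l\<in>set (g x). \<alpha> (snd l) = fst l)"
  by (auto simp: holds_def)

lemma holds_step_clauses:
  "holds \<alpha> (step_clauses es syms k il t) \<longleftrightarrow> (\<forall>e\<in>set es.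
     (\<alpha> [0, t, fst e] \<and> (\<forall>r\<in>set (fst (snd (snd e))). \<alpha> [1, t, fst r, Suc k, snd r]) \<longrightarrow> \<alpha> (2 # t # fst e # fst (snd e))) \<and>
     (\<alpha> (2 # t # fst e # fst (snd e)) \<longrightarrow> \<alpha> [0, Suc t, fst (snd (snd (snd e)))] \<and>
       (\<forall>r\<in>set (snd (snd (snd (snd e)))). \<alpha> [1, Suc t, fst r, k + fst (snd r), snd (snd r)] \<and>
          (\<forall>i\<in>set il. i \<noteq> k \<longrightarrow> (\<forall>a\<in>set syms. \<alpha> [1, t, fst r, Suc i, a] \<longrightarrow>
             \<alpha> [1, Suc t, fst r, i + fst (snd r), a])))))"
  unfolding step_clauses_def holds_simps by (simp add: bex_Un) blast

lemma holds_init_clauses: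
  "holds \<alpha> (init_clauses js k il x v) \<longleftrightarrow>
     \<alpha> [0, 0, 0] \<and> (\<forall>j\<in>set js. \<forall>i\<in>set il. \<alpha> [1, 0, j, i, 0]) \<and>
     (\<forall>i\<in>set il. i \<le> k \<longrightarrow> \<alpha> [1, 0, 0, i, 0]) \<and>
     (\<forall>l<length x. \<alpha> [1, 0, 0, Suc k + l, if x ! l then 2 else 1]) \<and>
     (\<forall>i\<in>set il. \<alpha> [1, 0, 0, Suc k + length x + i, 0]) \<and>
     (\<forall>i\<in>set il. i \<le> k \<longrightarrow> \<alpha> [1, 0, 1, i, 0]) \<and>
     (\<forall>l<length v. \<alpha> [1, 0, 1, Suc k + l, 0] \<or> \<alpha> [1, 0, 1, Suc k + l, 1] \<or> \<alpha> [1, 0, 1, Suc k + l, 2]) \<and>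
     (\<forall>l<length v. \<alpha> [1, 0, 1, Suc k + l, 0] \<longrightarrow> \<alpha> [1, 0, 1, Suc k + Suc l, 0]) \<and>
     (\<forall>i\<in>set il. \<alpha> [1, 0, 1, Suc k + length v + i, 0])"
proof -
  have zip: "(\<forall>p\<in>set (zip [0..<length x] x). P p) \<longleftrightarrow> (\<forall>l<length x. P (l, x ! l))" for P
  proof (intro iffI allI impI ballI)
    fix l assume P: "\<forall>p\<in>set (zip [0..<length x] x). P p" and l: "l < length x"
    then have "zip [0..<length x] x ! l \<in> set (zip [0..<length x] x)" by (intro nth_mem) simp
    with P l show "P (l, x ! l)" by fastforce
  qed (auto simp: set_zip)
  show ?thesis
    unfolding init_clauses_def holds_simps zip by (auto simp: Ball_def)
qed

section \<open>The run on a given witness, its intended model and what every model must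
  contain\<close>

locale computation =
  fixes M :: tm and x w :: "bool list"
  assumes tm: "is_tm M" and two: "2 \<le> n_tapes M"
begin

definition cfg :: "nat \<Rightarrow> config" where
  "cfg t = (tm_step M ^^ t) (tm_init M [x, w])"

abbreviation "state t \<equiv> fst (cfg t)"
abbreviation "reads t \<equiv> map read_tape (snd (cfg t))"

definition cell :: "nat \<Rightarrow> nat \<Rightarrow> int \<Rightarrow> nat" where
  "cell t j d = fst (snd (cfg t) ! j) (snd (snd (cfg t) ! j) + d)"

lemma cfg_Suc:
  "cfg (Suc t) = (fst (next_action M (state t) (reads t)),
     map2 act_on_tape (snd (next_action M (state t) (reads t))) (snd (cfg t)))"
  by (simp add: cfg_def tm_step_next_action[of M "fst (cfg t)" "snd (cfg t)" for t, unfolded cfg_def, simplified])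

lemma next_action:
  assumes "q < n_states M" "length as = n_tapes M" "\<forall>a\<in>set as. a < n_symbols M"
  shows "fst (next_action M q as) < n_states M" "length (snd (next_action M q as)) = n_tapes M"
    "\<forall>b\<in>set (snd (next_action M q as)). fst b < n_symbols M"
proof -
  obtain q' acts where d: "delta M q as = (q', acts)" by fastforce
  have "q' < n_states M \<and> length acts = n_tapes M \<and> (\<forall>(b, m)\<in>set acts. b < n_symbols M)"
    using tm assms d by (fastforce simp: is_tm_def)
  then show "fst (next_action M q as) < n_states M" "length (snd (next_action M q as)) = n_tapes M"
    "\<forall>b\<in>set (snd (next_action M q as)). fst b < n_symbols M"
    using assms tm d by (auto simp: next_action_def is_tm_def)
qed

lemma invariant:
  "state t < n_states M \<and> length (snd (cfg t)) = n_tapes M \<and>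
   (\<forall>j<n_tapes M. \<forall>i. fst (snd (cfg t) ! j) i < n_symbols M)"
proof (induction t)
  case 0
  show ?case using tm by (auto simp: cfg_def tm_init_def is_tm_def word_tape_def)
next
  case (Suc t)
  have "\<forall>a\<in>set (reads t). a < n_symbols M"
  proof
    fix a assume "a \<in> set (reads t)"
    then obtain j where "j < n_tapes M" "a = read_tape (snd (cfg t) ! j)"
      using Suc by (auto simp: in_set_conv_nth)
    then show "a < n_symbols M" using Suc by (cases "snd (cfg t) ! j") auto
  qed
  then have na: "fst (next_action M (state t) (reads t)) < n_states M"
    "length (snd (next_action M (state t) (reads t))) = n_tapes M"
    "\<forall>b\<in>set (snd (next_action M (state t) (reads t))). fst b < n_symbols M"
    using next_action[of "state t" "reads t"] Suc by auto
  have "fst (snd (cfg (Suc t)) ! j) i < n_symbols M" if j: "j < n_tapes M" for j i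
  proof -
    let ?b = "snd (next_action M (state t) (reads t)) ! j"
    have "fst ?b < n_symbols M" using na(2,3) j by simp
    then show ?thesis using Suc j na(2)
      by (cases ?b; cases "snd (cfg t) ! j") (auto simp: cfg_Suc)
  qed
  then show ?case using na Suc by (simp add: cfg_Suc)
qed

lemma reads_nth: "j < n_tapes M \<Longrightarrow> reads t ! j = cell t j 0"
  using invariant[of t] by (cases "snd (cfg t) ! j") (simp add: cell_def)

lemma cell_less: "j < n_tapes M \<Longrightarrow> cell t j d < n_symbols M"
  using invariant[of t] by (simp add: cell_def)

lemma reads_ok: "length (reads t) = n_tapes M" "\<forall>a\<in>set (reads t). a < n_symbols M"
proof -
  show l: "length (reads t) = n_tapes M" using invariant[of t] by simp
  show "\<forall>a\<in>set (reads t). a < n_symbols M"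
    using l reads_nth cell_less by (metis in_set_conv_nth)
qed

lemma entry_in: "entry_of M (state t) (reads t) \<in> set (entries M)"
  using invariant[of t] reads_ok[of t] unfolding set_entries by blast

definition act :: "nat \<Rightarrow> nat \<Rightarrow> nat \<times> move" where
  "act t j = snd (next_action M (state t) (reads t)) ! j"

lemma cell_Suc:
  assumes "j < n_tapes M"
  shows "cell (Suc t) j d = (if d + displacement (snd (act t j)) = 0 then fst (act t j)
    else cell t j (d + displacement (snd (act t j))))"
proof -
  have "length (snd (next_action M (state t) (reads t))) = n_tapes M"
    using next_action(2)[of "state t" "reads t"] invariant[of t] reads_ok[of t] by auto
  then have "snd (cfg (Suc t)) ! j = act_on_tape (act t j) (snd (cfg t) ! j)"
    using assms invariant[of t] by (simp add: cfg_Suc act_def)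
  then show ?thesis
    by (cases "act t j"; cases "snd (cfg t) ! j") (auto simp: cell_def add_ac)
qed

lemma acts_entry:
  "set (snd (snd (snd (snd (entry_of M (state t) (reads t))))))
   = {(j, move_shift (snd (act t j)), fst (act t j)) | j. j < n_tapes M}"
proof -
  have l: "length (snd (next_action M (state t) (reads t))) = n_tapes M"
    using next_action(2)[of "state t" "reads t"] invariant[of t] reads_ok[of t] by auto
  show ?thesis unfolding entry_of_def snd_conv set_map
  proof (intro equalityI subsetI)
    fix r assume "r \<in> {(j, move_shift (snd (act t j)), fst (act t j)) | j. j < n_tapes M}"
    then obtain j where j: "j < n_tapes M" "r = (j, move_shift (snd (act t j)), fst (act t j))" by blast
    then show "r \<in> (\<lambda>p. (fst p, move_shift (snd (snd p)), fst (snd p))) `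
        set (List.enumerate 0 (snd (next_action M (state t) (reads t))))"
      by (intro image_eqI[of _ _ "(j, act t j)"]) (simp_all add: in_set_enumerate_eq l act_def)
  qed (auto simp: in_set_enumerate_eq l act_def)
qed

lemma head_bound: "j < n_tapes M \<Longrightarrow> \<bar>snd (snd (cfg t) ! j)\<bar> \<le> int t"
proof (induction t)
  case 0
  then show ?case by (auto simp: cfg_def tm_init_def)
next
  case (Suc t)
  have "length (snd (next_action M (state t) (reads t))) = n_tapes M"
    using next_action(2)[of "state t" "reads t"] invariant[of t] reads_ok[of t] by auto
  then have "snd (cfg (Suc t)) ! j = act_on_tape (act t j) (snd (cfg t) ! j)"
    using Suc.prems invariant[of t] by (simp add: cfg_Suc act_def)
  moreover obtain b m where "act t j = (b, m)" by fastforce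
  moreover have "\<bar>displacement m\<bar> \<le> 1" by (cases m) auto
  ultimately show ?case using Suc.IH[OF Suc.prems]
    by (cases "snd (cfg t) ! j") auto
qed

lemma cell_0: "j < n_tapes M \<Longrightarrow> cell 0 j d = word_tape (if j = 0 then x else if j = 1 then w else []) d"
proof -
  assume "j < n_tapes M"
  moreover have "j < 2 \<Longrightarrow> j = 0 \<or> j = 1" by linarith
  ultimately show ?thesis by (auto simp: cell_def cfg_def tm_init_def)
qed

text \<open>The intended model: all true facts about this run, with the head at index
  \<open>Suc k\<close>.\<close>

definition atoms :: "nat \<Rightarrow> nat list set" where
  "atoms k = {[0, t, state t] | t. True} \<union>
     {[1, t, j, i, cell t j (int i - int (Suc k))] | t j i. j < n_tapes M} \<union>
     {2 # t # state t # reads t | t. True}"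

lemma atoms_iff:
  "[0, t, q] \<in> atoms k \<longleftrightarrow> q = state t"
  "[1, t, j, i, a] \<in> atoms k \<longleftrightarrow> j < n_tapes M \<and> a = cell t j (int i - int (Suc k))"
  "2 # t # q # as \<in> atoms k \<longleftrightarrow> q = state t \<and> as = reads t"
  by (auto simp: atoms_def)

lemma holds_steps: "holds (\<lambda>v. v \<in> atoms k) (step_clauses (entries M) syms k il t)"
  unfolding holds_step_clauses atoms_iff
proof (intro ballI conjI impI; (elim conjE)?)
  fix e assume e: "e \<in> set (entries M)"
  then obtain q as where qa: "e = entry_of M q as" "length as = n_tapes M"
    unfolding set_entries by blast
  {
    assume q: "fst e = state t" and
      r: "\<forall>r\<in>set (fst (snd (snd e))). fst r < n_tapes M \<and> snd r = cell t (fst r) (int (Suc k) - int (Suc k))"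
    have "as ! j = reads t ! j" if "j < n_tapes M" for j
    proof -
      have "(j, as ! j) \<in> set (fst (snd (snd e)))"
        using that qa by (auto simp: entry_of_def in_set_enumerate_eq)
      with r have "as ! j = cell t j 0" by fastforce
      then show ?thesis using reads_nth[OF that] by simp
    qed
    then show "fst e = state t" "fst (snd e) = reads t"
      using q qa reads_ok by (auto simp: entry_of_def intro: nth_equalityI)
  }
  assume q: "fst e = state t" "fst (snd e) = reads t"
  then have e: "e = entry_of M (state t) (reads t)" using qa by (simp add: entry_of_def)
  then show "fst (snd (snd (snd e))) = state (Suc t)" by (simp add: entry_of_def cfg_Suc)
  fix r assume "r \<in> set (snd (snd (snd (snd e))))"
  then obtain j where j: "j < n_tapes M" and r: "r = (j, move_shift (snd (act t j)), fst (act t j))"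
    unfolding e acts_entry by blast
  show "fst r < n_tapes M" using j r by simp
  show "snd (snd r) = cell (Suc t) (fst r) (int (k + fst (snd r)) - int (Suc k))"
    using cell_Suc[OF j] r by simp
  fix i a assume i: "i \<noteq> k" and a: "a = cell t (fst r) (int (Suc i) - int (Suc k))"
  show "a = cell (Suc t) (fst r) (int (i + fst (snd r)) - int (Suc k))"
    using cell_Suc[OF j] r i a by (simp add: algebra_simps)
  show "fst r < n_tapes M" using j r by simp
qed

lemma holds_init:
  assumes "length w \<le> length v"
  shows "holds (\<lambda>v. v \<in> atoms k) (init_clauses [2..<n_tapes M] k il x v)"
proof -
  have word: "word_tape u (int l) = (if l < length u then if u ! l then 2 else 1 else 0)" for u l
    by (simp add: word_tape_def)
  have neg: "word_tape u (int i - int (Suc k)) = 0" if "i \<le> k" for u i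
    using that by (simp add: word_tape_def)
  have nil: "word_tape [] d = 0" for d by (simp add: word_tape_def)
  have c: "cell 0 0 d = word_tape x d" "cell 0 1 d = word_tape w d" "2 \<le> j \<Longrightarrow> j < n_tapes M \<Longrightarrow> cell 0 j d = 0" for d j
    using cell_0[of 0 d] cell_0[of 1 d] cell_0[of j d] two nil by auto
  have pos: "int (Suc k + l) - int (Suc k) = int l" for l by simp
  have "state 0 = 0" by (simp add: cfg_def tm_init_def)
  then show ?thesis
    unfolding holds_init_clauses atoms_iff add.assoc[of "Suc k"] pos c using two assms
    by (auto simp only: c(3) word neg set_upt atLeastLessThan_iff not_add_less1 if_False split: if_splits)
qed

text \<open>A model may contain further atoms, but the step clauses propagate the true facts. The
  head moves by at most one cell, so a cell known at time t + 1 stems from one whose index differs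
  by at most 1 at time t. This is why the known interval loses one cell at each end in every
  step.\<close>

lemma forced:
  assumes init: "holds \<alpha> (init_clauses [2..<n_tapes M] (2 * T) [0..<4 * T + 3] x v)"
    and step: "\<And>t. t < T \<Longrightarrow> holds \<alpha> (step_clauses (entries M) [0..<n_symbols M] (2 * T) [0..<4 * T + 3] t)"
    and w: "\<And>l. l < 4 * T + 3 \<Longrightarrow> \<alpha> [1, 0, 1, Suc (2 * T) + l, word_tape w (int l)]"
    and "t \<le> T"
  shows "\<alpha> [0, t, state t] \<and> (\<forall>j<n_tapes M. \<forall>i. Suc t \<le> i \<and> i + t < 4 * T + 2 \<longrightarrow>
      \<alpha> [1, t, j, i, cell t j (int i - int (Suc (2 * T)))])"
  using \<open>t \<le> T\<close>
proof (induction t)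
  case 0
  have word: "word_tape u (int l) = (if l < length u then if u ! l then 2 else 1 else 0)" for u l
    by (simp add: word_tape_def)
  note init = init[unfolded holds_init_clauses, simplified]
  have "\<alpha> [1, 0, j, i, cell 0 j (int i - int (Suc (2 * T)))]" if j: "j < n_tapes M" and i: "i < 4 * T + 2" for j i
  proof -
    have "i \<le> 2 * T \<or> (\<exists>l. i = Suc (2 * T) + l \<and> l < 4 * T + 3)"
      using i by presburger
    then consider "2 \<le> j" | "j < 2" "i \<le> 2 * T" | l where "j < 2" "i = Suc (2 * T) + l" "l < 4 * T + 3"
      using not_less by blast
    then show ?thesis
    proof cases
      case 1
      then have "cell 0 j (int i - int (Suc (2 * T))) = 0" using cell_0[OF j] by (simp add: word_tape_def)
      then show ?thesis using init 1 j i by simp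
    next
      case 2
      then have "cell 0 j (int i - int (Suc (2 * T))) = 0" using cell_0[OF j] by (simp add: word_tape_def)
      moreover have "j = 0 \<or> j = 1" using 2 by linarith
      ultimately show ?thesis using init 2 i by auto
    next
      case 3
      have eq: "int i - int (Suc (2 * T)) = int l" using 3 by simp
      show ?thesis
      proof (cases "j = 0")
        case True
        have c: "cell 0 j (int l) = word_tape x (int l)" using cell_0[OF j] True by simp
        show ?thesis
        proof (cases "l < length x")
          case True
          then show ?thesis unfolding eq c word using init \<open>j = 0\<close> 3 by simp
        next
          case False
          then obtain m where "l = length x + m" by (metis le_iff_add not_less)
          then show ?thesis unfolding eq c word using init \<open>j = 0\<close> 3 by (simp add: add.assoc)
        qed
      next
        case False
        then have "j = 1" using 3 by linarith
        then show ?thesis unfolding eq using cell_0[OF j] w[OF 3(3)] 3 by simp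
      qed
    qed
  qed
  moreover have "state 0 = 0" by (simp add: cfg_def tm_init_def)
  ultimately show ?case using init by simp
next
  case (Suc t)
  then have t: "t < T" by simp
  note IH = Suc.IH[OF less_imp_le[OF t]]
  let ?e = "entry_of M (state t) (reads t)"
  have e: "fst ?e = state t" "fst (snd ?e) = reads t" "fst (snd (snd ?e)) = List.enumerate 0 (reads t)"
    "fst (snd (snd (snd ?e))) = state (Suc t)"
    by (simp_all add: entry_of_def cfg_Suc)
  note st = bspec[OF step[OF t, unfolded holds_step_clauses] entry_in[of t], unfolded e]
  have "\<alpha> [1, t, fst r, Suc (2 * T), snd r]" if "r \<in> set (List.enumerate 0 (reads t))" for r
  proof -
    from that have "fst r < length (reads t)" "snd r = reads t ! fst r"
      by (simp_all add: in_set_enumerate_eq)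
    then have r: "fst r < n_tapes M" "snd r = cell t (fst r) 0"
      unfolding reads_ok(1) using reads_nth by simp_all
    have "Suc t \<le> Suc (2 * T) \<and> Suc (2 * T) + t < 4 * T + 2" using t by linarith
    with IH r(1) have "\<alpha> [1, t, fst r, Suc (2 * T), cell t (fst r) (int (Suc (2 * T)) - int (Suc (2 * T)))]" by blast
    then show ?thesis using r by simp
  qed
  with st IH have X: "\<alpha> (2 # t # state t # reads t)" by blast
  have "\<alpha> [1, Suc t, j, i, cell (Suc t) j (int i - int (Suc (2 * T)))]"
    if j: "j < n_tapes M" and i: "Suc (Suc t) \<le> i" "i + Suc t < 4 * T + 2" for j i
  proof -
    let ?m = "move_shift (snd (act t j))" and ?d = "displacement (snd (act t j))"
    have r: "(j, ?m, fst (act t j)) \<in> set (snd (snd (snd (snd ?e))))"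
      using j unfolding acts_entry by blast
    have m: "?m \<le> 2" by (cases "snd (act t j)") (simp_all add: move_shift_def)
    then obtain i0 where i0: "i = i0 + ?m" using i(1) by (metis add.commute le_add_diff_inverse le_trans numeral_2_eq_2 Suc_le_mono le0)
    have di: "int i - int (Suc (2 * T)) + ?d = int (Suc i0) - int (Suc (2 * T))" using i0 by simp
    show ?thesis
    proof (cases "i0 = 2 * T")
      case True
      then have "int i - int (Suc (2 * T)) + ?d = 0" using di by simp
      then have "cell (Suc t) j (int i - int (Suc (2 * T))) = fst (act t j)" using cell_Suc[OF j] by simp
      moreover have "\<alpha> [1, Suc t, j, 2 * T + ?m, fst (act t j)]"
        using st X r by fastforce
      ultimately show ?thesis using i0 True by simp
    next
      case False
      then have nz: "int i - int (Suc (2 * T)) + ?d \<noteq> 0" using di by simp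
      then have c: "cell (Suc t) j (int i - int (Suc (2 * T))) = cell t j (int (Suc i0) - int (Suc (2 * T)))"
        using cell_Suc[OF j, of t "int i - int (Suc (2 * T))"] nz unfolding di by (simp only: if_False)
      have "int (Suc i0) = int i + ?d" using di by linarith
      moreover have "\<bar>?d\<bar> \<le> 1" by (cases "snd (act t j)") auto
      ultimately have "Suc t \<le> Suc i0 \<and> Suc i0 + t < 4 * T + 2" using i by linarith
      then have "\<alpha> [1, t, j, Suc i0, cell t j (int (Suc i0) - int (Suc (2 * T)))]" "i0 < 4 * T + 3"
        using IH j by (blast, linarith)
      then have "\<alpha> [1, Suc t, j, i0 + ?m, cell t j (int (Suc i0) - int (Suc (2 * T)))]"
        using st X r False cell_less[OF j] by fastforce
      then show ?thesis unfolding c unfolding i0 .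
    qed
  qed
  moreover have "\<alpha> [0, Suc t, state (Suc t)]" using st X by blast
  ultimately show ?case by blast
qed

text \<open>A halted configuration does not change any more, so the output can be read at time
  \<open>T\<close> even if the machine stopped earlier.\<close>

lemma output_cell:
  assumes "tm_computes_within M T [x, w] [b]"
  shows "fst (last (snd (cfg T))) = word_tape [b]"
proof -
  from assms obtain t where "t \<le> T" "case cfg t of (q, ts) \<Rightarrow> q = 1 \<and> fst (last ts) = word_tape [b]"
    unfolding tm_computes_within_def cfg_def[symmetric] by (elim exE conjE) (rule that)
  then have t: "t \<le> T" "fst (cfg t) = 1" "fst (last (snd (cfg t))) = word_tape [b]"
    by (simp_all add: case_prod_beta)
  have "cfg (t + i) = cfg t" for i
  proof (induction i)
    case (Suc i)
    then have "cfg (t + Suc i) = tm_step M (cfg t)" by (simp add: cfg_def)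
    also have "\<dots> = cfg t" using t(2) by (cases "cfg t") simp
    finally show ?case .
  qed simp
  from this[of "T - t"] show ?thesis using t by simp
qed

end

theorem sat_tableau_iff:
  assumes tm: "is_tm M" "2 \<le> n_tapes M"
    and run: "\<And>w. length w \<le> length v \<Longrightarrow> tm_computes_within M (length u) [x, w] [V w]"
  shows "sat (tableau M x v u) \<longleftrightarrow> (\<exists>w. length w \<le> length v \<and> V w)"
proof
  let ?T = "length u"
  assume "\<exists>w. length w \<le> length v \<and> V w"
  then obtain w where w: "length w \<le> length v" "V w" by blast
  interpret computation M x w using tm by unfold_locales
  have last: "last (snd (cfg ?T)) = snd (cfg ?T) ! (n_tapes M - 1)"
    using invariant[of ?T] two by (metis last_conv_nth list.size(3) not_numeral_le_zero)
  have "cell ?T (n_tapes M - 1) d \<noteq> 1" for d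
    using output_cell[OF run[OF w(1)]] w(2) unfolding last cell_def by (auto simp: word_tape_def)
  then have "[1, ?T, n_tapes M - 1, i, 1] \<notin> atoms (2 * ?T)" for i
    unfolding atoms_iff by metis
  then have "holds (\<lambda>a. a \<in> atoms (2 * ?T)) (tableau M x v u)"
    unfolding tableau_def holds_simps using holds_init[OF w(1)] holds_steps by simp
  then show "sat (tableau M x v u)" unfolding sat_holds by blast
next
  let ?T = "length u"
  assume "sat (tableau M x v u)"
  then obtain \<alpha> where \<alpha>: "holds \<alpha> (tableau M x v u)" unfolding sat_holds by blast
  have len: "length (u @ u @ u @ u @ [True, True, True]) = 4 * ?T + 3" by simp
  note \<alpha> = \<alpha>[unfolded tableau_def holds_simps len]
  have init: "holds \<alpha> (init_clauses [2..<n_tapes M] (2 * ?T) [0..<4 * ?T + 3] x v)"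
    and step: "\<And>t. t < ?T \<Longrightarrow> holds \<alpha> (step_clauses (entries M) [0..<n_symbols M] (2 * ?T) [0..<4 * ?T + 3] t)"
    and final: "\<And>i. i < 4 * ?T + 3 \<Longrightarrow> \<not> \<alpha> [1, ?T, n_tapes M - 1, i, 1]"
    using \<alpha> by auto
  let ?c = "\<lambda>l a. \<alpha> [1, 0, 1, Suc (2 * ?T) + l, a]"
  have choice: "?c l 0 \<or> ?c l 1 \<or> ?c l 2" "?c l 0 \<Longrightarrow> ?c (Suc l) 0" if "l < length v" for l
    using init that unfolding holds_init_clauses by blast+
  have beyond: "?c (length v + i) 0" if "i < 4 * ?T + 3" for i
    using init that unfolding holds_init_clauses by (simp add: add.assoc)
  \<comment> \<open>The first cell that the model allows to be blank marks the end of the witness.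
    Such a cell exists because the cells from \<open>length v\<close> on are blank.\<close>
  define m where "m = (LEAST l. ?c l 0)"
  have m0: "?c m 0" unfolding m_def by (rule LeastI[of _ "length v"]) (use beyond[of 0] in simp)
  have m_le: "m \<le> length v" unfolding m_def by (rule Least_le) (use beyond[of 0] in simp)
  have m_least: "\<not> ?c l 0" if "l < m" for l using that not_less_Least unfolding m_def by blast
  \<comment> \<open>A model may allow both bits in one cell. Preferring 2 is safe, since all that
    \<open>forced\<close> needs is that the atom of the selected symbol is true.\<close>
  define w where "w = map (\<lambda>l. ?c l 2) [0..<m]"
  interpret computation M x w using tm by unfold_locales
  have blank: "?c (m + i) 0" if "m + i \<le> length v" for i
    using that
  proof (induction i)
    case (Suc i)
    then show ?case using choice(2)[of "m + i"] by simp
  qed (use m0 in simp)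
  have wit: "?c l (word_tape w (int l))" if l: "l < 4 * ?T + 3" for l
  proof -
    consider "l < m" | i where "l = m + i" "l \<le> length v" | i where "l = length v + i" "i < 4 * ?T + 3"
      using l by (metis le_add_diff_inverse nat_le_linear not_less less_imp_diff_less)
    then show ?thesis
    proof cases
      case 1
      then show ?thesis using choice(1)[of l] m_least[of l] m_le by (auto simp: word_tape_def w_def)
    next
      case 2
      then show ?thesis using blank[of i] by (simp add: word_tape_def w_def)
    next
      case 3
      then show ?thesis using beyond[of i] m_le by (simp add: word_tape_def w_def)
    qed
  qed
  have lw: "length w \<le> length v" using m_le by (simp add: w_def)
  let ?j = "n_tapes M - 1"
  have j: "?j < n_tapes M" using two by linarith
  have last: "last (snd (cfg ?T)) = snd (cfg ?T) ! ?j"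
    using invariant[of ?T] two by (metis last_conv_nth list.size(3) not_numeral_le_zero)
  let ?h = "snd (snd (cfg ?T) ! ?j)"
  \<comment> \<open>The index of position 0 on the output tape at time T. The head is within
    distance T of that position, so the index lies in the interval that \<open>forced\<close>
    controls.\<close>
  define i where "i = nat (int (Suc (2 * ?T)) - ?h)"
  have i: "int i = int (Suc (2 * ?T)) - ?h" "Suc ?T \<le> i" "i + ?T < 4 * ?T + 2"
    using head_bound[OF j, of ?T] by (auto simp: i_def)
  have "\<alpha> [1, ?T, ?j, i, cell ?T ?j (int i - int (Suc (2 * ?T)))]"
    using forced[OF init step wit order_refl] i j by blast
  moreover have "cell ?T ?j (int i - int (Suc (2 * ?T))) = word_tape [V w] 0"
    using output_cell[OF run[OF lw]] unfolding last cell_def i(1) by simp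
  moreover have "i < 4 * ?T + 3" using i by linarith
  ultimately have "word_tape [V w] 0 \<noteq> 1" using final[of i] by metis
  then have "V w" by (auto simp: word_tape_def split: if_splits)
  with lw show "\<exists>w. length w \<le> length v \<and> V w" by blast
qed

theorem NP_reduces_to_quotient:
  assumes "A \<in> NP"
  obtains K :: nat and c where "2 \<le> K" "ptime (\<lambda>x. enc_lmc (c x))" "\<And>x. valid_lmc_code (c x)"
    "\<And>x. has_eps_quotient_of_size (lmc_of_code (c x)) (real (K - 1) / real (4 * K)) 5 \<longleftrightarrow> x \<in> A"
proof -
  from assms obtain V p where V: "poly_time_computable 2 (\<lambda>ws. [V (ws ! 0) (ws ! 1)])"
    and A: "\<And>x. x \<in> A \<longleftrightarrow> (\<exists>w. length w \<le> poly p (length x) \<and> V x w)" unfolding NP_def by blast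
  from V obtain M q where tm: "is_tm M" "2 \<le> n_tapes M" and
    run: "\<And>ws. length ws = 2 \<Longrightarrow> tm_computes_within M (poly q (sum_list (map length ws))) ws [V (ws ! 0) (ws ! 1)]"
    unfolding poly_time_computable_def by blast
  obtain v :: "bool list \<Rightarrow> bool list" where v: "ptime v" "\<And>x. length (v x) = poly p (length x)"
    using ptime_list_of_poly_length by metis
  \<comment> \<open>The composed polynomial is the running time of the verifier on the input
    together with a witness of maximal length.\<close>
  obtain u :: "bool list \<Rightarrow> bool list" where u: "ptime u" "\<And>x. length (u x) = poly (pcompose q (p + [:0, 1:])) (length x)"
    using ptime_list_of_poly_length by metis
  let ?cs = "\<lambda>x. tableau M x (v x) (u x)"
  let ?K = "n_tapes M + 3"
  have "sat (?cs x) \<longleftrightarrow> x \<in> A" for x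
    unfolding A v(2)[symmetric]
  proof (rule sat_tableau_iff[OF tm])
    fix w :: "bool list" assume "length w \<le> length (v x)"
    then have "poly q (length x + length w) \<le> length (u x)"
      unfolding u(2) v(2) poly_pcompose by (intro poly_nat_mono) simp
    with run[of "[x, w]"] show "tm_computes_within M (length (u x)) [x, w] [V x w]"
      unfolding tm_computes_within_def by (auto intro: order_trans)
  qed
  moreover have "ptime (\<lambda>x. enc_lmc (sat_code ?K (?cs x)))"
  proof (rule ptime_comp[OF ptime_sat_code])
    have "ptime (\<lambda>x. (x, v x, u x))" by (intro ptimes u v)
    from ptime_comp[OF ptime_tableau this] show "ptime ?cs" by simp
  qed
  moreover have "2 \<le> ?K" by simp
  moreover have "short_clauses ?K (?cs x)" for x
    by unfold_locales (simp, rule length_tableau_clause[OF tm(1)])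
  ultimately show thesis
    using that[of ?K "\<lambda>x. sat_code ?K (?cs x)"] short_clauses.valid_sat_code short_clauses.quotient_iff_sat
    by blast
qed

section \<open>Small rational solutions of linear inequalities\<close>

definition lin :: "'i set \<Rightarrow> ('i \<Rightarrow> int) \<Rightarrow> ('i \<Rightarrow> real) \<Rightarrow> real" where
  "lin I a z = (\<Sum>i\<in>I. of_int (a i) * z i)"

definition l1 :: "'i set \<Rightarrow> ('i \<Rightarrow> int) \<Rightarrow> int" where
  "l1 I a = (\<Sum>i\<in>I. \<bar>a i\<bar>)"

definition unit_vec :: "'i \<Rightarrow> 'i \<Rightarrow> int" where
  "unit_vec i k = of_bool (k = i)"

lemma lin_simps:
  "lin I (\<lambda>k. a k + b k) z = lin I a z + lin I b z"
  "lin I (\<lambda>k. a k - b k) z = lin I a z - lin I b z"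
  "lin I (\<lambda>k. - a k) z = - lin I a z"
  "lin I (\<lambda>k. c * a k) z = of_int c * lin I a z"
  "lin I (\<lambda>k. \<Sum>e\<in>E. f e k) z = (\<Sum>e\<in>E. lin I (f e) z)"
proof -
  have "(\<Sum>i\<in>I. of_int (\<Sum>e\<in>E. f e i) * z i) = (\<Sum>i\<in>I. \<Sum>e\<in>E. of_int (f e i) * z i)"
    by (simp add: sum_distrib_right)
  then show "lin I (\<lambda>k. \<Sum>e\<in>E. f e k) z = (\<Sum>e\<in>E. lin I (f e) z)"
    unfolding lin_def by (simp add: sum.swap[of _ E I])
qed (simp_all add: lin_def algebra_simps sum.distrib sum_subtractf sum_negf sum_distrib_left)

lemma lin_unit_vec: "finite I \<Longrightarrow> i \<in> I \<Longrightarrow> lin I (unit_vec i) z = z i"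
proof -
  assume "finite I" "i \<in> I"
  then have "(\<Sum>k\<in>I. of_int (unit_vec i k) * z k) = (\<Sum>k\<in>{i}. of_int (unit_vec i k) * z k)"
    by (intro sum.mono_neutral_right) (auto simp: unit_vec_def)
  then show ?thesis by (simp add: lin_def unit_vec_def)
qed

lemma l1_add: "l1 I (\<lambda>k. a k + b k) \<le> l1 I a + l1 I b"
  unfolding l1_def sum.distrib[symmetric] by (intro sum_mono abs_triangle_ineq)

lemma l1_diff: "l1 I (\<lambda>k. a k - b k) \<le> l1 I a + l1 I b"
  unfolding l1_def sum.distrib[symmetric] by (intro sum_mono abs_triangle_ineq4)

lemma l1_neg [simp]: "l1 I (\<lambda>k. - a k) = l1 I a"
  by (simp add: l1_def)

lemma l1_mult: "l1 I (\<lambda>k. c * a k) = \<bar>c\<bar> * l1 I a"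
  by (simp add: l1_def abs_mult sum_distrib_left)

lemma l1_sum: "l1 I (\<lambda>k. \<Sum>e\<in>E. f e k) \<le> (\<Sum>e\<in>E. l1 I (f e))"
proof -
  have "l1 I (\<lambda>k. \<Sum>e\<in>E. f e k) \<le> (\<Sum>i\<in>I. \<Sum>e\<in>E. \<bar>f e i\<bar>)"
    unfolding l1_def by (intro sum_mono sum_abs)
  also have "\<dots> = (\<Sum>e\<in>E. l1 I (f e))" unfolding l1_def by (rule sum.swap)
  finally show ?thesis .
qed

lemma l1_unit_vec: "finite I \<Longrightarrow> l1 I (unit_vec i) \<le> 1"
proof -
  assume "finite I"
  then have "(\<Sum>k\<in>I. \<bar>unit_vec i k\<bar>) = (\<Sum>k\<in>I \<inter> {i}. \<bar>unit_vec i k\<bar>)"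
    by (intro sum.mono_neutral_right) (auto simp: unit_vec_def)
  also have "\<dots> \<le> 1" by (cases "i \<in> I") (auto simp: unit_vec_def)
  finally show ?thesis by (simp add: l1_def)
qed

text \<open>Simultaneous approximation with an error below the reciprocal of the \<open>\<ell>\<^sub>1\<close>-norms keeps every
  integral inequality and every integral equation: both sides are integers less than \<open>1\<close> apart.\<close>

lemma dirichlet_feasible:
  assumes I: "finite I"
    and B: "\<And>a b. (a, b) \<in> C \<Longrightarrow> l1 I a \<le> int B"
    and z: "\<And>a b. (a, b) \<in> C \<Longrightarrow> lin I a z \<le> of_int b"
  obtains q p where "0 < q" "q \<le> int ((B + 1) ^ card I)"
    "\<And>a b. (a, b) \<in> C \<Longrightarrow> lin I a (\<lambda>i. of_int (p i)) \<le> of_int (q * b)"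
    "\<And>a b. (a, b) \<in> C \<Longrightarrow> lin I a z = of_int b \<Longrightarrow> lin I a (\<lambda>i. of_int (p i)) = of_int (q * b)"
proof -
  obtain h where h: "bij_betw h I {0..<card I}" using ex_bij_betw_finite_nat[OF I] by blast
  obtain q r where q: "0 < q" "q \<le> int ((B + 1) ^ card I)"
    and r: "\<And>i. i < card I \<Longrightarrow> \<bar>of_int q * z (inv_into I h i) - of_int (r i)\<bar> < 1 / real (B + 1)"
    using Dirichlet_approx_simult[of "B + 1" "card I" "\<lambda>i. z (inv_into I h i)"] by auto
  define p where "p i = r (h i)" for i
  have p: "\<bar>of_int (p i) - of_int q * z i\<bar> \<le> 1 / real (B + 1)" if "i \<in> I" for i
  proof -
    have "h i < card I" "inv_into I h (h i) = i"
      using h that bij_betw_inv_into_left by (fastforce simp: bij_betw_def)+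
    then show ?thesis using r[of "h i"] by (simp add: p_def abs_minus_commute)
  qed
  have close: "\<bar>lin I a (\<lambda>i. of_int (p i)) - of_int q * lin I a z\<bar> < 1" if ab: "(a, b) \<in> C" for a b
  proof -
    have "lin I a (\<lambda>i. of_int (p i)) - of_int q * lin I a z = (\<Sum>i\<in>I. of_int (a i) * (of_int (p i) - of_int q * z i))"
      by (simp add: lin_def sum_distrib_left sum_subtractf[symmetric] algebra_simps)
    also have "\<bar>\<dots>\<bar> \<le> (\<Sum>i\<in>I. \<bar>of_int (a i) * (of_int (p i) - of_int q * z i)\<bar>)" by (rule sum_abs)
    also have "\<dots> \<le> (\<Sum>i\<in>I. of_int \<bar>a i\<bar> * (1 / real (B + 1)))"
      unfolding abs_mult by (intro sum_mono mult_mono) (use p in auto)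
    also have "\<dots> = of_int (l1 I a) / real (B + 1)"
      by (simp add: l1_def sum_divide_distrib)
    also have "\<dots> \<le> real B / real (B + 1)"
    proof (rule divide_right_mono)
      show "of_int (l1 I a) \<le> real B" using B[OF ab] by linarith
    qed simp
    also have "\<dots> < 1" by simp
    finally show ?thesis .
  qed
  have int_lin: "lin I a (\<lambda>i. of_int (p i)) = of_int (\<Sum>i\<in>I. a i * p i)" for a
    by (simp add: lin_def)
  show thesis
  proof (rule that[OF q, of p])
    fix a b assume ab: "(a, b) \<in> C"
    have "of_int q * lin I a z \<le> of_int q * of_int b"
      using z[OF ab] q(1) by (intro mult_left_mono) auto
    then have "lin I a (\<lambda>i. of_int (p i)) < of_int (q * b + 1)" using close[OF ab] by simp
    then show "lin I a (\<lambda>i. of_int (p i)) \<le> of_int (q * b)"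
      unfolding int_lin of_int_less_iff of_int_le_iff by simp
    assume "lin I a z = of_int b"
    then have "\<bar>lin I a (\<lambda>i. of_int (p i)) - of_int (q * b)\<bar> < 1" using close[OF ab] by simp
    then show "lin I a (\<lambda>i. of_int (p i)) = of_int (q * b)"
      unfolding int_lin of_int_diff[symmetric] of_int_abs[symmetric] by (simp only: of_int_less_1_iff of_int_eq_iff)
  qed
qed

text \<open>To keep a coordinate positive, approximate a solution with as many tight constraints as
  possible: were the coordinate of the approximation \<open>p / q\<close> not positive, moving away from \<open>p / q\<close>
  would increase the coordinate and preserve all tight constraints until another one becomes tight.\<close>

lemma small_solution:
  assumes I: "finite I" and C: "finite C"
    and B: "\<And>a b. (a, b) \<in> C \<Longrightarrow> l1 I a \<le> int B"
    and z: "\<And>a b. (a, b) \<in> C \<Longrightarrow> lin I a z \<le> of_int b"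
    and e: "e \<in> I" "(unit_vec e, 1) \<in> C" "0 < z e"
  obtains q p where "0 < q" "q \<le> int ((B + 1) ^ card I)" "0 < p e"
    "\<And>a b. (a, b) \<in> C \<Longrightarrow> lin I a (\<lambda>i. of_int (p i)) \<le> of_int (q * b)"
proof -
  define feas where "feas z \<longleftrightarrow> (\<forall>(a, b)\<in>C. lin I a z \<le> of_int b) \<and> 0 < z e" for z
  define tight where "tight z = {(a, b). (a, b) \<in> C \<and> lin I a z = of_int b}" for z
  have fin_tight: "finite (tight z)" "card (tight z) \<le> card C" for z
    using C by (auto simp: tight_def intro: finite_subset[of _ C] card_mono)
  have "feas z" using z e by (auto simp: feas_def)
  then obtain y where y: "feas y" and max: "\<And>y'. feas y' \<Longrightarrow> card (tight y') \<le> card (tight y)"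
    using ex_has_greatest_nat[of feas z "\<lambda>z. card (tight z)" "Suc (card C)"] fin_tight(2)
    by (auto simp: less_Suc_eq_le)
  have y_le: "lin I a y \<le> of_int b" if "(a, b) \<in> C" for a b using y that by (auto simp: feas_def)
  obtain q p where q: "0 < q" "q \<le> int ((B + 1) ^ card I)"
    and p: "\<And>a b. (a, b) \<in> C \<Longrightarrow> lin I a (\<lambda>i. of_int (p i)) \<le> of_int (q * b)"
    and pt: "\<And>a b. (a, b) \<in> C \<Longrightarrow> lin I a y = of_int b \<Longrightarrow> lin I a (\<lambda>i. of_int (p i)) = of_int (q * b)"
    by (rule dirichlet_feasible[of I C B y], rule I, erule B, erule y_le, rule that)
  have "0 < p e"
  proof (rule ccontr)
    assume "\<not> 0 < p e"
    define r :: "'a \<Rightarrow> real" where "r i = of_int (p i) / of_int q" for i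
    have lin_r: "lin I a r = lin I a (\<lambda>i. of_int (p i)) / of_int q" for a
      by (simp add: lin_def r_def sum_divide_distrib)
    have r_le: "lin I a r \<le> of_int b" if "(a, b) \<in> C" for a b
      using p[OF that] q(1) by (simp add: lin_r divide_le_eq mult.commute)
    have r_tight: "lin I a r = of_int b" if "(a, b) \<in> C" "lin I a y = of_int b" for a b
      using pt[OF that] q(1) by (simp add: lin_r)
    have re: "r e \<le> 0" using \<open>\<not> 0 < p e\<close> q(1) by (simp add: r_def divide_le_0_iff)
    have ye: "0 < y e" using y by (simp add: feas_def)
    define U where "U = {(a, b). (a, b) \<in> C \<and> lin I a r < lin I a y}"
    define f where "f = (\<lambda>(a, b). (of_int b - lin I a y) / (lin I a y - lin I a r))"
    \<comment> \<open>The motion increases coordinate \<open>e\<close>, so its bound 1, which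
      belongs to \<open>C\<close>, is among the constraints that get tighter; in particular
      \<open>U\<close> is not empty.\<close>
    have U: "finite U" "(unit_vec e, 1) \<in> U"
      using C re ye e(2) lin_unit_vec[OF I e(1)] by (auto simp: U_def intro: finite_subset[of _ C])
    \<comment> \<open>The smallest step at which one of the constraints in \<open>U\<close> becomes
      an equality.\<close>
    define \<eta> where "\<eta> = Min (f ` U)"
    have "\<eta> \<in> f ` U" unfolding \<eta>_def using U by (intro Min_in) auto
    then obtain a0 b0 where ab0: "(a0, b0) \<in> U" "\<eta> = f (a0, b0)" by auto
    have \<eta>_le: "\<eta> \<le> f (a, b)" if "(a, b) \<in> U" for a b
      unfolding \<eta>_def using U(1) that by (intro Min_le) auto
    have pos: "0 \<le> f (a, b)" if "(a, b) \<in> U" for a b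
      using that y_le[of a b] by (auto simp: f_def U_def)
    then have \<eta>0: "0 \<le> \<eta>" using ab0 by simp
    define y' where "y' i = y i + \<eta> * (y i - r i)" for i
    have lin_y': "lin I a y' = lin I a y + \<eta> * (lin I a y - lin I a r)" for a
      by (simp add: lin_def y'_def algebra_simps sum.distrib sum_subtractf sum_distrib_left)
    have "lin I a y' \<le> of_int b" if ab: "(a, b) \<in> C" for a b
    proof (cases "lin I a r < lin I a y")
      case True
      then have "\<eta> * (lin I a y - lin I a r) \<le> f (a, b) * (lin I a y - lin I a r)"
        using \<eta>_le[of a b] ab by (intro mult_right_mono) (auto simp: U_def)
      also have "\<dots> = of_int b - lin I a y" using True by (simp add: f_def)
      finally show ?thesis by (simp add: lin_y')
    next
      case False
      then have "\<eta> * (lin I a y - lin I a r) \<le> 0" using \<eta>0 by (intro mult_nonneg_nonpos) auto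
      then show ?thesis using y_le[OF ab] by (simp add: lin_y')
    qed
    moreover have "0 < y' e"
    proof -
      have "0 \<le> \<eta> * (y e - r e)" using \<eta>0 re ye by (intro mult_nonneg_nonneg) auto
      then show ?thesis using ye by (simp add: y'_def)
    qed
    ultimately have "feas y'" by (auto simp: feas_def)
    moreover have "tight y \<subseteq> tight y'"
      using r_tight by (auto simp: tight_def lin_y')
    moreover have "(a0, b0) \<in> tight y'"
      using ab0 by (auto simp: tight_def lin_y' f_def U_def)
    moreover have "(a0, b0) \<notin> tight y"
      using ab0(1) r_tight by (auto simp: tight_def U_def)
    ultimately show False
      using max[of y'] psubset_card_mono[OF fin_tight(1)[of y'], of "tight y"] by force
  qed
  then show thesis by (rule that[OF q _ p])
qed

lemma finite_min_gap:
  assumes "finite G" "\<And>g. g \<in> G \<Longrightarrow> 0 < (g :: real)"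
  obtains \<delta> where "0 < \<delta>" "\<delta> \<le> 1" "\<And>g. g \<in> G \<Longrightarrow> \<delta> \<le> g"
proof
  let ?m = "Min (insert 1 G)"
  show "0 < ?m" using assms by simp
  show "?m \<le> 1" using assms(1) by simp
  show "?m \<le> g" if "g \<in> G" for g using assms(1) that by simp
qed

lemma finite_family:
  "finite {g E s t | E s t. E \<subseteq> {..<n} \<and> s < (n :: nat) \<and> t < n \<and> P E s t}"
proof (rule finite_subset)
  show "{g E s t | E s t. E \<subseteq> {..<n} \<and> s < n \<and> t < n \<and> P E s t}
      \<subseteq> (\<Union>E\<in>Pow {..<n}. {g E s t | s t. s \<in> {..<n} \<and> t \<in> {..<n}})" by blast
  show "finite (\<Union>E\<in>Pow {..<n}. {g E s t | s t. s \<in> {..<n} \<and> t \<in> {..<n}})"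
    by (intro finite_UN_I finite_image_set2) simp_all
qed

text \<open>The unknowns are the entries \<open>(0, s, t)\<close> of the new chain, upper bounds
  \<open>(1, s, t)\<close> on \<open>\<bar>D * x - m s t\<bar>\<close> for the entry x, and one gap
  \<open>(2, 0, 0)\<close>. Their number is the exponent in the bound on \<open>q\<close>; the base
  is one more than a bound on the l1 norms of the coefficients. A positive gap ensures that unequal
  masses stay unequal.\<close>

theorem small_perturbation:
  fixes \<tau> :: "nat \<Rightarrow> nat \<Rightarrow> real" and m :: "nat \<Rightarrow> nat \<Rightarrow> nat" and D e1 e2 n :: nat
  assumes D: "0 < D" and e2: "0 < e2"
    and distr: "\<And>s. s < n \<Longrightarrow> is_distr {..<n} (\<tau> s)"
    and near: "\<And>s. s < n \<Longrightarrow> (\<Sum>t<n. \<bar>\<tau> s t - real (m s t) / real D\<bar>) \<le> real e1 / real e2"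
  obtains q :: nat and p :: "nat \<Rightarrow> nat \<Rightarrow> nat"
  where "0 < q" "q \<le> (D + e2 * n + 2 * n + 3) ^ (2 * n * n + 1)"
    "\<And>s. s < n \<Longrightarrow> (\<Sum>t<n. p s t) = q"
    "\<And>s. s < n \<Longrightarrow> real e2 * (\<Sum>t<n. \<bar>real D * real (p s t) - real q * real (m s t)\<bar>) \<le> real q * real e1 * real D"
    "\<And>E s t. E \<subseteq> {..<n} \<Longrightarrow> s < n \<Longrightarrow> t < n \<Longrightarrow>
       (\<Sum>u\<in>E. p s u) = (\<Sum>u\<in>E. p t u) \<longleftrightarrow> (\<Sum>u\<in>E. \<tau> s u) = (\<Sum>u\<in>E. \<tau> t u)"
proof -
  let ?x = "\<lambda>s t. (0, s, t) :: nat \<times> nat \<times> nat" and ?y = "\<lambda>s t. (1, s, t) :: nat \<times> nat \<times> nat"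
  let ?e = "(2, 0, 0) :: nat \<times> nat \<times> nat"
  define I where "I = insert ?e ({0, 1} \<times> {..<n} \<times> {..<n})"
  have I: "finite I" by (simp add: I_def)
  have card: "card I = 2 * n * n + 1" by (simp add: I_def)
  have x: "?x s t \<in> I" "?y s t \<in> I" if "s < n" "t < n" for s t using that by (auto simp: I_def)
  have e: "?e \<in> I" by (simp add: I_def)
  let ?u = unit_vec
  let ?dif = "\<lambda>E s t k. (\<Sum>v\<in>E. ?u (?x s v) k) - (\<Sum>v\<in>E. ?u (?x t v) k)"
  \<comment> \<open>In this order: entries are nonnegative, rows sum to 1, both halves of the
    absolute value, the distance bound multiplied by \<open>e2 * D\<close>, the weak and the strict
    order of the masses on every \<open>E\<close>, and the upper bound of the gap. A strict
    inequality is made weak by adding the gap to its smaller side.\<close>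
  define C where "C =
    {(\<lambda>k. - ?u (?x s t) k, 0) | s t. s < n \<and> t < n} \<union>
    {(\<lambda>k. \<Sum>t<n. ?u (?x s t) k, 1) | s. s < n} \<union>
    {(\<lambda>k. - (\<Sum>t<n. ?u (?x s t) k), - 1) | s. s < n} \<union>
    {(\<lambda>k. int D * ?u (?x s t) k - ?u (?y s t) k, int (m s t)) | s t. s < n \<and> t < n} \<union>
    {(\<lambda>k. - (int D * ?u (?x s t) k) - ?u (?y s t) k, - int (m s t)) | s t. s < n \<and> t < n} \<union>
    {(\<lambda>k. int e2 * (\<Sum>t<n. ?u (?y s t) k), int (e1 * D)) | s. s < n} \<union>
    {(?dif E s t, 0) | E s t. E \<subseteq> {..<n} \<and> s < n \<and> t < n \<and> (\<Sum>v\<in>E. \<tau> s v) \<le> (\<Sum>v\<in>E. \<tau> t v)} \<union>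
    {(\<lambda>k. ?dif E s t k + ?u ?e k, 0) | E s t. E \<subseteq> {..<n} \<and> s < n \<and> t < n \<and> (\<Sum>v\<in>E. \<tau> s v) < (\<Sum>v\<in>E. \<tau> t v)} \<union>
    {(?u ?e, 1)}"
  have C_E: P if "(a, b) \<in> C"
    "\<And>s t. s < n \<Longrightarrow> t < n \<Longrightarrow> a = (\<lambda>k. - ?u (?x s t) k) \<Longrightarrow> b = 0 \<Longrightarrow> P"
    "\<And>s. s < n \<Longrightarrow> a = (\<lambda>k. \<Sum>t<n. ?u (?x s t) k) \<Longrightarrow> b = 1 \<Longrightarrow> P"
    "\<And>s. s < n \<Longrightarrow> a = (\<lambda>k. - (\<Sum>t<n. ?u (?x s t) k)) \<Longrightarrow> b = - 1 \<Longrightarrow> P"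
    "\<And>s t. s < n \<Longrightarrow> t < n \<Longrightarrow> a = (\<lambda>k. int D * ?u (?x s t) k - ?u (?y s t) k) \<Longrightarrow> b = int (m s t) \<Longrightarrow> P"
    "\<And>s t. s < n \<Longrightarrow> t < n \<Longrightarrow> a = (\<lambda>k. - (int D * ?u (?x s t) k) - ?u (?y s t) k) \<Longrightarrow> b = - int (m s t) \<Longrightarrow> P"
    "\<And>s. s < n \<Longrightarrow> a = (\<lambda>k. int e2 * (\<Sum>t<n. ?u (?y s t) k)) \<Longrightarrow> b = int (e1 * D) \<Longrightarrow> P"
    "\<And>E s t. E \<subseteq> {..<n} \<Longrightarrow> s < n \<Longrightarrow> t < n \<Longrightarrow> (\<Sum>v\<in>E. \<tau> s v) \<le> (\<Sum>v\<in>E. \<tau> t v) \<Longrightarrow>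
       a = ?dif E s t \<Longrightarrow> b = 0 \<Longrightarrow> P"
    "\<And>E s t. E \<subseteq> {..<n} \<Longrightarrow> s < n \<Longrightarrow> t < n \<Longrightarrow> (\<Sum>v\<in>E. \<tau> s v) < (\<Sum>v\<in>E. \<tau> t v) \<Longrightarrow>
       a = (\<lambda>k. ?dif E s t k + ?u ?e k) \<Longrightarrow> b = 0 \<Longrightarrow> P"
    "a = ?u ?e \<Longrightarrow> b = 1 \<Longrightarrow> P" for P a b
    using that(1) unfolding C_def
    apply (elim UnE)
            apply (use that(2) in blast)
           apply (use that(3) in blast)
          apply (use that(4) in blast)
         apply (use that(5) in blast)
        apply (use that(6) in blast)
       apply (use that(7) in blast)
      apply (use that(8) in blast)
     apply (use that(9) in blast)
    apply (use that(10) in blast)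
    done
  have C: "finite C"
    unfolding C_def by (intro finite_UnI finite_family finite_image_set2 finite_image_set) simp_all
  define G where "G = {(\<Sum>v\<in>E. \<tau> t v) - (\<Sum>v\<in>E. \<tau> s v) | E s t.
    E \<subseteq> {..<n} \<and> s < n \<and> t < n \<and> (\<Sum>v\<in>E. \<tau> s v) < (\<Sum>v\<in>E. \<tau> t v)}"
  have "finite G" "\<And>g. g \<in> G \<Longrightarrow> 0 < g" unfolding G_def by (rule finite_family) auto
  then obtain \<delta> where \<delta>: "0 < \<delta>" "\<delta> \<le> 1" "\<And>g. g \<in> G \<Longrightarrow> \<delta> \<le> g" using finite_min_gap by metis
  define z where "z = (\<lambda>(k, s, t). if k = 0 then \<tau> s t else if k = (1 :: nat) then \<bar>real D * \<tau> s t - real (m s t)\<bar> else \<delta>)"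
  have lx: "lin I (?u (?x s t)) w = w (?x s t)" "lin I (?u (?y s t)) w = w (?y s t)" if "s < n" "t < n" for s t w
    using lin_unit_vec[OF I] x[OF that] by auto
  have le: "lin I (?u ?e) w = w ?e" for w using lin_unit_vec[OF I e] .
  have sx: "(\<Sum>v\<in>E. lin I (?u (?x s v)) w) = (\<Sum>v\<in>E. w (?x s v))" "(\<Sum>v\<in>E. lin I (?u (?y s v)) w) = (\<Sum>v\<in>E. w (?y s v))"
    if "E \<subseteq> {..<n}" "s < n" for E s w
    using that by (auto intro!: sum.cong lx lx[unfolded One_nat_def])
  note sxn = sx[of "{..<n}", OF order_refl]
  have z_le: "lin I a z \<le> of_int b" if "(a, b) \<in> C" for a b
  proof -
    have dist: "(\<Sum>t<n. \<bar>real D * \<tau> s t - real (m s t)\<bar>) = real D * (\<Sum>t<n. \<bar>\<tau> s t - real (m s t) / real D\<bar>)" for s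
    proof -
      have "\<bar>real D * \<tau> s t - real (m s t)\<bar> = real D * \<bar>\<tau> s t - real (m s t) / real D\<bar>" for t
      proof -
        have "real D * \<tau> s t - real (m s t) = real D * (\<tau> s t - real (m s t) / real D)"
          using D by (simp add: right_diff_distrib)
        then show ?thesis by (simp add: abs_mult)
      qed
      then show ?thesis by (simp add: sum_distrib_left)
    qed
    have near_D: "real e2 * (\<Sum>t<n. \<bar>real D * \<tau> s t - real (m s t)\<bar>) \<le> real e1 * real D" if "s < n" for s
    proof -
      have "real e2 * (real D * (\<Sum>t<n. \<bar>\<tau> s t - real (m s t) / real D\<bar>)) \<le> real e2 * (real D * (real e1 / real e2))"
        using near[OF that] by (intro mult_left_mono) auto
      then show ?thesis using e2 by (simp add: dist mult.commute)
    qed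
    have "\<delta> \<le> (\<Sum>v\<in>E. \<tau> t v) - (\<Sum>v\<in>E. \<tau> s v)"
      if "E \<subseteq> {..<n}" "s < n" "t < n" "(\<Sum>v\<in>E. \<tau> s v) < (\<Sum>v\<in>E. \<tau> t v)" for E s t
      by (rule \<delta>(3)) (use that in \<open>auto simp only: G_def\<close>)
    note gap = this
    from that show ?thesis
    proof (cases rule: C_E[consumes 1])
      case (1 s t)
      then show ?thesis using distr[of s] by (simp add: lin_simps lx z_def is_distr_def)
    next
      case (2 s)
      then show ?thesis using distr[of s] by (simp add: lin_simps sxn z_def is_distr_def)
    next
      case (3 s)
      then show ?thesis using distr[of s] by (simp add: lin_simps sxn z_def is_distr_def)
    next
      case (4 s t)
      then show ?thesis by (simp add: lin_simps lx[unfolded One_nat_def] z_def)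
    next
      case (5 s t)
      then show ?thesis by (simp add: lin_simps lx[unfolded One_nat_def] z_def)
    next
      case (6 s)
      then show ?thesis using near_D[of s] by (simp add: lin_simps sxn[unfolded One_nat_def] z_def)
    next
      case (7 E s t)
      then show ?thesis by (simp add: lin_simps sx z_def)
    next
      case (8 E s t)
      then show ?thesis using gap[of E s t] by (simp add: lin_simps sx le z_def)
    next
      case 9
      then show ?thesis using \<delta>(2) by (simp add: le z_def)
    qed
  qed
  have B: "l1 I a \<le> int (D + e2 * n + 2 * n + 2)" if "(a, b) \<in> C" for a b
  proof -
    have u: "l1 I (?u i) \<le> 1" for i by (rule l1_unit_vec[OF I])
    have s: "l1 I (\<lambda>k. \<Sum>v\<in>E. ?u (f v) k) \<le> int n" if "E \<subseteq> {..<n}" for E :: "nat set" and f :: "nat \<Rightarrow> nat \<times> nat \<times> nat"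
    proof -
      have "l1 I (\<lambda>k. \<Sum>v\<in>E. ?u (f v) k) \<le> (\<Sum>v\<in>E. l1 I (?u (f v)))" by (rule l1_sum)
      also have "\<dots> \<le> (\<Sum>v\<in>E. 1)" by (rule sum_mono, rule u)
      also have "\<dots> \<le> int n" using card_mono[OF finite_lessThan that] by simp
      finally show ?thesis .
    qed
    note sn = s[of "{..<n}", OF order_refl]
    have d: "l1 I (?dif E s t) \<le> 2 * int n" if "E \<subseteq> {..<n}" for E s t
      using l1_diff[of I "\<lambda>k. \<Sum>v\<in>E. ?u (?x s v) k" "\<lambda>k. \<Sum>v\<in>E. ?u (?x t v) k"] s[OF that, of "?x s"] s[OF that, of "?x t"]
      by linarith
    have d': "l1 I (\<lambda>k. ?dif E s t k + ?u ?e k) \<le> 2 * int n + 1" if "E \<subseteq> {..<n}" for E s t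
      using l1_add[of I "?dif E s t" "?u ?e"] d[OF that, of s t] u[of ?e] by linarith
    have m: "l1 I (\<lambda>k. int D * ?u i k) \<le> int D" for i
      using u[of i] by (simp add: l1_mult mult_left_le)
    have dm: "l1 I (\<lambda>k. int D * ?u i k - ?u j k) \<le> int D + 1" "l1 I (\<lambda>k. - (int D * ?u i k) - ?u j k) \<le> int D + 1" for i j
      using l1_diff[of I "\<lambda>k. int D * ?u i k" "?u j"] l1_diff[of I "\<lambda>k. - (int D * ?u i k)" "?u j"] m[of i] u[of j]
      by simp_all
    have em: "l1 I (\<lambda>k. int e2 * (\<Sum>t<n. ?u (?y s t) k)) \<le> int e2 * int n" for s
      using sn[of "?y s"] by (simp add: l1_mult mult_left_mono)
    define bb where "bb = int (D + e2 * n + 2 * n + 2)"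
    have nonneg: "0 \<le> int D" "0 \<le> int n" "0 \<le> int e2 * int n" by simp_all
    have bb_eq: "bb = int D + int e2 * int n + 2 * int n + 2" by (simp add: bb_def)
    have le: "1 \<le> bb" "int n \<le> bb" "int D + 1 \<le> bb" "int e2 * int n \<le> bb" "2 * int n \<le> bb" "2 * int n + 1 \<le> bb"
      unfolding bb_eq using nonneg by linarith+
    from that have "l1 I a \<le> bb"
    proof (cases rule: C_E[consumes 1])
      case (1 s t) with u[of "?x s t"] le show "l1 I a \<le> bb" by simp
    next
      case (2 s) with sn[of "?x s"] le show "l1 I a \<le> bb" by simp
    next
      case (3 s) with sn[of "?x s"] le show "l1 I a \<le> bb" by simp
    next
      case (4 s t) with dm(1)[of "?x s t" "?y s t"] le show "l1 I a \<le> bb" by simp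
    next
      case (5 s t) with dm(2)[of "?x s t" "?y s t"] le show "l1 I a \<le> bb" by simp
    next
      case (6 s) with em[of s] le show "l1 I a \<le> bb" by simp
    next
      case (7 E s t) with d[of E s t] le show "l1 I a \<le> bb" by simp
    next
      case (8 E s t) with d'[of E s t] le show "l1 I a \<le> bb" by simp
    next
      case 9 with u[of ?e] le show "l1 I a \<le> bb" by simp
    qed
    then show ?thesis unfolding bb_def .
  qed
  have "(unit_vec ?e, 1) \<in> C" "0 < z ?e" using \<delta> by (simp_all add: C_def z_def)
  note pos = this
  obtain q p where q: "0 < q" "q \<le> int ((D + e2 * n + 2 * n + 2 + 1) ^ card I)" and pe: "0 < p ?e"
    and p: "\<And>a b. (a, b) \<in> C \<Longrightarrow> lin I a (\<lambda>i. of_int (p i)) \<le> of_int (q * b)"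
    by (rule small_solution[of I C _ z ?e], rule I, rule C, erule B, erule z_le, rule e, rule pos, rule pos, rule that)
  have nonneg: "0 \<le> p (?x s t)" if "s < n" "t < n" for s t
  proof -
    have "(\<lambda>k. - ?u (?x s t) k, 0) \<in> C" using that unfolding C_def by blast
    from p[OF this] show ?thesis by (simp add: lin_simps lx[OF that])
  qed
  have total: "(\<Sum>t<n. p (?x s t)) = q" if "s < n" for s
  proof -
    have "(\<lambda>k. \<Sum>t<n. ?u (?x s t) k, 1) \<in> C" "(\<lambda>k. - (\<Sum>t<n. ?u (?x s t) k), - 1) \<in> C"
      using that unfolding C_def by blast+
    from p[OF this(1)] p[OF this(2)]
    have "real_of_int (\<Sum>t<n. p (?x s t)) = of_int q"
      by (simp add: lin_simps sxn(1)[OF that])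
    then show ?thesis by linarith
  qed
  have near': "real e2 * (\<Sum>t<n. \<bar>real D * of_int (p (?x s t)) - of_int q * real (m s t)\<bar>) \<le> of_int q * real e1 * real D"
    if s: "s < n" for s
  proof -
    have "\<bar>real D * of_int (p (?x s t)) - of_int q * real (m s t)\<bar> \<le> of_int (p (?y s t))" if "t < n" for t
    proof -
      have "(\<lambda>k. int D * ?u (?x s t) k - ?u (?y s t) k, int (m s t)) \<in> C"
        "(\<lambda>k. - (int D * ?u (?x s t) k) - ?u (?y s t) k, - int (m s t)) \<in> C"
        using s that unfolding C_def by blast+
      from p[OF this(1)] p[OF this(2)] show ?thesis
        by (simp add: lin_simps lx[OF s that, unfolded One_nat_def] abs_le_iff)
    qed
    then have "real e2 * (\<Sum>t<n. \<bar>real D * of_int (p (?x s t)) - of_int q * real (m s t)\<bar>) \<le> real e2 * (\<Sum>t<n. of_int (p (?y s t)))"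
      by (intro mult_left_mono sum_mono) auto
    also have "\<dots> \<le> of_int q * real e1 * real D"
    proof -
      have "(\<lambda>k. int e2 * (\<Sum>t<n. ?u (?y s t) k), int (e1 * D)) \<in> C"
        using s unfolding C_def by blast
      from p[OF this] show ?thesis by (simp add: lin_simps sxn(2)[OF s, unfolded One_nat_def] mult.assoc)
    qed
    finally show ?thesis .
  qed
  have mono: "(\<Sum>v\<in>E. p (?x s v)) \<le> (\<Sum>v\<in>E. p (?x t v))"
    if E: "E \<subseteq> {..<n}" "s < n" "t < n" "(\<Sum>v\<in>E. \<tau> s v) \<le> (\<Sum>v\<in>E. \<tau> t v)" for E s t
  proof -
    have "(?dif E s t, 0) \<in> C" using E unfolding C_def by blast
    from p[OF this] have "real_of_int (\<Sum>v\<in>E. p (?x s v)) \<le> real_of_int (\<Sum>v\<in>E. p (?x t v))"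
      using sx(1)[OF E(1,2)] sx(1)[OF E(1,3)] by (simp add: lin_simps)
    then show ?thesis by linarith
  qed
  have strict: "(\<Sum>v\<in>E. p (?x s v)) < (\<Sum>v\<in>E. p (?x t v))"
    if E: "E \<subseteq> {..<n}" "s < n" "t < n" "(\<Sum>v\<in>E. \<tau> s v) < (\<Sum>v\<in>E. \<tau> t v)" for E s t
  proof -
    have "(\<lambda>k. ?dif E s t k + ?u ?e k, 0) \<in> C" using E unfolding C_def by blast
    from p[OF this] have "real_of_int (\<Sum>v\<in>E. p (?x s v)) + of_int (p ?e) \<le> real_of_int (\<Sum>v\<in>E. p (?x t v))"
      using sx(1)[OF E(1,2)] sx(1)[OF E(1,3)] by (simp add: lin_simps le)
    then show ?thesis using pe by linarith
  qed
  have pattern: "(\<Sum>v\<in>E. p (?x s v)) = (\<Sum>v\<in>E. p (?x t v)) \<longleftrightarrow> (\<Sum>v\<in>E. \<tau> s v) = (\<Sum>v\<in>E. \<tau> t v)"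
    if E: "E \<subseteq> {..<n}" "s < n" "t < n" for E s t
    using mono[OF E] mono[OF E(1,3,2)] strict[OF E] strict[OF E(1,3,2)] by (cases "\<Sum>v\<in>E. \<tau> s v" "\<Sum>v\<in>E. \<tau> t v" rule: linorder_cases) auto
  show thesis
  proof (rule that[of "nat q" "\<lambda>s t. nat (p (?x s t))"])
    show "0 < nat q" using q by simp
    have "nat q \<le> nat (int ((D + e2 * n + 2 * n + 2 + 1) ^ card I))" using q(2) by (rule nat_mono)
    moreover have "D + e2 * n + 2 * n + 2 + 1 = D + e2 * n + 2 * n + 3" by simp
    ultimately show "nat q \<le> (D + e2 * n + 2 * n + 3) ^ (2 * n * n + 1)"
      by (simp only: card nat_int)
    have int_sum: "int (\<Sum>v\<in>E. nat (p (?x s v))) = (\<Sum>v\<in>E. p (?x s v))" if "E \<subseteq> {..<n}" "s < n" for E s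
      unfolding of_nat_sum using that nonneg by (intro sum.cong) auto
    show "(\<Sum>t<n. nat (p (?x s t))) = nat q" if "s < n" for s
    proof -
      have "int (\<Sum>t<n. nat (p (?x s t))) = q"
        using int_sum[OF order_refl that] total[OF that] by (simp only:)
      then show ?thesis by (metis nat_int)
    qed
    show "real e2 * (\<Sum>t<n. \<bar>real D * real (nat (p (?x s t))) - real (nat q) * real (m s t)\<bar>) \<le> real (nat q) * real e1 * real D"
      if "s < n" for s
      using near'[OF that] nonneg[OF that] q(1) by simp
    show "(\<Sum>u\<in>E. nat (p (?x s u))) = (\<Sum>u\<in>E. nat (p (?x t u))) \<longleftrightarrow> (\<Sum>u\<in>E. \<tau> s u) = (\<Sum>u\<in>E. \<tau> t u)"
      if E: "E \<subseteq> {..<n}" "s < n" "t < n" for E s t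
      using pattern[OF E] int_sum[OF E(1,2)] int_sum[OF E(1,3)] by (metis of_nat_eq_iff)
  qed
qed

section \<open>Computing bisimilarity by partition refinement\<close>

text \<open>Each class is counted at its least member, which a program recognises by comparing
  indices.\<close>

lemma card_quotient_least:
  assumes "equiv {..<n :: nat} B"
  shows "card ({..<n} // B) = card {s. s < n \<and> (\<forall>t<n. (t, s) \<in> B \<longrightarrow> s \<le> t)}"
proof (rule bij_betw_same_card[of "\<lambda>s. B `` {s}", symmetric], rule bij_betw_imageI)
  have refl: "(s, s) \<in> B" if "s < n" for s using assms that by (simp add: equiv_def refl_on_def)
  have sub: "s < n \<and> t < n" if "(s, t) \<in> B" for s t using equiv_type[OF assms] that by blast
  have sym: "(t, s) \<in> B" if "(s, t) \<in> B" for s t using assms that by (meson equiv_def symD)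
  show "inj_on (\<lambda>s. B `` {s}) {s. s < n \<and> (\<forall>t<n. (t, s) \<in> B \<longrightarrow> s \<le> t)}"
  proof (rule inj_onI, clarify)
    fix s t assume s: "s < n" "\<forall>u<n. (u, s) \<in> B \<longrightarrow> s \<le> u" and t: "t < n" "\<forall>u<n. (u, t) \<in> B \<longrightarrow> t \<le> u"
      and "B `` {s} = B `` {t}"
    then have "(s, t) \<in> B" using refl by blast
    then show "s = t" using s t sym by (meson le_antisym)
  qed
  show "(\<lambda>s. B `` {s}) ` {s. s < n \<and> (\<forall>t<n. (t, s) \<in> B \<longrightarrow> s \<le> t)} = {..<n} // B"
  proof
    show "(\<lambda>s. B `` {s}) ` {s. s < n \<and> (\<forall>t<n. (t, s) \<in> B \<longrightarrow> s \<le> t)} \<subseteq> {..<n} // B"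
      by (auto intro: quotientI)
    show "{..<n} // B \<subseteq> (\<lambda>s. B `` {s}) ` {s. s < n \<and> (\<forall>t<n. (t, s) \<in> B \<longrightarrow> s \<le> t)}"
    proof
      fix E assume "E \<in> {..<n} // B"
      then obtain u where u: "u < n" "E = B `` {u}" by (auto elim: quotientE)
      define s where "s = (LEAST s. (s, u) \<in> B)"
      have s: "(s, u) \<in> B" unfolding s_def by (rule LeastI[of _ u]) (rule refl[OF u(1)])
      have "s \<le> t" if "(t, s) \<in> B" for t
      proof -
        have "(t, u) \<in> B" using that s assms by (meson equiv_def transE)
        then show ?thesis unfolding s_def by (rule Least_le)
      qed
      moreover have "E = B `` {s}" using equiv_class_eq[OF assms s] u(2) by simp
      ultimately show "E \<in> (\<lambda>s. B `` {s}) ` {s. s < n \<and> (\<forall>t<n. (t, s) \<in> B \<longrightarrow> s \<le> t)}"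
        using sub[OF s] by blast
    qed
  qed
qed

definition refine_rel :: "('s, 'l) lmc \<Rightarrow> ('s \<times> 's) set \<Rightarrow> ('s \<times> 's) set" where
  "refine_rel N r = {(s, t). (s, t) \<in> r \<and>
     (\<forall>v\<in>states N. (\<Sum>u\<in>r `` {v}. prob N s u) = (\<Sum>u\<in>r `` {v}. prob N t u))}"

lemma equiv_refine_rel:
  assumes "equiv (states N) r"
  shows "equiv (states N) (refine_rel N r)"
proof (rule equivI)
  show "refine_rel N r \<subseteq> states N \<times> states N" using equiv_type[OF assms] by (auto simp: refine_rel_def)
  show "refl_on (states N) (refine_rel N r)"
    using assms by (auto simp: refine_rel_def refl_on_def equiv_def)
  show "sym (refine_rel N r)"
    using assms unfolding sym_def refine_rel_def equiv_def by fastforce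
  show "trans (refine_rel N r)"
    using assms unfolding trans_def refine_rel_def equiv_def by fastforce
qed

text \<open>Every class of the coarser relation \<open>r\<close> is a union of classes of
  \<open>Q\<close>, on which related states already have equal mass. So refinement never separates
  bisimilar states.\<close>

lemma bisimulation_subset_refine_rel:
  assumes "finite (states N)" "equiv (states N) r" "prob_bisimulation N Q" "Q \<subseteq> r"
  shows "Q \<subseteq> refine_rel N r"
proof clarify
  fix s t assume st: "(s, t) \<in> Q"
  have Q: "equiv (states N) Q" "\<And>E. E \<in> states N // Q \<Longrightarrow> (\<Sum>u\<in>E. prob N s u) = (\<Sum>u\<in>E. prob N t u)"
    using assms(3) st by (auto simp: prob_bisimulation_def)
  have "(\<Sum>u\<in>r `` {v}. prob N s u) = (\<Sum>u\<in>r `` {v}. prob N t u)" if "v \<in> states N" for v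
    using sum_coarser_class[OF assms(1) Q(1) assms(2,4) quotientI[OF that] Q(2)] by simp
  then show "(s, t) \<in> refine_rel N r" using st assms(4) by (auto simp: refine_rel_def)
qed

lemma bisimulation_if_refine_rel_fixed:
  assumes "equiv (states N) r" "refine_rel N r = r" "\<And>s t. (s, t) \<in> r \<Longrightarrow> label N s = label N t"
  shows "prob_bisimulation N r"
proof -
  have "(\<Sum>u\<in>E. prob N s u) = (\<Sum>u\<in>E. prob N t u)" if st: "(s, t) \<in> r" and E: "E \<in> states N // r" for s t E
  proof -
    obtain v where "v \<in> states N" "E = r `` {v}" using E by (rule quotientE)
    moreover have "(s, t) \<in> refine_rel N r" using st assms(2) by simp
    ultimately show ?thesis by (simp add: refine_rel_def)
  qed
  then show ?thesis using assms unfolding prob_bisimulation_def by blast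
qed

lemma length_filter_neq: "filter P xs \<noteq> xs \<Longrightarrow> length (filter P xs) < length xs"
  by (induction xs) (auto simp: le_imp_less_Suc split: if_splits)

text \<open>Index, label and row of transition weights of a state.\<close>

type_synonym tagged_state = "nat \<times> nat \<times> nat list"

text \<open>Each state carries its own label and row, so the program never has to look up a list
  entry by a binary index.\<close>

definition tagged :: "nat list \<Rightarrow> nat list list \<Rightarrow> tagged_state list" where
  "tagged ls ps = zip [0..<length ls] (zip ls ps)"

definition block_mass :: "tagged_state list \<Rightarrow> (tagged_state \<times> tagged_state) list \<Rightarrow> tagged_state \<Rightarrow> tagged_state \<Rightarrow> nat" where
  "block_mass ts R v s = sum_list (map snd (filter (\<lambda>p. (v, fst p) \<in> set R) (zip ts (snd (snd s)))))"

definition refine :: "tagged_state list \<Rightarrow> (tagged_state \<times> tagged_state) list \<Rightarrow> (tagged_state \<times> tagged_state) list" where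
  "refine ts R = filter (\<lambda>p. \<forall>v\<in>set ts. block_mass ts R v (fst p) = block_mass ts R v (snd p)) R"

definition all_pairs :: "'a list \<Rightarrow> ('a \<times> 'a) list" where
  "all_pairs ts = concat (map (\<lambda>s. map (\<lambda>t. (s, t)) ts) ts)"

definition same_label :: "tagged_state list \<Rightarrow> (tagged_state \<times> tagged_state) list" where
  "same_label ts = filter (\<lambda>p. fst (snd (fst p)) = fst (snd (snd p))) (all_pairs ts)"

text \<open>A round that changes the relation removes at least one pair, so as many rounds as there
  are pairs suffice. The list of all pairs is the loop counter.\<close>

definition refined :: "tagged_state list \<Rightarrow> (tagged_state \<times> tagged_state) list" where
  "refined ts = fold (\<lambda>_ R. refine ts R) (all_pairs ts) (same_label ts)"

definition num_classes :: "tagged_state list \<Rightarrow> nat" where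
  "num_classes ts = length (filter (\<lambda>s. \<not> (\<exists>t\<in>set ts. fst t < fst s \<and> (t, s) \<in> set (refined ts))) ts)"

lemma ptime_tagged [ptimes]: "ptime ls \<Longrightarrow> ptime ps \<Longrightarrow> ptime (\<lambda>c. tagged (ls c) (ps c))"
  unfolding tagged_def by (intro ptimes)

lemma ptime_refine: "ptime (\<lambda>p. refine (fst p) (snd p))"
  unfolding refine_def block_mass_def by (intro ptimes)

lemma ptime_all_pairs [ptimes]: "ptime xs \<Longrightarrow> ptime (\<lambda>c. all_pairs (xs c))"
  unfolding all_pairs_def by (rule ptime_comp[of "\<lambda>ts. concat (map (\<lambda>s. map (\<lambda>t. (s, t)) ts) ts)"]) (intro ptimes)

lemma ptime_same_label: "ptime same_label"
  unfolding same_label_def by (intro ptimes)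

lemma ptime_refined: "ptime refined"
proof -
  obtain B where B: "pbound B" "\<And>ts. sz (same_label ts) \<le> B (sz ts)"
    using ptime_pbound[OF ptime_same_label] by metis
  show ?thesis
    unfolding refined_def
  proof (rule ptime_fold[where B = B])
    show "ptime (\<lambda>p :: tagged_state list \<times> (tagged_state \<times> tagged_state) \<times> (tagged_state \<times> tagged_state) list.
        refine (fst p) (snd (snd p)))"
      by (rule ptime_comp[OF ptime_refine, of "\<lambda>p. (fst p, snd (snd p))", simplified]) (intro ptimes)
    have "sz (fold (\<lambda>_. refine ts) ys R) \<le> sz R" for ts R and ys :: "(tagged_state \<times> tagged_state) list"
    proof (induction ys arbitrary: R)
      case (Cons y ys)
      have "sz (refine ts R) \<le> sz R" unfolding refine_def by (rule sz_filter_le)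
      with Cons[of "refine ts R"] show ?case by simp
    qed simp
    then show "sz (fold (\<lambda>_. refine ts) ys (same_label ts)) \<le> B (sz ts)"
      for ts and ys :: "(tagged_state \<times> tagged_state) list"
      using B(2) order_trans by blast
  qed (intro ptimes ptime_same_label B)+
qed

lemma ptime_num_classes [ptimes]: "ptime ts \<Longrightarrow> ptime (\<lambda>c. num_classes (ts c))"
proof (rule ptime_comp[of num_classes])
  show "ptime num_classes"
    unfolding num_classes_def by (intro ptimes ptime_comp[OF ptime_refined])
qed

section \<open>The refinement program computes bisimilarity\<close>

locale tagged_chain =
  fixes N :: "(nat, nat) lmc" and ls :: "nat list" and ps :: "nat list list" and Q :: nat
  assumes states: "states N = {..<length ls}" and len: "length ps = length ls"
    and rows: "\<And>i. i < length ls \<Longrightarrow> length (ps ! i) = length ls"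
    and label: "\<And>i. i < length ls \<Longrightarrow> label N i = ls ! i"
    and prob: "\<And>i j. i < length ls \<Longrightarrow> j < length ls \<Longrightarrow> prob N i j = real (ps ! i ! j) / real Q"
    and Q: "0 < Q"
begin

abbreviation "n \<equiv> length ls"
abbreviation "ts \<equiv> tagged ls ps"

definition tag :: "nat \<Rightarrow> tagged_state" where
  "tag i = (i, ls ! i, ps ! i)"

definition rel :: "(tagged_state \<times> tagged_state) list \<Rightarrow> (nat \<times> nat) set" where
  "rel R = {(i, j). i < n \<and> j < n \<and> (tag i, tag j) \<in> set R}"

lemma ts_eq: "ts = map tag [0..<n]"
  unfolding tagged_def by (rule nth_equalityI) (auto simp: len tag_def)

lemma block_mass_tag:
  assumes "s < n" "v < n"
  shows "block_mass ts R (tag v) (tag s) = (\<Sum>u\<in>rel R `` {v}. ps ! s ! u)"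
proof -
  have "zip ts (ps ! s) = map (\<lambda>u. (tag u, ps ! s ! u)) [0..<n]"
    unfolding ts_eq by (rule nth_equalityI) (auto simp: rows assms)
  then have "block_mass ts R (tag v) (tag s)
      = sum_list (map (\<lambda>u. ps ! s ! u) (filter (\<lambda>u. (tag v, tag u) \<in> set R) [0..<n]))"
    by (simp add: block_mass_def tag_def[of s] filter_map comp_def)
  also have "\<dots> = (\<Sum>u\<in>set (filter (\<lambda>u. (tag v, tag u) \<in> set R) [0..<n]). ps ! s ! u)"
    by (rule sum_list_distinct_conv_sum_set) simp
  also have "set (filter (\<lambda>u. (tag v, tag u) \<in> set R) [0..<n]) = rel R `` {v}"
    using assms by (auto simp: rel_def)
  finally show ?thesis .
qed

lemma rel_refine: "rel (refine ts R) = refine_rel N (rel R)"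
proof -
  have mass: "(\<Sum>u\<in>rel R `` {v}. prob N s u) = real (block_mass ts R (tag v) (tag s)) / real Q"
    if "s < n" "v < n" for s v
  proof -
    have "(\<Sum>u\<in>rel R `` {v}. prob N s u) = (\<Sum>u\<in>rel R `` {v}. real (ps ! s ! u) / real Q)"
      by (rule sum.cong) (auto simp: rel_def prob that)
    then show ?thesis by (simp add: block_mass_tag[OF that] sum_divide_distrib)
  qed
  have "(i, j) \<in> rel (refine ts R) \<longleftrightarrow> (i, j) \<in> refine_rel N (rel R)" for i j
  proof (cases "i < n \<and> j < n")
    case True
    then have "(\<forall>v\<in>states N. (\<Sum>u\<in>rel R `` {v}. prob N i u) = (\<Sum>u\<in>rel R `` {v}. prob N j u)) \<longleftrightarrow>
        (\<forall>v<n. block_mass ts R (tag v) (tag i) = block_mass ts R (tag v) (tag j))"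
      using Q by (auto simp: states mass)
    moreover have "(\<forall>z\<in>set ts. P z) \<longleftrightarrow> (\<forall>v<n. P (tag v))" for P
      unfolding ts_eq by auto
    ultimately show ?thesis using True by (simp add: refine_rel_def rel_def refine_def)
  qed (auto simp: rel_def refine_rel_def)
  then show ?thesis by auto
qed

lemma refine_refined: "refine ts (refined ts) = refined ts"
proof -
  have stable: "refine ts (fold (\<lambda>_. refine ts) ys R) = fold (\<lambda>_. refine ts) ys R"
    if "length R \<le> length ys" for R and ys :: "(tagged_state \<times> tagged_state) list"
    using that
  proof (induction ys arbitrary: R)
    case Nil
    then show ?case by (simp add: refine_def)
  next
    case (Cons y ys)
    show ?case
    proof (cases "refine ts R = R")
      case True
      then have "fold (\<lambda>_. refine ts) zs R = R" for zs :: "(tagged_state \<times> tagged_state) list"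
        by (induction zs) auto
      then show ?thesis using True by simp
    next
      case False
      then have "length (refine ts R) < length R"
        unfolding refine_def by (rule length_filter_neq)
      then have "length (refine ts R) \<le> length ys" using Cons.prems by simp
      from Cons.IH[OF this] show ?thesis unfolding fold_simps comp_def .
    qed
  qed
  have "length (same_label ts) \<le> length (all_pairs ts)" by (simp add: same_label_def)
  from stable[OF this] show ?thesis by (simp add: refined_def)
qed

lemma rel_refined: "rel (refined ts) = bisimilarity N"
proof -
  have fin: "finite (states N)" by (simp add: states)
  note bis = bisimilarity_largest[OF fin]
  \<comment> \<open>Refinement preserves that the relation is an equivalence, contains bisimilarity
    and respects labels. A fixed point with these properties is a bisimulation and hence equals the
    largest one.\<close>
  define inv where "inv R \<longleftrightarrow> equiv (states N) (rel R) \<and> bisimilarity N \<subseteq> rel R \<and>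
    (\<forall>s t. (s, t) \<in> rel R \<longrightarrow> label N s = label N t)" for R
  have "set (all_pairs ts) = set ts \<times> set ts" by (auto simp: all_pairs_def)
  moreover have "tag i \<in> set ts" if "i < n" for i unfolding ts_eq using that by simp
  moreover have "fst (snd (tag i)) = ls ! i" for i by (simp add: tag_def)
  ultimately have "rel (same_label ts) = {(i, j). i < n \<and> j < n \<and> label N i = label N j}"
    by (auto simp: rel_def same_label_def label)
  moreover have "bisimilarity N \<subseteq> {(i, j). i < n \<and> j < n \<and> label N i = label N j}"
    using bis(1) equiv_type unfolding prob_bisimulation_def states by fastforce
  ultimately have "inv (same_label ts)"
    by (auto simp: inv_def states equiv_def refl_on_def sym_def trans_def)
  moreover have step: "inv (refine ts R)" if "inv R" for R
  proof -
    have "bisimilarity N \<subseteq> refine_rel N (rel R)"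
      using bisimulation_subset_refine_rel[OF fin _ bis(1)] that by (simp add: inv_def)
    then show ?thesis using that equiv_refine_rel[of N "rel R"]
      unfolding inv_def rel_refine by (auto simp: refine_rel_def)
  qed
  moreover have "inv (fold (\<lambda>_. refine ts) ys R)" if "inv R" for R and ys :: "(tagged_state \<times> tagged_state) list"
    using that by (induction ys arbitrary: R) (simp_all add: step)
  ultimately have inv: "inv (refined ts)" unfolding refined_def by blast
  then have "prob_bisimulation N (rel (refined ts))"
    using refine_refined rel_refine[of "refined ts"] unfolding inv_def
    by (intro bisimulation_if_refine_rel_fixed) auto
  then show ?thesis using inv bis(2) unfolding inv_def by blast
qed

theorem num_classes_eq: "num_classes ts = card ({..<n} // bisimilarity N)"
proof -
  have "equiv {..<n} (bisimilarity N)"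
    using bisimilarity_largest(1)[of N] by (simp add: prob_bisimulation_def states)
  then have "card ({..<n} // bisimilarity N) = card {s. s < n \<and> (\<forall>t<n. (t, s) \<in> rel (refined ts) \<longrightarrow> s \<le> t)}"
    using card_quotient_least rel_refined by simp
  also have "{s. s < n \<and> (\<forall>t<n. (t, s) \<in> rel (refined ts) \<longrightarrow> s \<le> t)}
      = set (filter (\<lambda>s. \<not> (\<exists>t<n. t < s \<and> (tag t, tag s) \<in> set (refined ts))) [0..<n])"
    (is "?A = ?B")
  proof -
    have "s \<in> ?A \<longleftrightarrow> s \<in> ?B" for s
      unfolding rel_def set_filter mem_Collect_eq case_prod_conv by (simp, meson not_le)
    then show ?thesis by blast
  qed
  also have "card \<dots> = length (filter (\<lambda>s. \<not> (\<exists>t<n. t < s \<and> (tag t, tag s) \<in> set (refined ts))) [0..<n])"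
    by (rule distinct_card) simp
  also have "\<dots> = num_classes ts"
  proof -
    have "set ts = tag ` {..<n}" unfolding ts_eq by (simp add: atLeast0LessThan)
    moreover have "fst (tag i) = i" for i by (simp add: tag_def)
    moreover have "filter P ts = map tag (filter (\<lambda>s. P (tag s)) [0..<n])" for P
      unfolding ts_eq filter_map comp_def ..
    ultimately show ?thesis unfolding num_classes_def by (simp add: Bex_def)
  qed
  finally show ?thesis ..
qed

end


section \<open>Membership in NP\<close>

type_synonym certificate =
  "(nat list \<times> nat list \<times> fraction list list) \<times> (fraction \<times> nat) \<times> nat \<times> nat list list \<times> nat list list"

text \<open>A certificate consists of the instance, a common denominator \<open>Q\<close> and the numerators of \<open>\<tau>\<close> and
  \<open>\<tau>'\<close>. The distance is checked in the form \<open>\<bar>a - b\<bar> = 2 * max a b - a - b\<close>.\<close>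

definition check ::
  "bool list \<Rightarrow> nat list \<Rightarrow> nat list \<Rightarrow> fraction list list \<Rightarrow> fraction \<Rightarrow> nat \<Rightarrow> nat \<Rightarrow> nat list list \<Rightarrow> nat list list \<Rightarrow> bool" where
  "check x lb sl pr e k Q m p \<longleftrightarrow>
     x = enc_list enc_nat lb @ enc_list enc_nat sl @ enc_list (enc_list enc_fraction) pr @ enc_fraction e @ enc_nat k \<and>
     lb \<noteq> [] \<and> sl \<noteq> [] \<and> (\<forall>l\<in>set sl. l \<in> set lb) \<and> length pr = length sl \<and>
     (\<forall>r\<in>set pr. length r = length sl \<and> (\<forall>f\<in>set r. 0 < snd f)) \<and>
     0 < fst e \<and> 0 < snd e \<and> fst e \<le> snd e \<and> 1 \<le> k \<and> 0 < Q \<and>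
     length m = length sl \<and> (\<forall>r\<in>set m. length r = length sl \<and> sum_list r = Q) \<and>
     length p = length sl \<and> (\<forall>r\<in>set p. length r = length sl \<and> sum_list r = Q) \<and>
     (\<forall>z\<in>set (zip pr m). \<forall>y\<in>set (zip (fst z) (snd z)). fst (fst y) * Q = snd y * snd (fst y)) \<and>
     (\<forall>z\<in>set (zip m p). snd e * (2 * sum_list (map (\<lambda>y. max (fst y) (snd y)) (zip (fst z) (snd z))))
        \<le> (fst e + 2 * snd e) * Q) \<and>
     num_classes (tagged sl p) = k"

definition verify :: "bool list \<Rightarrow> certificate \<Rightarrow> bool" where
  "verify x w = check x (fst (fst w)) (fst (snd (fst w))) (snd (snd (fst w))) (fst (fst (snd w))) (snd (fst (snd w)))
     (fst (snd (snd w))) (fst (snd (snd (snd w)))) (snd (snd (snd (snd w))))"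

lemma ptime_verify: "ptime (\<lambda>p. verify (fst p) (snd p))"
  unfolding verify_def check_def by (intro ptimes)

lemma ptime_from_tree_certificate: "ptime (from_tree :: tree \<Rightarrow> certificate)"
  by (intro ptime_from_tree_prod ptime_from_tree_list ptime_from_tree_nat)

lemma Ball_set_zip:
  assumes "length xs = n" "length ys = n"
  shows "(\<forall>z\<in>set (zip xs ys). P z) \<longleftrightarrow> (\<forall>i<n. P (xs ! i, ys ! i))"
  using assms by (fastforce simp: set_zip)

text \<open>Both rows sum to \<open>Q\<close>, so the sum of the absolute differences of numerators
  is twice the sum of the maxima minus \<open>2 * Q\<close>. Moving the negative term to the other
  side leaves a comparison of natural numbers without subtraction.\<close>

lemma distance_by_max:
  fixes m p :: "nat \<Rightarrow> nat"
  assumes "(\<Sum>t<n. m t) = Q" "(\<Sum>t<n. p t) = Q" "0 < Q" "0 < e2"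
  shows "(\<Sum>t<n. \<bar>real (p t) / real Q - real (m t) / real Q\<bar>) \<le> real e1 / real e2 \<longleftrightarrow>
    e2 * (2 * (\<Sum>t<n. max (m t) (p t))) \<le> (e1 + 2 * e2) * Q"
proof -
  have "\<bar>real (p t) / real Q - real (m t) / real Q\<bar> = (2 * real (max (m t) (p t)) - real (m t) - real (p t)) / real Q" for t
    unfolding diff_divide_distrib[symmetric] abs_divide by (simp add: max_def abs_if)
  then have "(\<Sum>t<n. \<bar>real (p t) / real Q - real (m t) / real Q\<bar>)
      = (2 * real (\<Sum>t<n. max (m t) (p t)) - real (\<Sum>t<n. m t) - real (\<Sum>t<n. p t)) / real Q"
    by (simp add: sum_divide_distrib[symmetric] sum_subtractf sum_distrib_left)
  also have "\<dots> = (2 * real (\<Sum>t<n. max (m t) (p t)) - 2 * real Q) / real Q"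
    unfolding assms(1,2) by simp
  finally have eq: "(\<Sum>t<n. \<bar>real (p t) / real Q - real (m t) / real Q\<bar>)
      = (2 * real (\<Sum>t<n. max (m t) (p t)) - 2 * real Q) / real Q" .
  have "(\<Sum>t<n. \<bar>real (p t) / real Q - real (m t) / real Q\<bar>) \<le> real e1 / real e2 \<longleftrightarrow>
      real e2 * (2 * real (\<Sum>t<n. max (m t) (p t))) \<le> (real e1 + 2 * real e2) * real Q"
    unfolding eq using assms(3,4) by (simp add: field_simps)
  also have "\<dots> \<longleftrightarrow> real (e2 * (2 * (\<Sum>t<n. max (m t) (p t)))) \<le> real ((e1 + 2 * e2) * Q)" by simp
  finally show ?thesis unfolding of_nat_le_iff .
qed

lemma sum_list_nth: "length xs = n \<Longrightarrow> sum_list xs = (\<Sum>t<n. xs ! t :: nat)"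
  by (simp add: sum_list_sum_nth atLeast0LessThan)

section \<open>Accepted certificates are sound\<close>

locale certified =
  fixes x :: "bool list" and lb sl :: "nat list" and pr :: "fraction list list" and e :: fraction and k Q :: nat
    and m p :: "nat list list"
  assumes check: "check x lb sl pr e k Q m p"
begin

definition "c = \<lparr>label_names = lb, state_labels = sl, prob_rows = pr\<rparr>"

abbreviation "n \<equiv> length sl"

lemma facts:
  "x = enc_lmc c @ enc_fraction e @ enc_nat k" "lb \<noteq> []" "sl \<noteq> []" "set sl \<subseteq> set lb" "length pr = n" "0 < fst e" "0 < snd e"
  "fst e \<le> snd e" "1 \<le> k" "0 < Q" "length m = n" "length p = n" "num_classes (tagged sl p) = k"
  using check by (auto simp: check_def enc_lmc_def c_def)

lemma rows:
  assumes "s < n"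
  shows "length (pr ! s) = n" "\<And>t. t < n \<Longrightarrow> 0 < snd (pr ! s ! t)"
    "length (m ! s) = n" "(\<Sum>t<n. m ! s ! t) = Q" "length (p ! s) = n" "(\<Sum>t<n. p ! s ! t) = Q"
proof -
  have *: "pr ! s \<in> set pr" "m ! s \<in> set m" "p ! s \<in> set p" using assms facts by simp_all
  then show l: "length (pr ! s) = n" "length (m ! s) = n" "length (p ! s) = n"
    using check by (simp_all add: check_def)
  show "0 < snd (pr ! s ! t)" if "t < n" for t
    using check * l that nth_mem[of t "pr ! s"] unfolding check_def by metis
  show "(\<Sum>t<n. m ! s ! t) = Q" "(\<Sum>t<n. p ! s ! t) = Q"
    using check * l sum_list_nth[of _ n] unfolding check_def by metis+
qed

lemma prob_c:
  assumes "s < n" "t < n"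
  shows "prob (lmc_of_code c) s t = real (m ! s ! t) / real Q"
proof -
  have "\<forall>s<n. \<forall>y\<in>set (zip (pr ! s) (m ! s)). fst (fst y) * Q = snd y * snd (fst y)"
    using check Ball_set_zip[of pr n m "\<lambda>z. \<forall>y\<in>set (zip (fst z) (snd z)). fst (fst y) * Q = snd y * snd (fst y)"] facts
    by (simp add: check_def)
  then have "fst (pr ! s ! t) * Q = m ! s ! t * snd (pr ! s ! t)"
    using Ball_set_zip[of "pr ! s" n "m ! s" "\<lambda>y. fst (fst y) * Q = snd y * snd (fst y)"] assms rows[OF assms(1)] by simp
  then have "real (fst (pr ! s ! t)) * real Q = real (m ! s ! t) * real (snd (pr ! s ! t))"
    by (metis of_nat_mult)
  then show ?thesis using rows(2)[OF assms] facts(10)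
    by (cases "pr ! s ! t") (simp add: lmc_of_code_def c_def field_simps)
qed

lemma states_c: "states (lmc_of_code c) = {..<n}"
  by (simp add: lmc_of_code_def c_def)

lemma valid: "valid_lmc_code c"
proof -
  have "is_distr {..<n} (prob (lmc_of_code c) s)" if "s < n" for s
    using that rows(4)[OF that] facts(10)
    by (simp add: is_distr_def prob_c sum_divide_distrib[symmetric] of_nat_sum[symmetric] del: of_nat_sum)
  moreover have "label (lmc_of_code c) s \<in> set lb" if "s < n" for s
    using that facts(4) by (auto simp: lmc_of_code_def c_def)
  moreover have "labels (lmc_of_code c) = set lb" by (simp add: lmc_of_code_def c_def)
  ultimately have "is_lmc (lmc_of_code c)"
    using facts(2,3) by (auto simp: is_lmc_def states_c lessThan_empty_iff)
  moreover have "\<forall>r\<in>set pr. length r = n \<and> (\<forall>(a, b)\<in>set r. 0 < b)"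
    using check by (simp add: check_def case_prod_beta)
  ultimately show ?thesis using facts(5) by (simp add: valid_lmc_code_def c_def Let_def)
qed

lemma in_EPS_QUOTIENT: "x \<in> EPS_QUOTIENT"
proof -
  let ?M = "lmc_of_code c"
  let ?\<tau> = "\<lambda>s t. real (p ! s ! t) / real Q"
  have M: "is_lmc ?M" using valid by (simp add: valid_lmc_code_def Let_def)
  have near: "(\<Sum>t<n. \<bar>?\<tau> s t - prob ?M s t\<bar>) \<le> fraction_value e" if s: "s < n" for s
  proof -
    have "snd e * (2 * sum_list (map (\<lambda>y. max (fst y) (snd y)) (zip (m ! s) (p ! s)))) \<le> (fst e + 2 * snd e) * Q"
      using check Ball_set_zip[of m n p "\<lambda>z. snd e * (2 * sum_list (map (\<lambda>y. max (fst y) (snd y)) (zip (fst z) (snd z))))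
        \<le> (fst e + 2 * snd e) * Q"] facts(11,12) s by (simp add: check_def)
    also have "sum_list (map (\<lambda>y. max (fst y) (snd y)) (zip (m ! s) (p ! s))) = (\<Sum>t<n. max (m ! s ! t) (p ! s ! t))"
      using rows[OF s] by (subst sum_list_nth[of _ n]) auto
    finally have "(\<Sum>t<n. \<bar>?\<tau> s t - real (m ! s ! t) / real Q\<bar>) \<le> real (fst e) / real (snd e)"
      using distance_by_max[OF rows(4)[OF s] rows(6)[OF s] facts(10,7)] by simp
    then show ?thesis using s by (cases e) (simp add: prob_c)
  qed
  have distr: "is_distr {..<n} (?\<tau> s)" if "s < n" for s
    using rows(6)[OF that] facts(10)
    by (simp add: is_distr_def sum_divide_distrib[symmetric] of_nat_sum[symmetric] del: of_nat_sum)
  interpret N: tagged_chain "?M\<lparr>prob := ?\<tau>\<rparr>" sl p Q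
    by unfold_locales (use rows(5) facts(10,12) in \<open>simp_all add: lmc_of_code_def c_def\<close>)
  have "card ({..<n} // bisimilarity (?M\<lparr>prob := ?\<tau>\<rparr>)) = k"
    using N.num_classes_eq facts(13) by simp
  then have "has_eps_quotient_of_size ?M (fraction_value e) k"
    unfolding has_eps_quotient_of_size_iff[OF M] states_c using near distr by (intro exI[of _ ?\<tau>]) simp
  moreover have "valid_eps e" using facts(6-8) by (cases e) (simp add: valid_eps_def)
  ultimately show ?thesis unfolding EPS_QUOTIENT_def using valid facts(1,9) by blast
qed

end

section \<open>Members have certificates of polynomial size\<close>

lemma bisimilarity_cong:
  assumes "\<And>E s t. E \<subseteq> states M \<Longrightarrow> s \<in> states M \<Longrightarrow> t \<in> states M \<Longrightarrow>
    (\<Sum>u\<in>E. \<tau> s u) = (\<Sum>u\<in>E. \<tau> t u) \<longleftrightarrow> (\<Sum>u\<in>E. \<sigma> s u) = (\<Sum>u\<in>E. \<sigma> t u)"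
  shows "bisimilarity (M\<lparr>prob := \<tau>\<rparr>) = bisimilarity (M\<lparr>prob := \<sigma>\<rparr>)"
proof -
  have "prob_bisimulation (M\<lparr>prob := \<tau>\<rparr>) R \<longleftrightarrow> prob_bisimulation (M\<lparr>prob := \<sigma>\<rparr>) R" for R
  proof (cases "equiv (states M) R")
    case True
    have "E \<subseteq> states M" if "E \<in> states M // R" for E using that True by (metis Sup_upper Union_quotient)
    moreover have "s \<in> states M \<and> t \<in> states M" if "(s, t) \<in> R" for s t using that equiv_type[OF True] by blast
    ultimately show ?thesis unfolding prob_bisimulation_def using assms by (auto split: prod.splits)
  qed (simp add: prob_bisimulation_def)
  then show ?thesis by (simp add: bisimilarity_def)
qed

lemma length_binary_prod_list: "length (binary (prod_list (map snd xs))) \<le> sz (xs :: fraction list)"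
proof (induction xs)
  case Nil
  show ?case using length_binary_le[of 1] by simp
next
  case (Cons f xs)
  have "length (binary (snd f)) \<le> sz f" using length_binary_le_sz[of "snd f"] by (cases f) simp
  then show ?case using Cons length_binary_mult[of "snd f" "prod_list (map snd xs)"] by simp
qed

lemma length_binary_power: "length (binary (b ^ k)) \<le> k * length (binary b) + 1"
proof (induction k)
  case 0
  show ?case using length_binary_le[of 1] by simp
next
  case (Suc k)
  then show ?case using length_binary_mult[of b "b ^ k"] by simp
qed

text \<open>The slack 2 pays for the nodes that join components, so the same inequality carries over
  to fractions and lists. The factor 3 is dictated by the empty list, of size 1 and code length
  1.\<close>

lemma sz_enc_nat: "sz n + 2 \<le> 3 * length (enc_nat n)"
proof -
  have "length (enc_nat n) = 2 * length (binary n) + 1"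
    by (induction "binary n" arbitrary: n rule: list.induct)
      (simp_all add: enc_nat_def enc_list_def length_concat comp_def sum_list_triv)
  then show ?thesis using sz_nat_le[of n] by simp
qed

lemma sz_enc_fraction: "sz f + 2 \<le> 3 * length (enc_fraction f)"
  using sz_enc_nat[of "fst f"] sz_enc_nat[of "snd f"] by (cases f) simp

lemma sz_enc_list:
  assumes "\<And>x. sz x + 2 \<le> 3 * length (f x)"
  shows "sz xs + 2 \<le> 3 * length (enc_list f xs)"
proof (induction xs)
  case (Cons x xs)
  then show ?case using assms[of x] by (simp add: enc_list_def)
qed (simp add: enc_list_def)

text \<open>For an input of length \<open>l\<close> each of the five parts of the instance has size
  at most 3l. \<open>w\<close> bounds the binary length of the common denominator: 3l for the
  denominators of the instance, the rest for the power in \<open>small_perturbation\<close>, whose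
  base has at most 12l + 5 bits. The last summand accounts for two matrices with entries of that
  length.\<close>

definition certificate_bound :: "nat \<Rightarrow> nat" where
  "certificate_bound l = (let w = 3 * l + ((2 * (3 * l) * (3 * l) + 1) * (12 * l + 5) + 1) in
     15 * l + 20 + (4 * w + 1) + 2 * (3 * l * (3 * l * (4 * w + 1 + 1) + 1 + 1) + 1))"

lemma certificate_exists:
  assumes "x \<in> EPS_QUOTIENT"
  shows "\<exists>w. verify x w \<and> sz w \<le> certificate_bound (length x)"
proof -
  from assms obtain c e k where x: "x = enc_lmc c @ enc_fraction e @ enc_nat k" and c: "valid_lmc_code c"
    and e: "valid_eps e" and k: "1 \<le> k" and q: "has_eps_quotient_of_size (lmc_of_code c) (fraction_value e) k"
    unfolding EPS_QUOTIENT_def by blast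
  obtain lb sl pr where c_eq: "c = \<lparr>label_names = lb, state_labels = sl, prob_rows = pr\<rparr>" by (cases c) blast
  let ?M = "lmc_of_code c" and ?n = "length sl"
  have M: "is_lmc ?M" using c by (simp add: valid_lmc_code_def Let_def)
  have states: "states ?M = {..<?n}" by (simp add: lmc_of_code_def c_eq)
  have pr: "length pr = ?n" "\<And>r. r \<in> set pr \<Longrightarrow> length r = ?n \<and> (\<forall>f\<in>set r. 0 < snd f)"
    using c by (fastforce simp: valid_lmc_code_def Let_def c_eq)+
  have entry: "length (pr ! s) = ?n" "0 < snd (pr ! s ! t)" "pr ! s ! t \<in> set (concat pr)" if "s < ?n" "t < ?n" for s t
  proof -
    have s: "pr ! s \<in> set pr" using that pr(1) by simp
    then show l: "length (pr ! s) = ?n" using pr(2) by blast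
    with that have "pr ! s ! t \<in> set (pr ! s)" by simp
    then show "0 < snd (pr ! s ! t)" "pr ! s ! t \<in> set (concat pr)" using pr(2)[OF s] s by auto
  qed
  obtain e1 e2 where e12: "e = (e1, e2)" by fastforce
  have e2: "0 < e1" "0 < e2" "e1 \<le> e2" using e by (auto simp: valid_eps_def e12 zero_less_divide_iff)
  \<comment> \<open>The product of all denominators is a common one, and its binary length is at
    most the sum of theirs.\<close>
  define D where "D = prod_list (map snd (concat pr))"
  have "0 \<notin> set (map snd (concat pr))" using pr(2) by fastforce
  then have D: "0 < D" unfolding D_def by (metis gr_zeroI prod_list_zero_iff)
  have dvd: "snd (pr ! s ! t) dvd D" if "s < ?n" "t < ?n" for s t
    unfolding D_def using entry(3)[OF that] by (intro prod_list_dvd) auto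
  define m where "m s t = fst (pr ! s ! t) * (D div snd (pr ! s ! t))" for s t
  have prob: "prob ?M s t = real (m s t) / real D" if st: "s < ?n" "t < ?n" for s t
  proof -
    obtain d where d: "D = snd (pr ! s ! t) * d" using dvd[OF st] by blast
    then show ?thesis using entry(2)[OF st] D
      by (cases "pr ! s ! t") (simp add: lmc_of_code_def c_eq m_def)
  qed
  from q[unfolded has_eps_quotient_of_size_iff[OF M] states] obtain \<tau> where
    \<tau>: "\<And>s. s < ?n \<Longrightarrow> is_distr {..<?n} (\<tau> s)" "\<And>s. s < ?n \<Longrightarrow> (\<Sum>t<?n. \<bar>\<tau> s t - prob ?M s t\<bar>) \<le> fraction_value e"
    and card: "card ({..<?n} // bisimilarity (?M\<lparr>prob := \<tau>\<rparr>)) = k" by auto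
  have near: "(\<Sum>t<?n. \<bar>\<tau> s t - real (m s t) / real D\<bar>) \<le> real e1 / real e2" if "s < ?n" for s
    using \<tau>(2)[OF that] that by (simp add: prob e12)
  obtain q p where q: "0 < q" "q \<le> (D + e2 * ?n + 2 * ?n + 3) ^ (2 * ?n * ?n + 1)"
    and p: "\<And>s. s < ?n \<Longrightarrow> (\<Sum>t<?n. p s t) = q"
    and p_near: "\<And>s. s < ?n \<Longrightarrow> real e2 * (\<Sum>t<?n. \<bar>real D * real (p s t) - real q * real (m s t)\<bar>) \<le> real q * real e1 * real D"
    and pattern: "\<And>E s t. E \<subseteq> {..<?n} \<Longrightarrow> s < ?n \<Longrightarrow> t < ?n \<Longrightarrow>
       (\<Sum>u\<in>E. p s u) = (\<Sum>u\<in>E. p t u) \<longleftrightarrow> (\<Sum>u\<in>E. \<tau> s u) = (\<Sum>u\<in>E. \<tau> t u)"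
    by (rule small_perturbation[where n = ?n and \<tau> = \<tau> and m = m, OF D e2(2) \<tau>(1) near]) (assumption | rule that)+
  \<comment> \<open>With \<open>D * q\<close> as denominator both the original chain, with
    numerators \<open>q * m s t\<close>, and the perturbed one, with numerators
    \<open>D * p s t\<close>, become integral.\<close>
  define Q where "Q = D * q"
  have Q: "0 < Q" using D q by (simp add: Q_def)
  have m_sum: "(\<Sum>t<?n. m s t) = D" if "s < ?n" for s
  proof -
    have "is_distr {..<?n} (prob ?M s)" using M that by (simp add: is_lmc_def states)
    then have "(\<Sum>t<?n. real (m s t) / real D) = 1" using that by (simp add: is_distr_def prob)
    then have "real (\<Sum>t<?n. m s t) = real D" using D by (simp add: sum_divide_distrib[symmetric])
    then show ?thesis by (simp only: of_nat_eq_iff)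
  qed
  let ?mat = "\<lambda>f. map (\<lambda>s. map (f s) [0..<?n]) [0..<?n]"
  let ?m = "?mat (\<lambda>s t. q * m s t)" and ?p = "?mat (\<lambda>s t. D * p s t)"
  have sums: "(\<Sum>t<?n. q * m s t) = Q" "(\<Sum>t<?n. D * p s t) = Q" if "s < ?n" for s
    using m_sum[OF that] p[OF that] by (simp_all add: Q_def sum_distrib_left[symmetric] mult.commute)
  let ?\<sigma> = "\<lambda>s t. real (D * p s t) / real Q"
  have bisim: "bisimilarity (?M\<lparr>prob := ?\<sigma>\<rparr>) = bisimilarity (?M\<lparr>prob := \<tau>\<rparr>)"
  proof (rule bisimilarity_cong)
    fix E s t assume E: "E \<subseteq> states ?M" "s \<in> states ?M" "t \<in> states ?M"
    have "(\<Sum>u\<in>E. ?\<sigma> s u) = real D / real Q * real (\<Sum>u\<in>E. p s u)" for s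
      by (simp add: sum_distrib_left)
    then have "(\<Sum>u\<in>E. ?\<sigma> s u) = (\<Sum>u\<in>E. ?\<sigma> t u) \<longleftrightarrow> (\<Sum>u\<in>E. p s u) = (\<Sum>u\<in>E. p t u)"
      using D Q by (simp only: mult_cancel_left of_nat_eq_iff) simp
    then show "(\<Sum>u\<in>E. ?\<sigma> s u) = (\<Sum>u\<in>E. ?\<sigma> t u) \<longleftrightarrow> (\<Sum>u\<in>E. \<tau> s u) = (\<Sum>u\<in>E. \<tau> t u)"
      using pattern E by (simp only: states lessThan_iff)
  qed
  have "tagged_chain (?M\<lparr>prob := ?\<sigma>\<rparr>) sl ?p Q"
    by unfold_locales (use Q in \<open>simp_all add: lmc_of_code_def c_eq\<close>)
  from tagged_chain.num_classes_eq[OF this] have classes: "num_classes (tagged sl ?p) = k"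
    unfolding bisim card .
  have dist: "e2 * (2 * (\<Sum>t<?n. max (q * m s t) (D * p s t))) \<le> (e1 + 2 * e2) * Q" if s: "s < ?n" for s
  proof -
    have "(\<Sum>t<?n. \<bar>real (D * p s t) / real Q - real (q * m s t) / real Q\<bar>)
        = (\<Sum>t<?n. \<bar>real D * real (p s t) - real q * real (m s t)\<bar>) / real Q"
      using Q by (simp add: sum_divide_distrib diff_divide_distrib[symmetric])
    also have "\<dots> \<le> real e1 / real e2"
      using p_near[OF s] e2(2) Q by (simp add: field_simps Q_def)
    finally show ?thesis using distance_by_max[OF sums[OF s] Q e2(2)] by simp
  qed
  have num: "fst (pr ! s ! t) * Q = q * m s t * snd (pr ! s ! t)" if "s < ?n" "t < ?n" for s t
    using dvd[OF that] by (auto simp: m_def Q_def)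
  have sl: "sl \<noteq> []" "lb \<noteq> []" "\<forall>l\<in>set sl. l \<in> set lb"
    using M by (auto simp: is_lmc_def lmc_of_code_def c_eq in_set_conv_nth[of _ sl])
  have "check x lb sl pr e k Q ?m ?p"
    unfolding check_def
  proof (intro conjI)
    show "x = enc_list enc_nat lb @ enc_list enc_nat sl @ enc_list (enc_list enc_fraction) pr @ enc_fraction e @ enc_nat k"
      using x by (simp add: enc_lmc_def c_eq)
    show "\<forall>z\<in>set (zip pr ?m). \<forall>y\<in>set (zip (fst z) (snd z)). fst (fst y) * Q = snd y * snd (fst y)"
      using num entry(1) by (simp add: Ball_set_zip[of _ ?n] pr(1))
    show "\<forall>z\<in>set (zip ?m ?p). snd e * (2 * sum_list (map (\<lambda>y. max (fst y) (snd y)) (zip (fst z) (snd z))))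
        \<le> (fst e + 2 * snd e) * Q"
    proof -
      have "sum_list (map (\<lambda>y. max (fst y) (snd y)) (zip (?m ! s) (?p ! s))) = (\<Sum>t<?n. max (q * m s t) (D * p s t))"
        if "s < ?n" for s using that by (subst sum_list_nth[of _ ?n]) auto
      then show ?thesis using dist by (simp add: Ball_set_zip[of _ ?n] e12)
    qed
    show "\<forall>r\<in>set ?m. length r = ?n \<and> sum_list r = Q" "\<forall>r\<in>set ?p. length r = ?n \<and> sum_list r = Q"
      using sums by (auto simp: sum_list_nth[of _ ?n])
  qed (use sl pr e2 e12 k Q classes in auto)
  then have ver: "verify x ((lb, sl, pr), (e, k), Q, ?m, ?p)" by (simp add: verify_def)
  let ?l = "length x"
  have szs: "sz lb \<le> 3 * ?l" "sz sl \<le> 3 * ?l" "sz pr \<le> 3 * ?l" "sz e \<le> 3 * ?l" "sz k \<le> 3 * ?l"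
    using sz_enc_list[OF sz_enc_nat, of lb] sz_enc_list[OF sz_enc_nat, of sl]
      sz_enc_list[OF sz_enc_list[OF sz_enc_fraction], of pr] sz_enc_fraction[of e] sz_enc_nat[of k]
    by (simp_all add: x enc_lmc_def c_eq)
  have n: "?n \<le> 3 * ?l" using length_le_sz[of sl] szs by simp
  define w where "w = 3 * ?l + ((2 * (3 * ?l) * (3 * ?l) + 1) * (12 * ?l + 5) + 1)"
  have lD: "length (binary D) \<le> 3 * ?l"
    unfolding D_def using length_binary_prod_list[of "concat pr"] sz_concat_le[of pr] szs by simp
  have "length (binary e2) \<le> 3 * ?l" using length_binary_le_sz[of e2] szs(4) by (simp add: e12)
  then have "length (binary (D + e2 * ?n + 2 * ?n + 3)) \<le> 12 * ?l + 5"
    using length_binary_add[of "D + e2 * ?n + 2 * ?n" 3] length_binary_add[of "D + e2 * ?n" "2 * ?n"]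
      length_binary_add[of D "e2 * ?n"] length_binary_mult[of e2 ?n] length_binary_mult[of 2 ?n]
      length_binary_le[of ?n] length_binary_le[of 2] length_binary_le[of 3] n lD by linarith
  moreover have "2 * ?n * ?n + 1 \<le> 2 * (3 * ?l) * (3 * ?l) + 1"
    using n by (intro add_mono mult_le_mono) auto
  ultimately have "(2 * ?n * ?n + 1) * length (binary (D + e2 * ?n + 2 * ?n + 3))
      \<le> (2 * (3 * ?l) * (3 * ?l) + 1) * (12 * ?l + 5)" by (rule mult_le_mono[rotated])
  then have "length (binary q) \<le> (2 * (3 * ?l) * (3 * ?l) + 1) * (12 * ?l + 5) + 1"
    using length_binary_mono[OF q(2)] length_binary_power[of "D + e2 * ?n + 2 * ?n + 3" "2 * ?n * ?n + 1"]
    by linarith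
  then have lQ: "length (binary Q) \<le> w"
    using lD length_binary_mult[of D q] unfolding Q_def w_def by linarith
  define B where "B = 3 * ?l * (3 * ?l * (4 * w + 1 + 1) + 1 + 1) + 1"
  have mat: "sz (?mat f) \<le> B"
    if f: "\<And>s t. s < ?n \<Longrightarrow> t < ?n \<Longrightarrow> f s t \<le> Q" for f
  proof -
    have entry: "sz (f s t) \<le> 4 * w + 1" if "s < ?n" "t < ?n" for s t
      using sz_nat_le[of "f s t"] length_binary_mono[OF f[OF that]] lQ by linarith
    have "sz (map (f s) [0..<?n]) \<le> 3 * ?l * (4 * w + 1 + 1) + 1" if "s < ?n" for s
    proof -
      have "sz (map (f s) [0..<?n]) \<le> length (map (f s) [0..<?n]) * (4 * w + 1 + 1) + 1"
        by (rule sz_le_length) (use entry[OF that] in auto)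
      also have "\<dots> \<le> 3 * ?l * (4 * w + 1 + 1) + 1"
        using n by (intro add_mono mult_le_mono) auto
      finally show ?thesis .
    qed
    then have "sz (?mat f) \<le> length (?mat f) * (3 * ?l * (4 * w + 1 + 1) + 1 + 1) + 1"
      by (intro sz_le_length) auto
    also have "\<dots> \<le> 3 * ?l * (3 * ?l * (4 * w + 1 + 1) + 1 + 1) + 1"
      using n by (intro add_mono mult_le_mono) auto
    finally show ?thesis unfolding B_def .
  qed
  have le_sum: "f s t \<le> Q" if "(\<Sum>t<?n. f s t) = Q" "t < ?n" for f :: "nat \<Rightarrow> nat \<Rightarrow> nat" and s t
    using member_le_sum[of t "{..<?n}" "f s"] that by auto
  have "sz ?m \<le> B" "sz ?p \<le> B"
    using mat[of "\<lambda>s t. q * m s t"] mat[of "\<lambda>s t. D * p s t"]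
      le_sum[of "\<lambda>s t. q * m s t", OF sums(1)] le_sum[of "\<lambda>s t. D * p s t", OF sums(2)] by blast+
  moreover have "sz Q \<le> 4 * w + 1" using sz_nat_le[of Q] lQ by linarith
  moreover have "certificate_bound ?l = 15 * ?l + 20 + (4 * w + 1) + 2 * B"
    unfolding certificate_bound_def Let_def w_def B_def ..
  ultimately have "sz ((lb, sl, pr), (e, k), Q, ?m, ?p) \<le> certificate_bound ?l"
    using szs unfolding sz_simps(1) by linarith
  with ver show ?thesis by blast
qed

lemma EPS_QUOTIENT_in_NP: "EPS_QUOTIENT \<in> NP"
proof -
  let ?V = "\<lambda>x w. verify x (from_tree (parse w))"
  have "ptime (\<lambda>p :: bool list \<times> bool list. [?V (fst p) (snd p)])"
    by (intro ptimes ptime_comp[OF ptime_verify, of "\<lambda>p. (fst p, from_tree (parse (snd p)))", simplified]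
        ptime_comp[OF ptime_from_tree_certificate] ptime_comp[OF ptime_parse])
  from ptime_computable_2[OF this]
  have "poly_time_computable 2 (\<lambda>ws. [?V (ws ! 0) (ws ! 1)])" .
  moreover have "pbound certificate_bound"
    unfolding certificate_bound_def Let_def by (intro pbound_intros)
  then obtain p where p: "\<And>n. certificate_bound n \<le> poly p n" unfolding pbound_def by blast
  moreover have "x \<in> EPS_QUOTIENT \<longleftrightarrow> (\<exists>w. length w \<le> poly p (length x) \<and> ?V x w)" for x
  proof
    assume "x \<in> EPS_QUOTIENT"
    then obtain w where w: "verify x w" "sz w \<le> certificate_bound (length x)" using certificate_exists by blast
    then have "length (bits (to_tree w)) \<le> poly p (length x)" using p order_trans by (auto simp: sz_def)
    then show "\<exists>w. length w \<le> poly p (length x) \<and> ?V x w"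
      using w(1) by (intro exI[of _ "bits (to_tree w)"]) simp
  next
    assume "\<exists>w. length w \<le> poly p (length x) \<and> ?V x w"
    then obtain w where "verify x w" by blast
    then have "certified x (fst (fst w)) (fst (snd (fst w))) (snd (snd (fst w))) (fst (fst (snd w))) (snd (fst (snd w)))
       (fst (snd (snd w))) (fst (snd (snd (snd w)))) (snd (snd (snd (snd w))))"
      unfolding verify_def certified_def .
    then show "x \<in> EPS_QUOTIENT" by (rule certified.in_EPS_QUOTIENT)
  qed
  ultimately show ?thesis unfolding NP_def mem_Collect_eq by (intro exI[of _ ?V] exI[of _ p]) blast
qed

section \<open>Hardness\<close>

text \<open>Membership of the constructed word only provides some instance with that code.
  Injectivity of the encodings identifies it with the constructed one, which gives the converse
  direction of both reductions.\<close>

lemma hardness: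
  assumes "A \<in> NP"
  shows "poly_time_reducible A (EPS_QUOTIENT_FIXED 5)" "poly_time_reducible A EPS_QUOTIENT"
proof -
  obtain K c where K: "2 \<le> K" and c: "ptime (\<lambda>x. enc_lmc (c x))" "\<And>x. valid_lmc_code (c x)"
    and iff: "\<And>x. has_eps_quotient_of_size (lmc_of_code (c x)) (real (K - 1) / real (4 * K)) 5 \<longleftrightarrow> x \<in> A"
    using NP_reduces_to_quotient[OF assms] by metis
  let ?e = "(K - 1, 4 * K)"
  have e: "valid_eps ?e" "fraction_value ?e = real (K - 1) / real (4 * K)"
    using K by (auto simp: valid_eps_def)
  have "x \<in> A \<longleftrightarrow> enc_lmc (c x) @ enc_fraction ?e \<in> EPS_QUOTIENT_FIXED 5" for x
  proof
    assume "x \<in> A"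
    then show "enc_lmc (c x) @ enc_fraction ?e \<in> EPS_QUOTIENT_FIXED 5"
      unfolding EPS_QUOTIENT_FIXED_def using iff c(2) e by (intro CollectI exI[of _ "c x"] exI[of _ ?e]) simp
  next
    assume "enc_lmc (c x) @ enc_fraction ?e \<in> EPS_QUOTIENT_FIXED 5"
    then obtain d f where eq: "enc_lmc (c x) @ enc_fraction ?e = enc_lmc d @ enc_fraction f"
      and q: "has_eps_quotient_of_size (lmc_of_code d) (fraction_value f) 5"
      unfolding EPS_QUOTIENT_FIXED_def by blast
    from enc_instance_fixed_inject[OF eq] q have "has_eps_quotient_of_size (lmc_of_code (c x)) (fraction_value ?e) 5"
      by simp
    then show "x \<in> A" unfolding e(2) iff .
  qed
  moreover have "poly_time_computable 1 (\<lambda>ws. enc_lmc (c (ws ! 0)) @ enc_fraction ?e)"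
    by (rule ptime_computable_1) (intro ptimes c(1))
  ultimately show "poly_time_reducible A (EPS_QUOTIENT_FIXED 5)"
    unfolding poly_time_reducible_def by (intro exI[of _ "\<lambda>x. enc_lmc (c x) @ enc_fraction ?e"]) simp
  have "x \<in> A \<longleftrightarrow> enc_lmc (c x) @ enc_fraction ?e @ enc_nat 5 \<in> EPS_QUOTIENT" for x
  proof
    assume "x \<in> A"
    then show "enc_lmc (c x) @ enc_fraction ?e @ enc_nat 5 \<in> EPS_QUOTIENT"
      unfolding EPS_QUOTIENT_def using iff c(2) e by (intro CollectI exI[of _ "c x"] exI[of _ ?e] exI[of _ 5]) simp
  next
    assume "enc_lmc (c x) @ enc_fraction ?e @ enc_nat 5 \<in> EPS_QUOTIENT"
    then obtain d f k where eq: "enc_lmc (c x) @ enc_fraction ?e @ enc_nat 5 = enc_lmc d @ enc_fraction f @ enc_nat k"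
      and q: "has_eps_quotient_of_size (lmc_of_code d) (fraction_value f) k"
      unfolding EPS_QUOTIENT_def by blast
    from enc_instance_inject[OF eq] q have "has_eps_quotient_of_size (lmc_of_code (c x)) (fraction_value ?e) 5"
      by simp
    then show "x \<in> A" unfolding e(2) iff .
  qed
  moreover have "poly_time_computable 1 (\<lambda>ws. enc_lmc (c (ws ! 0)) @ enc_fraction ?e @ enc_nat 5)"
    by (rule ptime_computable_1) (intro ptimes c(1))
  ultimately show "poly_time_reducible A EPS_QUOTIENT"
    unfolding poly_time_reducible_def by (intro exI[of _ "\<lambda>x. enc_lmc (c x) @ enc_fraction ?e @ enc_nat 5"]) simp
qed

theorem theorem1:
  shows "NP_complete EPS_QUOTIENT \<and> NP_hard (EPS_QUOTIENT_FIXED 5)"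
  unfolding NP_complete_def NP_hard_def using EPS_QUOTIENT_in_NP hardness by blast

end
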